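(* Let $F\colon\mathsf{A}\to\mathsf{B}$ be a definable functor between finitely accessible categories with products, and suppose that $F$ admits a left adjoint $\Lambda\colon\mathsf{B}\to\mathsf{A}$. Then there are isomorphisms \[ \mathrm{PExt}_{\mathsf{B}}^{n}(B,F(A))\simeq \mathrm{PExt}_{\mathsf{A}}^{n}(\Lambda(B),A) \] for all $A\in\mathsf{A}$, $B\in\mathsf{B}$ and $n\geq 0$.
   Context: All categories are preadditive and all functors additive. A category $\mathsf{A}$ is finitely accessible with products if it has all direct limits (filtered colimits), the full subcategory $\mathsf{fp}(\mathsf{A})$ of finitely presented objects is skeletally small, every object is a direct limit of finitely presented objects, and $\mathsf{A}$ has products. A functor between finitely accessible categories with products is definable if it preserves filtered colimits and products. A sequence $0\to X\to Y\to Z\to 0$ in $\mathsf{A}$ is pure exact if $0\to \mathrm{Hom}(C,X)\to\mathrm{Hom}(C,Y)\to\mathrm{Hom}(C,Z)\to 0$ is exact for all $C\in\mathsf{fp}(\mathsf{A})$; then $X\to Y$ is a pure monomorphism and $Y\to Z$ a pure epimorphism. An object $X$ is pure injective (resp. pure projective) if every pure monomorphism out of $X$ (resp. every pure epimorphism onto $X$) splits. Every object has pure projective and pure injective resolutions, and $\mathrm{PExt}^n_{\mathsf{A}}(-,-)$ denotes the derived functors of $\mathrm{Hom}_{\mathsf{A}}$ with respect to these resolutions. *)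

theory Defs
  imports "HOL-Algebra.Coset"
begin

unbundle cardinal_syntax

section \<open>Size\<close>

text \<open>
  ``Small'' means ``of cardinality below a fixed strongly inaccessible cardinal \<open>\<kappa>\<close>'', i.e.\ small
  with respect to the Grothendieck universe of rank \<open>\<kappa>\<close>. Objects and arrows of the categories
  studied below may form sets of any size. Since \<open>Card_order \<kappa>\<close> gives \<open>|Field \<kappa>| =o \<kappa>\<close>, every
  small set is in bijection with a subset of \<open>Field \<kappa>\<close>, so it is no restriction to index
  products and filtered colimits by small sets of elements of the type underlying \<open>\<kappa>\<close>.
\<close>

definition inaccessible :: "'u rel \<Rightarrow> bool" where
  "inaccessible \<kappa> \<longleftrightarrow> Card_order \<kappa> \<and> natLeq <o \<kappa> \<and> regularCard \<kappa> \<and>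
     (\<forall>X :: 'u set. |X| <o \<kappa> \<longrightarrow> |Pow X| <o \<kappa>)"

section \<open>Categories and functors\<close>

record ('o, 'm) cat =
  Obj :: "'o set"
  Arr :: "'m set"
  Dom :: "'m \<Rightarrow> 'o"
  Cod :: "'m \<Rightarrow> 'o"
  Ident :: "'o \<Rightarrow> 'm"
  Comp :: "'m \<Rightarrow> 'm \<Rightarrow> 'm"  (infixl \<open>\<cdot>\<index>\<close> 70)

definition Hom :: "('o, 'm, 'z) cat_scheme \<Rightarrow> 'o \<Rightarrow> 'o \<Rightarrow> 'm set" where
  "Hom C x y = {f \<in> Arr C. Dom C f = x \<and> Cod C f = y}"

locale category =
  fixes C :: "('o, 'm, 'z) cat_scheme" (structure)
  assumes Dom_in_Obj: "f \<in> Arr C \<Longrightarrow> Dom C f \<in> Obj C"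
    and Cod_in_Obj: "f \<in> Arr C \<Longrightarrow> Cod C f \<in> Obj C"
    and Ident_in_Hom: "x \<in> Obj C \<Longrightarrow> Ident C x \<in> Hom C x x"
    and Comp_in_Hom: "\<lbrakk>g \<in> Hom C y z; f \<in> Hom C x y\<rbrakk> \<Longrightarrow> g \<cdot> f \<in> Hom C x z"
    and Ident_Comp: "f \<in> Hom C x y \<Longrightarrow> Ident C y \<cdot> f = f"
    and Comp_Ident: "f \<in> Hom C x y \<Longrightarrow> f \<cdot> Ident C x = f"
    and Comp_assoc: "\<lbrakk>h \<in> Hom C z w; g \<in> Hom C y z; f \<in> Hom C x y\<rbrakk> \<Longrightarrow> h \<cdot> g \<cdot> f = h \<cdot> (g \<cdot> f)"

record ('o, 'm) precat = "('o, 'm) cat" +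
  Plus :: "'m \<Rightarrow> 'm \<Rightarrow> 'm"
  Zero :: "'o \<Rightarrow> 'o \<Rightarrow> 'm"

definition hom_group :: "('o, 'm, 'z) precat_scheme \<Rightarrow> 'o \<Rightarrow> 'o \<Rightarrow> 'm monoid" where
  "hom_group C x y = \<lparr>carrier = Hom C x y, mult = Plus C, one = Zero C x y\<rparr>"

locale preadditive_category = category C
  for C :: "('o, 'm, 'z) precat_scheme" (structure) +
  assumes comm_group_hom_group: "\<lbrakk>x \<in> Obj C; y \<in> Obj C\<rbrakk> \<Longrightarrow> comm_group (hom_group C x y)"
    and Comp_Plus: "\<lbrakk>h \<in> Hom C y z; f \<in> Hom C x y; g \<in> Hom C x y\<rbrakk>
      \<Longrightarrow> h \<cdot> Plus C f g = Plus C (h \<cdot> f) (h \<cdot> g)"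
    and Plus_Comp: "\<lbrakk>f \<in> Hom C y z; g \<in> Hom C y z; h \<in> Hom C x y\<rbrakk>
      \<Longrightarrow> Plus C f g \<cdot> h = Plus C (f \<cdot> h) (g \<cdot> h)"

record ('o1, 'm1, 'o2, 'm2) func =
  FObj :: "'o1 \<Rightarrow> 'o2"
  FArr :: "'m1 \<Rightarrow> 'm2"

definition is_functor ::
  "('o1, 'm1, 'z1) cat_scheme \<Rightarrow> ('o2, 'm2, 'z2) cat_scheme \<Rightarrow> ('o1, 'm1, 'o2, 'm2) func \<Rightarrow> bool"
where
  "is_functor C D F \<longleftrightarrow>
     (\<forall>x \<in> Obj C. FObj F x \<in> Obj D) \<and>
     (\<forall>x y. \<forall>f \<in> Hom C x y. FArr F f \<in> Hom D (FObj F x) (FObj F y)) \<and>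
     (\<forall>x \<in> Obj C. FArr F (Ident C x) = Ident D (FObj F x)) \<and>
     (\<forall>x y z. \<forall>g \<in> Hom C y z. \<forall>f \<in> Hom C x y.
        FArr F (g \<cdot>\<^bsub>C\<^esub> f) = FArr F g \<cdot>\<^bsub>D\<^esub> FArr F f)"

definition additive_functor ::
  "('o1, 'm1, 'z1) precat_scheme \<Rightarrow> ('o2, 'm2, 'z2) precat_scheme \<Rightarrow> ('o1, 'm1, 'o2, 'm2) func \<Rightarrow> bool"
where
  "additive_functor C D F \<longleftrightarrow> is_functor C D F \<and>
     (\<forall>x y. \<forall>f \<in> Hom C x y. \<forall>g \<in> Hom C x y.
        FArr F (Plus C f g) = Plus D (FArr F f) (FArr F g))"

text \<open>\<open>\<Lambda> : D \<rightarrow> C\<close> is left adjoint to \<open>F : C \<rightarrow> D\<close>, through bijections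
  \<open>Hom C (\<Lambda> d) c \<rightarrow> Hom D d (F c)\<close> natural in \<open>d\<close> and \<open>c\<close>.\<close>

definition left_adjoint ::
  "('o1, 'm1, 'z1) cat_scheme \<Rightarrow> ('o2, 'm2, 'z2) cat_scheme \<Rightarrow>
   ('o2, 'm2, 'o1, 'm1) func \<Rightarrow> ('o1, 'm1, 'o2, 'm2) func \<Rightarrow> bool"
where
  "left_adjoint C D \<Lambda> F \<longleftrightarrow> (\<exists>\<phi>.
     (\<forall>d \<in> Obj D. \<forall>c \<in> Obj C. bij_betw (\<phi> d c) (Hom C (FObj \<Lambda> d) c) (Hom D d (FObj F c))) \<and>
     (\<forall>d d' c c'. \<forall>g \<in> Hom D d' d. \<forall>h \<in> Hom C c c'. \<forall>f \<in> Hom C (FObj \<Lambda> d) c.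
        \<phi> d' c' (h \<cdot>\<^bsub>C\<^esub> f \<cdot>\<^bsub>C\<^esub> FArr \<Lambda> g) = FArr F h \<cdot>\<^bsub>D\<^esub> \<phi> d c f \<cdot>\<^bsub>D\<^esub> g))"

section \<open>Products and filtered colimits\<close>

definition is_product ::
  "('o, 'm, 'z) cat_scheme \<Rightarrow> 'i set \<Rightarrow> ('i \<Rightarrow> 'o) \<Rightarrow> 'o \<Rightarrow> ('i \<Rightarrow> 'm) \<Rightarrow> bool"
where
  "is_product C I X p \<pi> \<longleftrightarrow> p \<in> Obj C \<and> (\<forall>i \<in> I. \<pi> i \<in> Hom C p (X i)) \<and>
     (\<forall>c \<in> Obj C. \<forall>f. (\<forall>i \<in> I. f i \<in> Hom C c (X i)) \<longrightarrow>
        (\<exists>!g. g \<in> Hom C c p \<and> (\<forall>i \<in> I. \<pi> i \<cdot>\<^bsub>C\<^esub> g = f i)))"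

definition small_filtered :: "'u rel \<Rightarrow> ('u, 'u) cat \<Rightarrow> bool" where
  "small_filtered \<kappa> J \<longleftrightarrow> category J \<and> |Obj J| <o \<kappa> \<and> |Arr J| <o \<kappa> \<and>
     Obj J \<noteq> {} \<and>
     (\<forall>i \<in> Obj J. \<forall>j \<in> Obj J. \<exists>k. Hom J i k \<noteq> {} \<and> Hom J j k \<noteq> {}) \<and>
     (\<forall>i j. \<forall>u \<in> Hom J i j. \<forall>v \<in> Hom J i j. \<exists>k. \<exists>w \<in> Hom J j k. w \<cdot>\<^bsub>J\<^esub> u = w \<cdot>\<^bsub>J\<^esub> v)"

definition is_cocone ::
  "('i, 'j) cat \<Rightarrow> ('o, 'm, 'z) cat_scheme \<Rightarrow> ('i, 'j, 'o, 'm) func \<Rightarrow> 'o \<Rightarrow> ('i \<Rightarrow> 'm) \<Rightarrow> bool"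
where
  "is_cocone J C D c \<iota> \<longleftrightarrow> c \<in> Obj C \<and> (\<forall>j \<in> Obj J. \<iota> j \<in> Hom C (FObj D j) c) \<and>
     (\<forall>i j. \<forall>u \<in> Hom J i j. \<iota> j \<cdot>\<^bsub>C\<^esub> FArr D u = \<iota> i)"

definition is_colimit ::
  "('i, 'j) cat \<Rightarrow> ('o, 'm, 'z) cat_scheme \<Rightarrow> ('i, 'j, 'o, 'm) func \<Rightarrow> 'o \<Rightarrow> ('i \<Rightarrow> 'm) \<Rightarrow> bool"
where
  "is_colimit J C D c \<iota> \<longleftrightarrow> is_cocone J C D c \<iota> \<and>
     (\<forall>x \<tau>. is_cocone J C D x \<tau> \<longrightarrow>
        (\<exists>!h. h \<in> Hom C c x \<and> (\<forall>j \<in> Obj J. h \<cdot>\<^bsub>C\<^esub> \<iota> j = \<tau> j)))"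

definition preserves_products ::
  "'u rel \<Rightarrow> ('o1, 'm1, 'z1) cat_scheme \<Rightarrow> ('o2, 'm2, 'z2) cat_scheme \<Rightarrow>
   ('o1, 'm1, 'o2, 'm2) func \<Rightarrow> bool"
where
  "preserves_products \<kappa> C D F \<longleftrightarrow>
     (\<forall>(I :: 'u set) X p \<pi>. |I| <o \<kappa> \<and> (\<forall>i \<in> I. X i \<in> Obj C) \<and> is_product C I X p \<pi> \<longrightarrow>
        is_product D I (\<lambda>i. FObj F (X i)) (FObj F p) (\<lambda>i. FArr F (\<pi> i)))"

definition preserves_filtered_colimits ::
  "'u rel \<Rightarrow> ('o1, 'm1, 'z1) cat_scheme \<Rightarrow> ('o2, 'm2, 'z2) cat_scheme \<Rightarrow>
   ('o1, 'm1, 'o2, 'm2) func \<Rightarrow> bool"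
where
  "preserves_filtered_colimits \<kappa> C D F \<longleftrightarrow>
     (\<forall>(J :: ('u, 'u) cat) T c \<iota>.
        small_filtered \<kappa> J \<and> is_functor J C T \<and> is_colimit J C T c \<iota> \<longrightarrow>
        is_colimit J D \<lparr>FObj = FObj F \<circ> FObj T, FArr = FArr F \<circ> FArr T\<rparr>
          (FObj F c) (\<lambda>j. FArr F (\<iota> j)))"

section \<open>Finitely accessible categories with products\<close>

text \<open>
  An object \<open>x\<close> is finitely presented if \<open>Hom(x, -)\<close> preserves filtered colimits, that is, if the
  canonical map from \<open>colim\<^sub>j Hom(x, T j)\<close> to \<open>Hom(x, colim T)\<close> is surjective and injective. The
  filtered colimit of sets on the left consists of pairs \<open>(j, f)\<close> with \<open>f \<in> Hom(x, T j)\<close>, where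
  \<open>(i, f)\<close> and \<open>(j, g)\<close> are identified if they become equal at some later stage \<open>k\<close>.
\<close>

definition fp :: "'u rel \<Rightarrow> ('o, 'm, 'z) cat_scheme \<Rightarrow> 'o set" where
  "fp \<kappa> C = {x \<in> Obj C.
     \<forall>(J :: ('u, 'u) cat) T c \<iota>.
       small_filtered \<kappa> J \<and> is_functor J C T \<and> is_colimit J C T c \<iota> \<longrightarrow>
       (\<forall>h \<in> Hom C x c. \<exists>j \<in> Obj J. \<exists>f \<in> Hom C x (FObj T j). \<iota> j \<cdot>\<^bsub>C\<^esub> f = h) \<and>
       (\<forall>i \<in> Obj J. \<forall>j \<in> Obj J. \<forall>f \<in> Hom C x (FObj T i). \<forall>g \<in> Hom C x (FObj T j).
          \<iota> i \<cdot>\<^bsub>C\<^esub> f = \<iota> j \<cdot>\<^bsub>C\<^esub> g \<longrightarrow>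
          (\<exists>k. \<exists>u \<in> Hom J i k. \<exists>v \<in> Hom J j k. FArr T u \<cdot>\<^bsub>C\<^esub> f = FArr T v \<cdot>\<^bsub>C\<^esub> g))}"

definition isomorphic :: "('o, 'm, 'z) cat_scheme \<Rightarrow> 'o \<Rightarrow> 'o \<Rightarrow> bool" where
  "isomorphic C x y \<longleftrightarrow> (\<exists>f \<in> Hom C x y. \<exists>g \<in> Hom C y x.
     g \<cdot>\<^bsub>C\<^esub> f = Ident C x \<and> f \<cdot>\<^bsub>C\<^esub> g = Ident C y)"

text \<open>As usual, categories have small Hom-sets; this is made explicit in \<open>locally_small\<close>.\<close>

locale finitely_accessible_with_products = preadditive_category C
  for \<kappa> :: "'u rel" and C :: "('o, 'm, 'z) precat_scheme" (structure) +
  assumes locally_small: "\<lbrakk>x \<in> Obj C; y \<in> Obj C\<rbrakk> \<Longrightarrow> |Hom C x y| <o \<kappa>"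
    and has_filtered_colimits:
      "\<And>(J :: ('u, 'u) cat) T. \<lbrakk>small_filtered \<kappa> J; is_functor J C T\<rbrakk> \<Longrightarrow> \<exists>c \<iota>. is_colimit J C T c \<iota>"
    and fp_skeletally_small:
      "\<exists>S \<subseteq> fp \<kappa> C. |S| <o \<kappa> \<and> (\<forall>x \<in> fp \<kappa> C. \<exists>y \<in> S. isomorphic C x y)"
    and filtered_colimit_of_fp:
      "x \<in> Obj C \<Longrightarrow> \<exists>(J :: ('u, 'u) cat) T \<iota>. small_filtered \<kappa> J \<and> is_functor J C T \<and>
         (\<forall>j \<in> Obj J. FObj T j \<in> fp \<kappa> C) \<and> is_colimit J C T x \<iota>"
    and has_products:
      "\<And>(I :: 'u set) X. \<lbrakk>|I| <o \<kappa>; \<forall>i \<in> I. X i \<in> Obj C\<rbrakk> \<Longrightarrow> \<exists>p \<pi>. is_product C I X p \<pi>"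

definition definable_functor ::
  "'u rel \<Rightarrow> ('o1, 'm1, 'z1) precat_scheme \<Rightarrow> ('o2, 'm2, 'z2) precat_scheme \<Rightarrow>
   ('o1, 'm1, 'o2, 'm2) func \<Rightarrow> bool"
where
  "definable_functor \<kappa> C D F \<longleftrightarrow> additive_functor C D F \<and>
     preserves_filtered_colimits \<kappa> C D F \<and> preserves_products \<kappa> C D F"

section \<open>Purity\<close>

text \<open>\<open>exact_at C c x y z f g\<close>: the sequence \<open>Hom(c, x) \<rightarrow> Hom(c, y) \<rightarrow> Hom(c, z)\<close> induced by
  \<open>f : x \<rightarrow> y\<close> and \<open>g : y \<rightarrow> z\<close> is exact at \<open>Hom(c, y)\<close>.\<close>

definition exact_at ::
  "('o, 'm, 'z) precat_scheme \<Rightarrow> 'o \<Rightarrow> 'o \<Rightarrow> 'o \<Rightarrow> 'o \<Rightarrow> 'm \<Rightarrow> 'm \<Rightarrow> bool"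
where
  "exact_at C c x y z f g \<longleftrightarrow>
     (\<lambda>h. f \<cdot>\<^bsub>C\<^esub> h) ` Hom C c x = kernel (hom_group C c y) (hom_group C c z) (\<lambda>h. g \<cdot>\<^bsub>C\<^esub> h)"

definition pure_exact ::
  "'u rel \<Rightarrow> ('o, 'm, 'z) precat_scheme \<Rightarrow> 'o \<Rightarrow> 'o \<Rightarrow> 'o \<Rightarrow> 'm \<Rightarrow> 'm \<Rightarrow> bool"
where
  "pure_exact \<kappa> C x y z f g \<longleftrightarrow> f \<in> Hom C x y \<and> g \<in> Hom C y z \<and>
     (\<forall>c \<in> fp \<kappa> C.
        inj_on (\<lambda>h. f \<cdot>\<^bsub>C\<^esub> h) (Hom C c x) \<and>
        exact_at C c x y z f g \<and>
        (\<lambda>h. g \<cdot>\<^bsub>C\<^esub> h) ` Hom C c y = Hom C c z)"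

definition pure_epi :: "'u rel \<Rightarrow> ('o, 'm, 'z) precat_scheme \<Rightarrow> 'o \<Rightarrow> 'o \<Rightarrow> 'm \<Rightarrow> bool" where
  "pure_epi \<kappa> C y z g \<longleftrightarrow> (\<exists>x f. pure_exact \<kappa> C x y z f g)"

definition pure_projective :: "'u rel \<Rightarrow> ('o, 'm, 'z) precat_scheme \<Rightarrow> 'o \<Rightarrow> bool" where
  "pure_projective \<kappa> C p \<longleftrightarrow> p \<in> Obj C \<and>
     (\<forall>y g. pure_epi \<kappa> C y p g \<longrightarrow> (\<exists>s \<in> Hom C p y. g \<cdot>\<^bsub>C\<^esub> s = Ident C p))"

text \<open>A pure projective resolution \<open>\<dots> \<rightarrow> P 1 \<rightarrow> P 0 \<rightarrow> x \<rightarrow> 0\<close>, with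
  \<open>d n : P (n + 1) \<rightarrow> P n\<close> and augmentation \<open>e : P 0 \<rightarrow> x\<close>: pure exactness of the long sequence
  means, as for short sequences, exactness under \<open>Hom(c, -)\<close> for all finitely presented \<open>c\<close>.\<close>

definition pure_projective_resolution ::
  "'u rel \<Rightarrow> ('o, 'm, 'z) precat_scheme \<Rightarrow> 'o \<Rightarrow> (nat \<Rightarrow> 'o) \<Rightarrow> (nat \<Rightarrow> 'm) \<Rightarrow> 'm \<Rightarrow> bool"
where
  "pure_projective_resolution \<kappa> C x P d e \<longleftrightarrow>
     (\<forall>n. pure_projective \<kappa> C (P n)) \<and>
     (\<forall>n. d n \<in> Hom C (P (Suc n)) (P n)) \<and>
     e \<in> Hom C (P 0) x \<and>
     (\<forall>c \<in> fp \<kappa> C.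
        (\<lambda>h. e \<cdot>\<^bsub>C\<^esub> h) ` Hom C c (P 0) = Hom C c x \<and>
        exact_at C c (P 1) (P 0) x (d 0) e \<and>
        (\<forall>n. exact_at C c (P (Suc (Suc n))) (P (Suc n)) (P n) (d (Suc n)) (d n)))"

section \<open>Derived functors\<close>

text \<open>Cohomology of a cochain complex \<open>0 \<rightarrow> G 0 \<rightarrow> G 1 \<rightarrow> \<dots>\<close> with \<open>\<delta> n : G n \<rightarrow> G (n + 1)\<close>.\<close>

definition cohomology :: "(nat \<Rightarrow> 'a monoid) \<Rightarrow> (nat \<Rightarrow> 'a \<Rightarrow> 'a) \<Rightarrow> nat \<Rightarrow> 'a set monoid" where
  "cohomology G \<delta> n =
     (G n)\<lparr>carrier := kernel (G n) (G (Suc n)) (\<delta> n)\<rparr> Mod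
       (case n of 0 \<Rightarrow> {\<one>\<^bsub>G 0\<^esub>} | Suc m \<Rightarrow> \<delta> m ` carrier (G m))"

text \<open>
  \<open>PExt \<kappa> C n x y\<close> is the cohomology of \<open>Hom(P\<^sub>*, y)\<close> for a chosen pure projective resolution
  \<open>P\<^sub>*\<close> of \<open>x\<close>; the choice depends on \<open>\<kappa>\<close>, \<open>C\<close> and \<open>x\<close> only.
\<close>

definition PExt ::
  "'u rel \<Rightarrow> ('o, 'm, 'z) precat_scheme \<Rightarrow> nat \<Rightarrow> 'o \<Rightarrow> 'o \<Rightarrow> 'm set monoid"
where
  "PExt \<kappa> C n x y =
     (let (P, d, e) = (SOME (P, d, e). pure_projective_resolution \<kappa> C x P d e)
      in cohomology (\<lambda>k. hom_group C (P k) y) (\<lambda>k f. f \<cdot>\<^bsub>C\<^esub> d k) n)"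

end

theory Submission
  imports Defs "HOL-Algebra.FiniteProduct"
begin

text \<open>
  Write \<open>x\<close> for an object of \<open>B\<close> and \<open>y\<close> for an object of \<open>A\<close>. If \<open>P \<rightarrow> x\<close> is a pure projective
  resolution in \<open>B\<close>, then \<open>\<Lambda> P \<rightarrow> \<Lambda> x\<close> is a pure projective resolution in \<open>A\<close>
  (\<open>\<Lambda>_resolution\<close>). The adjunction identifies the complexes \<open>Hom(P, F y)\<close> and \<open>Hom(\<Lambda> P, y)\<close>, hence
  their cohomology groups (\<open>adjoint_cohomology\<close>). As \<open>PExt\<close> is computed from one chosen resolution,
  one also needs that resolutions exist (\<open>resolution_exists\<close>) and that the cohomology does not
  depend on the choice (\<open>resolution_independence\<close>).

  Why \<open>\<Lambda> P\<close> is again such a resolution. Since \<open>F\<close> preserves filtered colimits, \<open>\<Lambda>\<close> preserves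
  finitely presented objects (\<open>\<Lambda>_fp\<close>). Pure projectivity of \<open>P\<close> is equivalent to a lifting property
  that can be tested on maps from finitely presented objects (\<open>pure_projective_iff_lifting\<close>), and
  this property passes through the adjunction (\<open>\<Lambda>_pure_lifting\<close>). The main point is exactness
  (\<open>\<Lambda>_fp_exact\<close>). A pure exact sequence is a filtered colimit of split exact sequences and \<open>\<Lambda>\<close>
  preserves filtered colimits; the proof does this on elements. A map \<open>c \<rightarrow> \<Lambda> P\<^sub>n\<close> with \<open>c\<close> finitely
  presented comes from some \<open>c \<rightarrow> \<Lambda> D\<close> and \<open>k : D \<rightarrow> P\<^sub>n\<close> with \<open>D\<close> finitely presented. If it is a
  cycle, then \<open>k\<close> can be changed to a cycle without changing the given map, because the kernels
  occurring in a pure exact complex are flat: each relation that holds in the kernel already holds at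
  a finitely presented stage inside the kernel (\<open>kernel_factorization\<close>).

  The same flatness carries the theory of pure projective objects. A flat additive subfunctor of
  \<open>Hom(-, p)\<close> on the finitely presented objects is represented by the colimit of its category of
  elements, which is filtered (\<open>flat_subfunctor_representable\<close>). Applied to the arrows into a product
  with finitely many nonzero coordinates this gives coproducts of finitely presented objects
  (\<open>coproduct_exists\<close>); applied to the arrows killed by a given one it gives kernels of pure
  epimorphisms (\<open>kernel_exists\<close>). Coproducts provide enough pure projectives (\<open>pure_cover\<close>), and
  kernels are needed since an epimorphism counts as pure only as part of a short pure exact
  sequence. From there on, the comparison of resolutions is the classical one.
\<close>

section \<open>Calculus in preadditive categories\<close>

lemma ex1_unique: "\<exists>!x. P x \<Longrightarrow> P x \<Longrightarrow> P y \<Longrightarrow> x = y"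
  by blast

lemma Hom_iff: "f \<in> Hom C x y \<longleftrightarrow> f \<in> Arr C \<and> Dom C f = x \<and> Cod C f = y"
  by (auto simp: Hom_def)

lemma ArrD_Hom: "f \<in> Arr C \<Longrightarrow> f \<in> Hom C (Dom C f) (Cod C f)"
  by (simp add: Hom_iff)

context category
begin

lemma Hom_Obj: assumes "f \<in> Hom C x y" shows "x \<in> Obj C" "y \<in> Obj C"
  using assms Dom_in_Obj Cod_in_Obj by (auto simp: Hom_iff)

lemma Comp_simps [simp]:
  assumes "g \<in> Arr C" "f \<in> Arr C" "Cod C f = Dom C g"
  shows "g \<cdot> f \<in> Arr C" "Dom C (g \<cdot> f) = Dom C f" "Cod C (g \<cdot> f) = Cod C g"
  using Comp_in_Hom[of g "Dom C g" "Cod C g" f "Dom C f"] assms by (auto simp: Hom_iff)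

lemma Ident_simps [simp]:
  assumes "x \<in> Obj C"
  shows "Ident C x \<in> Arr C" "Dom C (Ident C x) = x" "Cod C (Ident C x) = x"
  using Ident_in_Hom[OF assms] by (auto simp: Hom_iff)

lemma Dom_Cod_Obj [simp]: "f \<in> Arr C \<Longrightarrow> Dom C f \<in> Obj C" "f \<in> Arr C \<Longrightarrow> Cod C f \<in> Obj C"
  by (simp_all add: Dom_in_Obj Cod_in_Obj)

lemma Comp_units [simp]:
  "\<lbrakk>f \<in> Arr C; Cod C f = y\<rbrakk> \<Longrightarrow> Ident C y \<cdot> f = f"
  "\<lbrakk>f \<in> Arr C; Dom C f = x\<rbrakk> \<Longrightarrow> f \<cdot> Ident C x = f"
  using Ident_Comp Comp_Ident by (auto simp: Hom_iff)

lemma Comp_assoc_right [simp]: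
  assumes "h \<in> Arr C" "g \<in> Arr C" "f \<in> Arr C" "Cod C f = Dom C g" "Cod C g = Dom C h"
  shows "h \<cdot> g \<cdot> f = h \<cdot> (g \<cdot> f)"
  using Comp_assoc[of h "Dom C h" "Cod C h" g "Dom C g" f "Dom C f"] assms by (simp add: Hom_iff)

lemma Comp_eq_assoc:
  assumes "g \<cdot> f = h" "g \<in> Arr C" "f \<in> Arr C" "l \<in> Arr C" "Cod C f = Dom C g" "Cod C l = Dom C f"
  shows "g \<cdot> (f \<cdot> l) = h \<cdot> l"
  using Comp_assoc_right[of g f l] assms by simp

end

definition Sub :: "('o, 'm, 'z) precat_scheme \<Rightarrow> 'm \<Rightarrow> 'm \<Rightarrow> 'm" (infixl \<open>\<ominus>\<index>\<close> 65) where
  "Sub C f g = Plus C f (inv\<^bsub>hom_group C (Dom C f) (Cod C f)\<^esub> g)"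

abbreviation Add :: "('o, 'm, 'z) precat_scheme \<Rightarrow> 'm \<Rightarrow> 'm \<Rightarrow> 'm" (infixl \<open>\<oplus>\<index>\<close> 65) where
  "Add C f g \<equiv> Plus C f g"

lemma hom_group_simps [simp]:
  "carrier (hom_group C x y) = Hom C x y"
  "mult (hom_group C x y) = Plus C"
  "one (hom_group C x y) = Zero C x y"
  by (simp_all add: hom_group_def)

context preadditive_category
begin

lemma Zero_simps [simp]:
  assumes "x \<in> Obj C" "y \<in> Obj C"
  shows "Zero C x y \<in> Arr C" "Dom C (Zero C x y) = x" "Cod C (Zero C x y) = y"
proof -
  interpret comm_group "hom_group C x y" using comm_group_hom_group assms .
  show "Zero C x y \<in> Arr C" "Dom C (Zero C x y) = x" "Cod C (Zero C x y) = y"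
    using one_closed by (auto simp: Hom_iff)
qed

lemma Add_simps [simp]:
  assumes "f \<in> Arr C" "g \<in> Arr C" "Dom C f = Dom C g" "Cod C f = Cod C g"
  shows "f \<oplus> g \<in> Arr C" "Dom C (f \<oplus> g) = Dom C g" "Cod C (f \<oplus> g) = Cod C g"
proof -
  interpret comm_group "hom_group C (Dom C g) (Cod C g)" using comm_group_hom_group assms by simp
  show "f \<oplus> g \<in> Arr C" "Dom C (f \<oplus> g) = Dom C g" "Cod C (f \<oplus> g) = Cod C g"
    using m_closed[of f g] assms by (auto simp: Hom_iff)
qed

lemma Sub_simps [simp]:
  assumes "f \<in> Arr C" "g \<in> Arr C" "Dom C f = Dom C g" "Cod C f = Cod C g"
  shows "f \<ominus> g \<in> Arr C" "Dom C (f \<ominus> g) = Dom C g" "Cod C (f \<ominus> g) = Cod C g"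
proof -
  interpret comm_group "hom_group C (Dom C g) (Cod C g)" using comm_group_hom_group assms by simp
  show "f \<ominus> g \<in> Arr C" "Dom C (f \<ominus> g) = Dom C g" "Cod C (f \<ominus> g) = Cod C g"
    using m_closed[of f "inv\<^bsub>hom_group C (Dom C f) (Cod C f)\<^esub> g"] assms inv_closed[of g]
    by (auto simp: Hom_iff Sub_def)
qed

lemma Add_Zero [simp]:
  assumes "f \<in> Arr C" "Dom C f = x" "Cod C f = y"
  shows "f \<oplus> Zero C x y = f" "Zero C x y \<oplus> f = f"
proof -
  interpret comm_group "hom_group C x y" using comm_group_hom_group assms by auto
  show "f \<oplus> Zero C x y = f" "Zero C x y \<oplus> f = f"
    using l_one[of f] r_one[of f] assms by (auto simp: Hom_iff)
qed

lemma Add_commute: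
  assumes "f \<in> Arr C" "g \<in> Arr C" "Dom C f = Dom C g" "Cod C f = Cod C g"
  shows "f \<oplus> g = g \<oplus> f"
proof -
  interpret comm_group "hom_group C (Dom C g) (Cod C g)" using comm_group_hom_group assms by simp
  show ?thesis using m_comm[of f g] assms by (auto simp: Hom_iff)
qed

lemma Sub_eq_iff:
  assumes "f \<in> Arr C" "g \<in> Arr C" "h \<in> Arr C"
    "Dom C f = Dom C g" "Cod C f = Cod C g" "Dom C h = Dom C g" "Cod C h = Cod C g"
  shows "f \<ominus> g = h \<longleftrightarrow> f = h \<oplus> g"
proof -
  interpret comm_group "hom_group C (Dom C g) (Cod C g)" using comm_group_hom_group assms by simp
  show ?thesis using inv_solve_right[of h f g] assms by (simp add: Hom_iff Sub_def) metis
qed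

lemma Sub_Add_cancel [simp]:
  assumes "f \<in> Arr C" "g \<in> Arr C" "Dom C f = Dom C g" "Cod C f = Cod C g"
  shows "f \<ominus> g \<oplus> g = f"
  using Sub_eq_iff[of f g "f \<ominus> g"] assms by simp

lemma Sub_Sub_self:
  assumes "f \<in> Arr C" "g \<in> Arr C" "Dom C f = Dom C g" "Cod C f = Cod C g"
  shows "f \<ominus> (f \<ominus> g) = g"
proof -
  have "g \<oplus> (f \<ominus> g) = f \<ominus> g \<oplus> g" by (rule Add_commute) (simp_all add: assms)
  also have "\<dots> = f" by (rule Sub_Add_cancel[OF assms])
  finally have eq: "f = g \<oplus> (f \<ominus> g)" by (rule sym)
  show ?thesis by (rule Sub_eq_iff[THEN iffD2, OF _ _ _ _ _ _ _ eq]) (simp_all add: assms)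
qed

lemma Sub_self [simp]: "\<lbrakk>f \<in> Arr C\<rbrakk> \<Longrightarrow> f \<ominus> f = Zero C (Dom C f) (Cod C f)"
  by (subst Sub_eq_iff) auto

lemma Sub_Zero [simp]: "\<lbrakk>f \<in> Arr C; Dom C f = x; Cod C f = y\<rbrakk> \<Longrightarrow> f \<ominus> Zero C x y = f"
  by (subst Sub_eq_iff) auto

lemma Sub_eq_Zero_iff:
  assumes "f \<in> Arr C" "g \<in> Arr C" "Dom C f = Dom C g" "Cod C f = Cod C g"
  shows "f \<ominus> g = Zero C (Dom C g) (Cod C g) \<longleftrightarrow> f = g"
  using assms by (subst Sub_eq_iff) auto

lemma Comp_Add [simp]:
  assumes "h \<in> Arr C" "f \<in> Arr C" "g \<in> Arr C" "Dom C f = Dom C g" "Cod C f = Cod C g" "Cod C g = Dom C h"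
  shows "h \<cdot> (f \<oplus> g) = h \<cdot> f \<oplus> h \<cdot> g"
  using Comp_Plus[of h "Dom C h" "Cod C h" f "Dom C g" g] assms by (simp add: Hom_iff)

lemma Add_Comp [simp]:
  assumes "h \<in> Arr C" "f \<in> Arr C" "g \<in> Arr C" "Dom C f = Dom C g" "Cod C f = Cod C g" "Cod C h = Dom C g"
  shows "(f \<oplus> g) \<cdot> h = f \<cdot> h \<oplus> g \<cdot> h"
  using Plus_Comp[of f "Dom C g" "Cod C g" g h "Dom C h"] assms by (simp add: Hom_iff)

lemma Comp_Sub [simp]:
  assumes "h \<in> Arr C" "f \<in> Arr C" "g \<in> Arr C" "Dom C f = Dom C g" "Cod C f = Cod C g" "Cod C g = Dom C h"
  shows "h \<cdot> (f \<ominus> g) = h \<cdot> f \<ominus> h \<cdot> g"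
proof -
  have "h \<cdot> f = h \<cdot> (f \<ominus> g) \<oplus> h \<cdot> g"
    using Comp_Add[of h "f \<ominus> g" g] assms by simp
  then show ?thesis using assms by (subst eq_commute, subst Sub_eq_iff) auto
qed

lemma Sub_Comp [simp]:
  assumes "h \<in> Arr C" "f \<in> Arr C" "g \<in> Arr C" "Dom C f = Dom C g" "Cod C f = Cod C g" "Cod C h = Dom C g"
  shows "(f \<ominus> g) \<cdot> h = f \<cdot> h \<ominus> g \<cdot> h"
proof -
  have "f \<cdot> h = (f \<ominus> g) \<cdot> h \<oplus> g \<cdot> h"
    using Add_Comp[of h "f \<ominus> g" g] assms by simp
  then show ?thesis using assms by (subst eq_commute, subst Sub_eq_iff) auto
qed

lemma Comp_Zero [simp]:
  assumes "h \<in> Arr C" "x \<in> Obj C" "Dom C h = y"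
  shows "h \<cdot> Zero C x y = Zero C x (Cod C h)"
  using Comp_Sub[of h "Zero C x y" "Zero C x y"] assms by auto

lemma Zero_Comp [simp]:
  assumes "h \<in> Arr C" "z \<in> Obj C" "Cod C h = y"
  shows "Zero C y z \<cdot> h = Zero C (Dom C h) z"
  using Sub_Comp[of h "Zero C y z" "Zero C y z"] assms by auto

end

lemma functor_simps:
  assumes "is_functor C D F"
  shows "x \<in> Obj C \<Longrightarrow> FObj F x \<in> Obj D"
    and "f \<in> Arr C \<Longrightarrow> FArr F f \<in> Arr D"
    and "f \<in> Arr C \<Longrightarrow> Dom D (FArr F f) = FObj F (Dom C f)"
    and "f \<in> Arr C \<Longrightarrow> Cod D (FArr F f) = FObj F (Cod C f)"
    and "x \<in> Obj C \<Longrightarrow> FArr F (Ident C x) = Ident D (FObj F x)"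
    and "\<lbrakk>g \<in> Arr C; f \<in> Arr C; Cod C f = Dom C g\<rbrakk> \<Longrightarrow> FArr F (g \<cdot>\<^bsub>C\<^esub> f) = FArr F g \<cdot>\<^bsub>D\<^esub> FArr F f"
proof -
  have H: "FArr F f \<in> Hom D (FObj F (Dom C f)) (FObj F (Cod C f))" if "f \<in> Arr C" for f
    using assms ArrD_Hom[OF that] unfolding is_functor_def by blast
  show "f \<in> Arr C \<Longrightarrow> FArr F f \<in> Arr D" "f \<in> Arr C \<Longrightarrow> Dom D (FArr F f) = FObj F (Dom C f)"
    "f \<in> Arr C \<Longrightarrow> Cod D (FArr F f) = FObj F (Cod C f)"
    using H[of f] by (simp_all add: Hom_iff)
  show "x \<in> Obj C \<Longrightarrow> FObj F x \<in> Obj D" "x \<in> Obj C \<Longrightarrow> FArr F (Ident C x) = Ident D (FObj F x)"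
    using assms by (simp_all add: is_functor_def)
  show "\<lbrakk>g \<in> Arr C; f \<in> Arr C; Cod C f = Dom C g\<rbrakk> \<Longrightarrow> FArr F (g \<cdot>\<^bsub>C\<^esub> f) = FArr F g \<cdot>\<^bsub>D\<^esub> FArr F f"
    using assms ArrD_Hom[of f C] ArrD_Hom[of g C] unfolding is_functor_def by metis
qed

lemma additive_functor_simps:
  assumes F: "additive_functor C D F" and "preadditive_category C" "preadditive_category D"
  shows "\<lbrakk>f \<in> Arr C; g \<in> Arr C; Dom C f = Dom C g; Cod C f = Cod C g\<rbrakk>
      \<Longrightarrow> FArr F (f \<oplus>\<^bsub>C\<^esub> g) = FArr F f \<oplus>\<^bsub>D\<^esub> FArr F g"
    and "\<lbrakk>f \<in> Arr C; g \<in> Arr C; Dom C f = Dom C g; Cod C f = Cod C g\<rbrakk>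
      \<Longrightarrow> FArr F (f \<ominus>\<^bsub>C\<^esub> g) = FArr F f \<ominus>\<^bsub>D\<^esub> FArr F g"
    and "\<lbrakk>x \<in> Obj C; y \<in> Obj C\<rbrakk> \<Longrightarrow> FArr F (Zero C x y) = Zero D (FObj F x) (FObj F y)"
proof -
  interpret C: preadditive_category C by fact
  interpret D: preadditive_category D by fact
  have Fu: "is_functor C D F" using F by (simp add: additive_functor_def)
  note S = functor_simps[OF Fu]
  have A: "FArr F (f \<oplus>\<^bsub>C\<^esub> g) = FArr F f \<oplus>\<^bsub>D\<^esub> FArr F g"
    if "f \<in> Arr C" "g \<in> Arr C" "Dom C f = Dom C g" "Cod C f = Cod C g" for f g
    using F that ArrD_Hom[of f C] ArrD_Hom[of g C] unfolding additive_functor_def by metis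
  have B: "FArr F (f \<ominus>\<^bsub>C\<^esub> g) = FArr F f \<ominus>\<^bsub>D\<^esub> FArr F g"
    if "f \<in> Arr C" "g \<in> Arr C" "Dom C f = Dom C g" "Cod C f = Cod C g" for f g
    using A[of "f \<ominus>\<^bsub>C\<^esub> g" g] that
    by (subst eq_commute, subst D.Sub_eq_iff) (simp_all add: S)
  show "FArr F (Zero C x y) = Zero D (FObj F x) (FObj F y)" if "x \<in> Obj C" "y \<in> Obj C" for x y
    using B[of "Zero C x y" "Zero C x y"] that by (simp add: S)
  show "\<lbrakk>f \<in> Arr C; g \<in> Arr C; Dom C f = Dom C g; Cod C f = Cod C g\<rbrakk>
      \<Longrightarrow> FArr F (f \<oplus>\<^bsub>C\<^esub> g) = FArr F f \<oplus>\<^bsub>D\<^esub> FArr F g" for f g by (rule A)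
  show "\<lbrakk>f \<in> Arr C; g \<in> Arr C; Dom C f = Dom C g; Cod C f = Cod C g\<rbrakk>
      \<Longrightarrow> FArr F (f \<ominus>\<^bsub>C\<^esub> g) = FArr F f \<ominus>\<^bsub>D\<^esub> FArr F g" for f g by (rule B)
qed

section \<open>Small sets\<close>

lemma small_image: "|X| <o \<kappa> \<Longrightarrow> |f ` X| <o \<kappa>"
  by (rule ordLeq_ordLess_trans[OF card_of_image])

context
  fixes \<kappa> :: "'u rel"
  assumes inacc: "inaccessible \<kappa>"
begin

lemma small_embedding:
  assumes "|X :: 'a set| <o \<kappa>" shows "\<exists>p :: 'a \<Rightarrow> 'u. inj_on p X"
proof -
  have "Card_order \<kappa>" using inacc by (simp add: inaccessible_def)
  then have "\<kappa> =o |Field \<kappa>|" by (rule ordIso_symmetric[OF card_of_Field_ordIso])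
  with ordLess_imp_ordLeq[OF assms] have "|X| \<le>o |Field \<kappa>|" by (rule ordLeq_ordIso_trans)
  then show ?thesis using card_of_ordLeq[of X "Field \<kappa>"] by blast
qed

lemma small_infinite: "Cinfinite \<kappa>" "infinite (Field \<kappa>)"
proof -
  have C: "Card_order \<kappa>" "natLeq <o \<kappa>" using inacc by (auto simp: inaccessible_def)
  have "cinfinite \<kappa>" using cinfinite_mono[OF ordLess_imp_ordLeq[OF C(2)] natLeq_cinfinite] .
  then show "Cinfinite \<kappa>" "infinite (Field \<kappa>)" using C by (simp_all add: cinfinite_def)
qed

lemma small_UN: "\<lbrakk>|I| <o \<kappa>; \<And>i. i \<in> I \<Longrightarrow> |A i| <o \<kappa>\<rbrakk> \<Longrightarrow> |\<Union>i\<in>I. A i| <o \<kappa>"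
  by (rule card_of_UNION_ordLess_infinite_Field_regularCard)
    (use small_infinite inacc in \<open>auto simp: inaccessible_def\<close>)

lemma small_Times: assumes "|X| <o \<kappa>" "|Y| <o \<kappa>" shows "|X \<times> Y| <o \<kappa>"
proof -
  have "|\<Union>x\<in>X. Pair x ` Y| <o \<kappa>" by (rule small_UN[OF assms(1) small_image[OF assms(2)]])
  moreover have "(\<Union>x\<in>X. Pair x ` Y) = X \<times> Y" by auto
  ultimately show ?thesis by simp
qed

lemma small_subset: "\<lbrakk>|Y| <o \<kappa>; X \<subseteq> Y\<rbrakk> \<Longrightarrow> |X| <o \<kappa>"
  by (rule ordLeq_ordLess_trans[OF card_of_mono1])

lemma small_finite: "finite X \<Longrightarrow> |X| <o \<kappa>"
  using inacc ordLess_transitive[of "|X|" natLeq \<kappa>]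
  by (simp add: inaccessible_def finite_iff_ordLess_natLeq)

end

lemma is_product_map:
  assumes "is_product C I X p \<pi>" "c \<in> Obj C" "\<And>i. i \<in> I \<Longrightarrow> f i \<in> Hom C c (X i)"
  shows "\<exists>!g. g \<in> Hom C c p \<and> (\<forall>i \<in> I. \<pi> i \<cdot>\<^bsub>C\<^esub> g = f i)"
  using assms unfolding is_product_def by simp

lemma is_colimit_map:
  assumes "is_colimit J C T c \<iota>" "is_cocone J C T x \<tau>"
  shows "\<exists>!h. h \<in> Hom C c x \<and> (\<forall>j \<in> Obj J. h \<cdot>\<^bsub>C\<^esub> \<iota> j = \<tau> j)"
  using assms unfolding is_colimit_def by simp

lemma fp_factors:
  fixes J :: "('u, 'u) cat" and \<kappa> :: "'u rel"
  assumes "x \<in> fp \<kappa> C" "small_filtered \<kappa> J" "is_functor J C T" "is_colimit J C T c \<iota>" "h \<in> Hom C x c"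
  shows "\<exists>j \<in> Obj J. \<exists>f \<in> Hom C x (FObj T j). \<iota> j \<cdot>\<^bsub>C\<^esub> f = h"
  using assms unfolding fp_def by simp

section \<open>Filtered colimits and products with arbitrary small index types\<close>

text \<open>
  The condition \<open>small_filtered\<close> for index categories whose objects and arrows have arbitrary types.
  Categories of elements, which index colimits below, live on the arrows of the given category and
  not on the type underlying \<open>\<kappa>\<close>.
\<close>

definition filtered_index :: "'u rel \<Rightarrow> ('i, 'j) cat \<Rightarrow> bool" where
  "filtered_index \<kappa> J \<longleftrightarrow> category J \<and> |Obj J| <o \<kappa> \<and> |Arr J| <o \<kappa> \<and>
     Obj J \<noteq> {} \<and>
     (\<forall>i \<in> Obj J. \<forall>j \<in> Obj J. \<exists>k. Hom J i k \<noteq> {} \<and> Hom J j k \<noteq> {}) \<and>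
     (\<forall>i j. \<forall>u \<in> Hom J i j. \<forall>v \<in> Hom J i j. \<exists>k. \<exists>w \<in> Hom J j k. w \<cdot>\<^bsub>J\<^esub> u = w \<cdot>\<^bsub>J\<^esub> v)"

text \<open>
  A small index category is isomorphic, along injections of its objects and arrows, to one on the
  type underlying \<open>\<kappa>\<close>; cocones and colimits are carried over unchanged.
\<close>

locale relabelling = category J for J :: "('i, 'j) cat" (structure) +
  fixes p :: "'i \<Rightarrow> 'u" and q :: "'j \<Rightarrow> 'u"
  assumes inj_p: "inj_on p (Obj J)" and inj_q: "inj_on q (Arr J)"
begin

abbreviation "p' \<equiv> inv_into (Obj J) p"
abbreviation "q' \<equiv> inv_into (Arr J) q"

definition relab :: "('u, 'u) cat" where
  "relab = \<lparr>Obj = p ` Obj J, Arr = q ` Arr J, Dom = (\<lambda>a. p (Dom J (q' a))),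
     Cod = (\<lambda>a. p (Cod J (q' a))), Ident = (\<lambda>i. q (Ident J (p' i))),
     Comp = (\<lambda>b a. q (q' b \<cdot> q' a))\<rparr>"

lemma relab_sel [simp]:
  "Obj relab = p ` Obj J" "Arr relab = q ` Arr J"
  "u \<in> Arr J \<Longrightarrow> Dom relab (q u) = p (Dom J u)"
  "u \<in> Arr J \<Longrightarrow> Cod relab (q u) = p (Cod J u)"
  "i \<in> Obj J \<Longrightarrow> Ident relab (p i) = q (Ident J i)"
  "\<lbrakk>u \<in> Arr J; v \<in> Arr J\<rbrakk> \<Longrightarrow> q v \<cdot>\<^bsub>relab\<^esub> q u = q (v \<cdot> u)"
  using inj_p inj_q by (simp_all add: relab_def)

lemma p_eq_iff [simp]: "\<lbrakk>i \<in> Obj J; j \<in> Obj J\<rbrakk> \<Longrightarrow> p i = p j \<longleftrightarrow> i = j"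
  using inj_p by (meson inj_onD)

lemma p'_p [simp]: "i \<in> Obj J \<Longrightarrow> p' (p i) = i" using inj_p by simp
lemma q'_q [simp]: "i \<in> Arr J \<Longrightarrow> q' (q i) = i" using inj_q by simp

lemma Hom_relabE:
  assumes "a \<in> Hom relab x y"
  obtains i j u where "u \<in> Hom J i j" "i \<in> Obj J" "j \<in> Obj J" "x = p i" "y = p j" "a = q u"
  using assms by (auto simp: Hom_iff)

lemma Hom_relabI: "u \<in> Hom J i j \<Longrightarrow> q u \<in> Hom relab (p i) (p j)"
  by (auto simp: Hom_iff)

lemma category_relab: "category relab"
proof
  fix f assume "f \<in> Arr relab"
  then show "Dom relab f \<in> Obj relab" "Cod relab f \<in> Obj relab" by auto
next
  fix x assume "x \<in> Obj relab"
  then show "Ident relab x \<in> Hom relab x x" by (auto simp: Hom_iff)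
next
  fix g f x y z assume "g \<in> Hom relab y z" "f \<in> Hom relab x y"
  then show "g \<cdot>\<^bsub>relab\<^esub> f \<in> Hom relab x z" by (auto simp: Hom_iff)
next
  fix f x y assume "f \<in> Hom relab x y"
  then show "Ident relab y \<cdot>\<^bsub>relab\<^esub> f = f" "f \<cdot>\<^bsub>relab\<^esub> Ident relab x = f" by (auto simp: Hom_iff)
next
  fix h g f x y z w
  assume "h \<in> Hom relab z w" "g \<in> Hom relab y z" "f \<in> Hom relab x y"
  then show "h \<cdot>\<^bsub>relab\<^esub> g \<cdot>\<^bsub>relab\<^esub> f = h \<cdot>\<^bsub>relab\<^esub> (g \<cdot>\<^bsub>relab\<^esub> f)" by (auto simp: Hom_iff)
qed

lemma small_filtered_relab:
  assumes "filtered_index \<kappa> J"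
  shows "small_filtered \<kappa> relab"
  unfolding small_filtered_def
proof (intro conjI ballI allI)
  show "category relab" by (rule category_relab)
  show "|Obj relab| <o \<kappa>" "|Arr relab| <o \<kappa>"
    using assms small_image by (auto simp: filtered_index_def)
  show "Obj relab \<noteq> {}" using assms by (simp add: filtered_index_def)
next
  fix x y assume "x \<in> Obj relab" "y \<in> Obj relab"
  then obtain i j where ij: "i \<in> Obj J" "j \<in> Obj J" "x = p i" "y = p j" by auto
  then obtain k u v where "u \<in> Hom J i k" "v \<in> Hom J j k"
    using assms unfolding filtered_index_def by blast
  then show "\<exists>k. Hom relab x k \<noteq> {} \<and> Hom relab y k \<noteq> {}" using ij Hom_relabI by blast
next
  fix x y a b assume "a \<in> Hom relab x y" "b \<in> Hom relab x y"
  then obtain i j u v where uv: "u \<in> Hom J i j" "v \<in> Hom J i j" "a = q u" "b = q v" "y = p j"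
    by (auto simp: Hom_iff)
  then obtain k w where w: "w \<in> Hom J j k" "w \<cdot> u = w \<cdot> v"
    using assms unfolding filtered_index_def by blast
  then have "q w \<in> Hom relab y (p k)" "q w \<cdot>\<^bsub>relab\<^esub> a = q w \<cdot>\<^bsub>relab\<^esub> b"
    using uv Hom_relabI by (auto simp: Hom_iff)
  then show "\<exists>k. \<exists>w\<in>Hom relab y k. w \<cdot>\<^bsub>relab\<^esub> a = w \<cdot>\<^bsub>relab\<^esub> b" by blast
qed

definition relab_func where
  "relab_func T = \<lparr>FObj = FObj T \<circ> p', FArr = FArr T \<circ> q'\<rparr>"

lemma is_functor_relab:
  assumes "is_functor J C T" shows "is_functor relab C (relab_func T)"
proof -
  note S = functor_simps[OF assms]
  show ?thesis unfolding is_functor_def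
    by (auto simp: relab_func_def Hom_iff S)
qed

lemma is_cocone_relab:
  "is_cocone relab C (relab_func T) c \<iota> \<longleftrightarrow> is_cocone J C T c (\<iota> \<circ> p)"
proof -
  have "(\<forall>x y. \<forall>a \<in> Hom relab x y. \<iota> y \<cdot>\<^bsub>C\<^esub> FArr (relab_func T) a = \<iota> x) \<longleftrightarrow>
        (\<forall>i j. \<forall>u \<in> Hom J i j. \<iota> (p j) \<cdot>\<^bsub>C\<^esub> FArr T u = \<iota> (p i))" (is "?L \<longleftrightarrow> ?R")
  proof
    assume L: ?L
    show ?R
    proof (intro allI ballI)
      fix i j u assume u: "u \<in> Hom J i j"
      then show "\<iota> (p j) \<cdot>\<^bsub>C\<^esub> FArr T u = \<iota> (p i)"
        using L[rule_format, OF Hom_relabI[OF u]] by (simp add: relab_func_def Hom_iff)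
    qed
  next
    assume R: ?R
    show ?L
    proof (intro allI ballI)
      fix x y a assume "a \<in> Hom relab x y"
      then show "\<iota> y \<cdot>\<^bsub>C\<^esub> FArr (relab_func T) a = \<iota> x"
        by (rule Hom_relabE) (use R in \<open>auto simp: relab_func_def Hom_iff\<close>)
    qed
  qed
  then show ?thesis by (auto simp: is_cocone_def relab_func_def)
qed

lemma is_colimit_relab:
  "is_colimit relab C (relab_func T) c \<iota> \<longleftrightarrow> is_colimit J C T c (\<iota> \<circ> p)" (is "?L \<longleftrightarrow> ?R")
proof
  assume L: ?L
  show ?R unfolding is_colimit_def
  proof (intro conjI allI impI)
    show "is_cocone J C T c (\<iota> \<circ> p)" using L by (simp add: is_colimit_def is_cocone_relab)
  next
    fix x \<tau> assume t: "is_cocone J C T x \<tau>"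
    have "is_cocone J C T x ((\<tau> \<circ> p') \<circ> p)" 
      using t unfolding is_cocone_def by (auto simp: Hom_iff)
    then have "\<exists>!h. h \<in> Hom C c x \<and> (\<forall>j\<in>Obj relab. h \<cdot>\<^bsub>C\<^esub> \<iota> j = (\<tau> \<circ> p') j)"
      using L unfolding is_cocone_relab[symmetric] is_colimit_def by blast
    then show "\<exists>!h. h \<in> Hom C c x \<and> (\<forall>j\<in>Obj J. h \<cdot>\<^bsub>C\<^esub> (\<iota> \<circ> p) j = \<tau> j)" by simp
  qed
next
  assume R: ?R
  show ?L unfolding is_colimit_def
  proof (intro conjI allI impI)
    show "is_cocone relab C (relab_func T) c \<iota>" using R by (simp add: is_colimit_def is_cocone_relab)
  next
    fix x \<tau> assume t: "is_cocone relab C (relab_func T) x \<tau>"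
    then show "\<exists>!h. h \<in> Hom C c x \<and> (\<forall>j\<in>Obj relab. h \<cdot>\<^bsub>C\<^esub> \<iota> j = \<tau> j)"
      using R[unfolded is_colimit_def, THEN conjunct2, rule_format, of x "\<tau> \<circ> p"]
      unfolding is_cocone_relab by simp
  qed
qed

end

locale small_accessible = finitely_accessible_with_products \<kappa> C
  for \<kappa> :: "'u rel" and C :: "('o, 'm, 'z) precat_scheme" (structure) +
  assumes inaccessible: "inaccessible \<kappa>"
begin

lemma filtered_index_relabelling:
  assumes "filtered_index \<kappa> J"
  obtains p :: "'i \<Rightarrow> 'u" and q :: "'j \<Rightarrow> 'u" where "relabelling J p q"
proof -
  have J: "category J" "|Obj J| <o \<kappa>" "|Arr J| <o \<kappa>" using assms by (auto simp: filtered_index_def)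
  obtain p :: "'i \<Rightarrow> 'u" where p: "inj_on p (Obj J)"
    using small_embedding[OF inaccessible J(2)] by blast
  obtain q :: "'j \<Rightarrow> 'u" where q: "inj_on q (Arr J)"
    using small_embedding[OF inaccessible J(3)] by blast
  show thesis using that J(1) p q by (simp add: relabelling_def relabelling_axioms_def)
qed

lemma filtered_colimit_exists:
  fixes J :: "('i, 'j) cat"
  assumes "filtered_index \<kappa> J" "is_functor J C T"
  shows "\<exists>c \<iota>. is_colimit J C T c \<iota>"
proof -
  obtain p :: "'i \<Rightarrow> 'u" and q :: "'j \<Rightarrow> 'u" where "relabelling J p q"
    using filtered_index_relabelling assms(1) .
  then interpret relabelling J p q .
  obtain c \<iota> where "is_colimit relab C (relab_func T) c \<iota>"
    using has_filtered_colimits[OF small_filtered_relab[OF assms(1)] is_functor_relab[OF assms(2)]]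
    by blast
  then have "is_colimit J C T c (\<iota> \<circ> p)" by (simp only: is_colimit_relab)
  then show ?thesis by blast
qed

lemma fp_factors_through_stage:
  fixes J :: "('i, 'j) cat"
  assumes J: "filtered_index \<kappa> J" "is_functor J C T" "is_colimit J C T c \<iota>"
    and x: "x \<in> fp \<kappa> C" and h: "h \<in> Hom C x c"
  shows "\<exists>j \<in> Obj J. \<exists>f \<in> Hom C x (FObj T j). \<iota> j \<cdot> f = h"
proof -
  obtain p :: "'i \<Rightarrow> 'u" and q :: "'j \<Rightarrow> 'u" where "relabelling J p q"
    using filtered_index_relabelling J(1) .
  then interpret J: relabelling J p q .
  have "is_cocone J C T c (\<iota> \<circ> J.p' \<circ> p) = is_cocone J C T c \<iota>"
    unfolding is_cocone_def by (simp add: J.Hom_Obj cong: conj_cong)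
  then have "is_colimit J C T c (\<iota> \<circ> J.p' \<circ> p)"
    using J(3) unfolding is_colimit_def by simp
  then have "is_colimit J.relab C (J.relab_func T) c (\<iota> \<circ> J.p')"
    unfolding J.is_colimit_relab .
  then have "\<exists>j \<in> Obj J.relab. \<exists>f \<in> Hom C x (FObj (J.relab_func T) j). (\<iota> \<circ> J.p') j \<cdot> f = h"
    using fp_factors[OF x J.small_filtered_relab[OF J(1)] J.is_functor_relab[OF J(2)] _ h] by blast
  then show ?thesis by (auto simp: J.relab_func_def)
qed

lemma product_exists:
  fixes I :: "'i set"
  assumes "|I| <o \<kappa>" "\<And>i. i \<in> I \<Longrightarrow> X i \<in> Obj C"
  shows "\<exists>p \<pi>. is_product C I X p \<pi>"
proof -
  obtain e :: "'i \<Rightarrow> 'u" where e: "inj_on e I" using small_embedding[OF inaccessible] assms(1) by blast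
  let ?d = "inv_into I e"
  have "|e ` I| <o \<kappa>" using assms(1) small_image by blast
  moreover have "\<forall>i \<in> e ` I. (X \<circ> ?d) i \<in> Obj C" using assms(2) e by simp
  ultimately obtain p \<pi> where P: "is_product C (e ` I) (X \<circ> ?d) p \<pi>" using has_products by blast
  have "is_product C I X p (\<pi> \<circ> e)"
    unfolding is_product_def
  proof (intro conjI ballI allI impI)
    show "p \<in> Obj C" using P by (simp add: is_product_def)
    show "(\<pi> \<circ> e) i \<in> Hom C p (X i)" if "i \<in> I" for i using P that e by (simp add: is_product_def)
    fix c f assume c: "c \<in> Obj C" and f: "\<forall>i\<in>I. f i \<in> Hom C c (X i)"
    have "(f \<circ> ?d) i \<in> Hom C c ((X \<circ> ?d) i)" if "i \<in> e ` I" for i using f e that by auto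
    then have "\<exists>!g. g \<in> Hom C c p \<and> (\<forall>i \<in> e ` I. \<pi> i \<cdot> g = (f \<circ> ?d) i)"
      by (rule is_product_map[OF P c])
    then show "\<exists>!g. g \<in> Hom C c p \<and> (\<forall>i\<in>I. (\<pi> \<circ> e) i \<cdot> g = f i)" using e by simp
  qed
  then show ?thesis by blast
qed

end

section \<open>Finitely presented objects\<close>

context preadditive_category
begin

definition biproduct :: "'o \<Rightarrow> 'o \<Rightarrow> 'o \<Rightarrow> 'm \<Rightarrow> 'm \<Rightarrow> 'm \<Rightarrow> 'm \<Rightarrow> bool" where
  "biproduct x y p i j r s \<longleftrightarrow> i \<in> Hom C x p \<and> j \<in> Hom C y p \<and> r \<in> Hom C p x \<and> s \<in> Hom C p y \<and>
     r \<cdot> i = Ident C x \<and> s \<cdot> j = Ident C y \<and> s \<cdot> i = Zero C x y \<and> r \<cdot> j = Zero C y x \<and>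
     i \<cdot> r \<oplus> j \<cdot> s = Ident C p"

end

context small_accessible
begin

lemma biproduct_exists:
  assumes x: "x \<in> Obj C" and y: "y \<in> Obj C"
  shows "\<exists>p i j r s. biproduct x y p i j r s"
proof -
  let ?X = "\<lambda>b. if b then x else y"
  have "|UNIV :: bool set| <o \<kappa>" by (rule small_finite[OF inaccessible]) simp
  then have "\<exists>p \<pi>. is_product C UNIV ?X p \<pi>" by (rule product_exists) (simp add: x y)
  then obtain p \<pi> where P: "is_product C UNIV ?X p \<pi>" by blast
  have p: "p \<in> Obj C" and pi': "\<pi> True \<in> Hom C p x" "\<pi> False \<in> Hom C p y"
    using P unfolding is_product_def by (auto dest: spec[of _ True] spec[of _ False])
  then have pi [simp]: "\<pi> True \<in> Arr C" "Dom C (\<pi> True) = p" "Cod C (\<pi> True) = x"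
    "\<pi> False \<in> Arr C" "Dom C (\<pi> False) = p" "Cod C (\<pi> False) = y" by (auto simp: Hom_iff)
  have ex: "\<exists>!g. g \<in> Hom C c p \<and> \<pi> True \<cdot> g = f \<and> \<pi> False \<cdot> g = f'"
    if "f \<in> Hom C c x" "f' \<in> Hom C c y" for c f f'
    using is_product_map[OF P, of c "\<lambda>b. if b then f else f'"] that Hom_Obj[OF that(1)]
    by (simp add: all_bool_eq conj_commute)
  obtain i where i: "i \<in> Hom C x p" "\<pi> True \<cdot> i = Ident C x" "\<pi> False \<cdot> i = Zero C x y"
    using ex[of "Ident C x" x "Zero C x y"] x y by (auto simp: Hom_iff)
  obtain j where j: "j \<in> Hom C y p" "\<pi> True \<cdot> j = Zero C y x" "\<pi> False \<cdot> j = Ident C y"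
    using ex[of "Zero C y x" y "Ident C y"] x y by (auto simp: Hom_iff)
  have a [simp]: "i \<in> Arr C" "Dom C i = x" "Cod C i = p" "j \<in> Arr C" "Dom C j = y" "Cod C j = p"
    using i j by (auto simp: Hom_iff)
  note [simp] = Comp_eq_assoc[OF i(2)] Comp_eq_assoc[OF i(3)] Comp_eq_assoc[OF j(2)] Comp_eq_assoc[OF j(3)]
  let ?e = "i \<cdot> \<pi> True \<oplus> j \<cdot> \<pi> False"
  have e: "?e \<in> Hom C p p" "\<pi> True \<cdot> ?e = \<pi> True" "\<pi> False \<cdot> ?e = \<pi> False"
    using p x y by (simp_all add: Hom_iff)
  have "Ident C p \<in> Hom C p p" "\<pi> True \<cdot> Ident C p = \<pi> True" "\<pi> False \<cdot> Ident C p = \<pi> False"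
    using p by (simp_all add: Hom_iff)
  then have "?e = Ident C p" using e ex1_unique[OF ex[OF pi']]
    by meson
  then have "biproduct x y p i j (\<pi> True) (\<pi> False)"
    using i j by (simp add: biproduct_def Hom_iff)
  then show ?thesis by blast
qed

lemma fp_Obj [simp]: "x \<in> fp \<kappa> C \<Longrightarrow> x \<in> Obj C"
  by (simp add: fp_def)

text \<open>
  Injectivity of \<open>colim Hom(x, T j) \<rightarrow> Hom(x, colim T)\<close>, read off at a zero arrow.
\<close>

lemma fp_killed_at_stage:
  fixes J :: "('u, 'u) cat"
  assumes x: "x \<in> fp \<kappa> C" and J: "small_filtered \<kappa> J" "is_functor J C T" "is_colimit J C T c \<iota>"
    and f: "i \<in> Obj J" "f \<in> Hom C x (FObj T i)" "\<iota> i \<cdot> f = Zero C x c"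
  shows "\<exists>k. \<exists>u \<in> Hom J i k. FArr T u \<cdot> f = Zero C x (FObj T k)"
proof -
  interpret J: category J using J(1) by (simp add: small_filtered_def)
  note T [simp] = functor_simps[OF J(2)]
  have i: "\<iota> i \<in> Hom C (FObj T i) c" using J(3) f(1) by (auto simp: is_colimit_def is_cocone_def)
  have "\<iota> i \<cdot> f = \<iota> i \<cdot> Zero C x (FObj T i)" using f i x by (auto simp: Hom_iff)
  moreover have "Zero C x (FObj T i) \<in> Hom C x (FObj T i)" using x f by (simp add: Hom_iff)
  ultimately have "\<exists>k. \<exists>u\<in>Hom J i k. \<exists>v\<in>Hom J i k. FArr T u \<cdot> f = FArr T v \<cdot> Zero C x (FObj T i)"
    using x[unfolded fp_def, THEN CollectD, THEN conjunct2, rule_format, of J T c \<iota>] J f(1,2) by simp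
  then obtain k u v where "u \<in> Hom J i k" "v \<in> Hom J i k" "FArr T u \<cdot> f = FArr T v \<cdot> Zero C x (FObj T i)"
    by blast
  then show ?thesis using x f(1) by (auto simp: Hom_iff intro!: exI[of _ k] bexI[of _ u])
qed

text \<open>
  For injectivity of \<open>colim Hom(x, T j) \<rightarrow> Hom(x, colim T)\<close> it is enough to test the kernel: two
  arrows can be moved to a common stage, where their difference can be formed.
\<close>

lemma fpI:
  assumes x: "x \<in> Obj C"
    and fac: "\<And>(J :: ('u, 'u) cat) T c \<iota> h. \<lbrakk>small_filtered \<kappa> J; is_functor J C T; is_colimit J C T c \<iota>;
      h \<in> Hom C x c\<rbrakk> \<Longrightarrow> \<exists>j \<in> Obj J. \<exists>f \<in> Hom C x (FObj T j). \<iota> j \<cdot> f = h"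
    and kill: "\<And>(J :: ('u, 'u) cat) T c \<iota> i f. \<lbrakk>small_filtered \<kappa> J; is_functor J C T; is_colimit J C T c \<iota>;
      i \<in> Obj J; f \<in> Hom C x (FObj T i); \<iota> i \<cdot> f = Zero C x c\<rbrakk>
      \<Longrightarrow> \<exists>k. \<exists>u \<in> Hom J i k. FArr T u \<cdot> f = Zero C x (FObj T k)"
  shows "x \<in> fp \<kappa> C"
  unfolding fp_def
proof (intro CollectI conjI allI impI ballI x)
  fix J :: "('u, 'u) cat" and T c \<iota> h
  assume "small_filtered \<kappa> J \<and> is_functor J C T \<and> is_colimit J C T c \<iota>" "h \<in> Hom C x c"
  then show "\<exists>j\<in>Obj J. \<exists>f\<in>Hom C x (FObj T j). \<iota> j \<cdot> f = h" using fac by blast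
next
  fix J :: "('u, 'u) cat" and T c \<iota> i j f g
  assume J: "small_filtered \<kappa> J \<and> is_functor J C T \<and> is_colimit J C T c \<iota>" and ij: "i \<in> Obj J" "j \<in> Obj J"
    and f: "f \<in> Hom C x (FObj T i)" and g: "g \<in> Hom C x (FObj T j)" and eq: "\<iota> i \<cdot> f = \<iota> j \<cdot> g"
  interpret J: category J using J by (simp add: small_filtered_def)
  have T: "is_functor J C T" using J by simp
  note [simp] = functor_simps[OF T]
  have co: "is_cocone J C T c \<iota>" using J by (simp add: is_colimit_def)
  then have i [simp]: "\<iota> i \<in> Arr C" "Dom C (\<iota> i) = FObj T i" "Cod C (\<iota> i) = c" if "i \<in> Obj J" for i
    using that by (auto simp: is_cocone_def Hom_iff)
  obtain k u v where uv: "u \<in> Hom J i k" "v \<in> Hom J j k"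
    using J ij unfolding small_filtered_def by blast
  have iu: "\<iota> k \<cdot> FArr T u = \<iota> i" "\<iota> k \<cdot> FArr T v = \<iota> j" using co uv unfolding is_cocone_def by blast+
  have k: "k \<in> Obj J" using J.Hom_Obj(2)[OF uv(1)] .
  let ?d = "FArr T u \<cdot> f \<ominus> FArr T v \<cdot> g"
  have d: "?d \<in> Hom C x (FObj T k)" using f g uv by (auto simp: Hom_iff)
  have "\<iota> k \<cdot> ?d = Zero C x c"
    using f g uv ij k eq Comp_eq_assoc[OF iu(1), of f] Comp_eq_assoc[OF iu(2), of g] x
    by (auto simp: Hom_iff)
  then obtain m w where w: "w \<in> Hom J k m" "FArr T w \<cdot> ?d = Zero C x (FObj T m)"
    using kill[of J T c \<iota> k ?d] J k d by blast
  have "FArr T (w \<cdot>\<^bsub>J\<^esub> u) \<cdot> f = FArr T (w \<cdot>\<^bsub>J\<^esub> v) \<cdot> g"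
    using w uv f g Sub_eq_Zero_iff[of "FArr T w \<cdot> (FArr T u \<cdot> f)" "FArr T w \<cdot> (FArr T v \<cdot> g)"]
    by (auto simp: Hom_iff)
  moreover have "w \<cdot>\<^bsub>J\<^esub> u \<in> Hom J i m" "w \<cdot>\<^bsub>J\<^esub> v \<in> Hom J j m" using w uv by (auto simp: Hom_iff)
  ultimately show "\<exists>k. \<exists>u\<in>Hom J i k. \<exists>v\<in>Hom J j k. FArr T u \<cdot> f = FArr T v \<cdot> g" by blast
qed

text \<open>
  An arrow out of a biproduct is the sum of its two restrictions. So both conditions for \<open>p\<close> follow
  by treating the restrictions separately and then passing to a common stage.
\<close>

lemma fp_biproduct:
  assumes x: "x \<in> fp \<kappa> C" and y: "y \<in> fp \<kappa> C" and bi: "biproduct x y p e e' r r'"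
  shows "p \<in> fp \<kappa> C"
proof (rule fpI)
  note bi = bi[unfolded biproduct_def Hom_iff]
  have a [simp]: "e \<in> Arr C" "e' \<in> Arr C" "r \<in> Arr C" "r' \<in> Arr C" "Dom C e = x" "Cod C e = p"
    "Dom C e' = y" "Cod C e' = p" "Dom C r = p" "Cod C r = x" "Dom C r' = p" "Cod C r' = y"
    and sum: "e \<cdot> r \<oplus> e' \<cdot> r' = Ident C p"
    using bi by simp_all
  show p: "p \<in> Obj C" using Cod_in_Obj[OF a(1)] by simp
  fix J :: "('u, 'u) cat" and T c \<iota>
  assume J: "small_filtered \<kappa> J" "is_functor J C T" "is_colimit J C T c \<iota>"
  interpret J: category J using J by (simp add: small_filtered_def)
  note [simp] = functor_simps[OF J(2)]
  have co: "is_cocone J C T c \<iota>" using J by (simp add: is_colimit_def)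
  then have i [simp]: "\<iota> i \<in> Arr C" "Dom C (\<iota> i) = FObj T i" "Cod C (\<iota> i) = c" if "i \<in> Obj J" for i
    using that by (auto simp: is_cocone_def Hom_iff)
  have split: "h = h \<cdot> e \<cdot> r \<oplus> h \<cdot> e' \<cdot> r'" if "h \<in> Arr C" "Dom C h = p" for h
  proof -
    have "h = h \<cdot> (e \<cdot> r \<oplus> e' \<cdot> r')" using that by (simp add: sum)
    then show ?thesis using that by simp
  qed
  {
    fix h assume h: "h \<in> Hom C p c"
    then have [simp]: "h \<in> Arr C" "Dom C h = p" "Cod C h = c" by (auto simp: Hom_iff)
    have "h \<cdot> e \<in> Hom C x c" "h \<cdot> e' \<in> Hom C y c" by (auto simp: Hom_iff)
    then obtain i j f g where ij: "i \<in> Obj J" "j \<in> Obj J" "f \<in> Hom C x (FObj T i)" "g \<in> Hom C y (FObj T j)"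
      "\<iota> i \<cdot> f = h \<cdot> e" "\<iota> j \<cdot> g = h \<cdot> e'"
      using fp_factors[OF x J] fp_factors[OF y J] by metis
    obtain k u v where uv: "u \<in> Hom J i k" "v \<in> Hom J j k"
      using J ij unfolding small_filtered_def by blast
    have k: "k \<in> Obj J" using J.Hom_Obj(2)[OF uv(1)] .
    have iu: "\<iota> k \<cdot> FArr T u = \<iota> i" "\<iota> k \<cdot> FArr T v = \<iota> j" using co uv unfolding is_cocone_def by blast+
    let ?m = "FArr T u \<cdot> f \<cdot> r \<oplus> FArr T v \<cdot> g \<cdot> r'"
    have m: "?m \<in> Hom C p (FObj T k)" using ij uv by (auto simp: Hom_iff)
    have "\<iota> k \<cdot> ?m = \<iota> k \<cdot> FArr T u \<cdot> f \<cdot> r \<oplus> \<iota> k \<cdot> FArr T v \<cdot> g \<cdot> r'"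
      using ij uv k by (simp add: Hom_iff)
    also have "\<dots> = h" using split[of h] by (simp add: iu ij)
    finally show "\<exists>j\<in>Obj J. \<exists>f\<in>Hom C p (FObj T j). \<iota> j \<cdot> f = h" using k m by blast
  next
    fix i f assume i: "i \<in> Obj J" and f: "f \<in> Hom C p (FObj T i)" "\<iota> i \<cdot> f = Zero C p c"
    have F [simp]: "f \<in> Arr C" "Dom C f = p" "Cod C f = FObj T i" using f by (auto simp: Hom_iff)
    have c: "c \<in> Obj C" using co by (simp add: is_cocone_def)
    have "f \<cdot> e \<in> Hom C x (FObj T i)" "\<iota> i \<cdot> (f \<cdot> e) = Zero C x c"
      using f(2) i c Comp_eq_assoc[OF f(2), of e] by (auto simp: Hom_iff)
    then obtain k u where u: "u \<in> Hom J i k" "FArr T u \<cdot> (f \<cdot> e) = Zero C x (FObj T k)"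
      using fp_killed_at_stage[OF x J i] by blast
    then have k: "k \<in> Obj J" using J.Hom_Obj by blast
    have iu: "\<iota> k \<cdot> FArr T u = \<iota> i" using co u unfolding is_cocone_def by blast
    have "FArr T u \<cdot> (f \<cdot> e') \<in> Hom C y (FObj T k)" using u by (auto simp: Hom_iff)
    moreover have "\<iota> k \<cdot> (FArr T u \<cdot> (f \<cdot> e')) = Zero C y c"
      using f(2) i k c u Comp_eq_assoc[OF f(2), of e'] Comp_eq_assoc[OF iu, of "f \<cdot> e'"] by (auto simp: Hom_iff)
    ultimately obtain m v where v: "v \<in> Hom J k m" "FArr T v \<cdot> (FArr T u \<cdot> (f \<cdot> e')) = Zero C y (FObj T m)"
      using fp_killed_at_stage[OF y J k] by blast
    have m: "m \<in> Obj J" using v J.Hom_Obj by blast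
    let ?w = "v \<cdot>\<^bsub>J\<^esub> u"
    have "?w \<in> Hom J i m" using u v by (auto simp: Hom_iff)
    moreover have "FArr T ?w \<cdot> f = Zero C p (FObj T m)"
    proof -
      have [simp]: "u \<in> Arr J" "v \<in> Arr J" "Dom J u = i" "Cod J u = k" "Dom J v = k" "Cod J v = m"
        using u v by (auto simp: Hom_iff)
      have "FArr T v \<cdot> (FArr T u \<cdot> (f \<cdot> (e \<cdot> r))) = Zero C p (FObj T m)"
        using Comp_eq_assoc[OF u(2), of r] m k p by simp
      moreover have "FArr T v \<cdot> (FArr T u \<cdot> (f \<cdot> (e' \<cdot> r'))) = Zero C p (FObj T m)"
        using Comp_eq_assoc[OF v(2), of r'] m k p by simp
      moreover have "f = f \<cdot> e \<cdot> r \<oplus> f \<cdot> e' \<cdot> r'" by (rule split) simp_all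
      then have "FArr T ?w \<cdot> f = FArr T ?w \<cdot> (f \<cdot> e \<cdot> r \<oplus> f \<cdot> e' \<cdot> r')" by simp
      ultimately show ?thesis using m p by simp
    qed
    ultimately show "\<exists>k. \<exists>u\<in>Hom J i k. FArr T u \<cdot> f = Zero C p (FObj T k)" by blast
  }
qed

lemma fp_presentation:
  assumes "x \<in> Obj C"
  shows "\<exists>(J :: ('u, 'u) cat) T \<iota>. small_filtered \<kappa> J \<and> is_functor J C T \<and> is_colimit J C T x \<iota> \<and>
    (\<forall>j \<in> Obj J. FObj T j \<in> fp \<kappa> C \<and> \<iota> j \<in> Hom C (FObj T j) x)"
proof -
  obtain J :: "('u, 'u) cat" and T \<iota> where J: "small_filtered \<kappa> J" "is_functor J C T"
    "is_colimit J C T x \<iota>" "\<forall>j \<in> Obj J. FObj T j \<in> fp \<kappa> C"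
    using filtered_colimit_of_fp[OF assms] by blast
  then have "\<forall>j \<in> Obj J. \<iota> j \<in> Hom C (FObj T j) x"
    by (simp add: is_colimit_def is_cocone_def)
  with J show ?thesis by (intro exI[of _ J] exI[of _ T] exI[of _ \<iota>]) simp
qed

text \<open>
  The domain is a colimit of finitely presented objects, and the components of a colimit cocone are
  jointly epimorphic.
\<close>

lemma fp_separate:
  assumes g: "g \<in> Hom C x y" "g' \<in> Hom C x y"
    and eq: "\<And>c l. \<lbrakk>c \<in> fp \<kappa> C; l \<in> Hom C c x\<rbrakk> \<Longrightarrow> g \<cdot> l = g' \<cdot> l"
  shows "g = g'"
proof -
  obtain J :: "('u, 'u) cat" and T \<iota> where J: "small_filtered \<kappa> J" "is_functor J C T"
    "is_colimit J C T x \<iota>" "\<forall>j \<in> Obj J. FObj T j \<in> fp \<kappa> C \<and> \<iota> j \<in> Hom C (FObj T j) x"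
    using fp_presentation[OF Hom_Obj(1)[OF g(1)]] by blast
  interpret J: category J using J by (simp add: small_filtered_def)
  have co: "is_cocone J C T x \<iota>" using J(3) by (simp add: is_colimit_def)
  note [simp] = functor_simps[OF J(2)]
  have "is_cocone J C T y (\<lambda>j. g \<cdot> \<iota> j)" unfolding is_cocone_def
  proof (intro conjI allI ballI)
    show "y \<in> Obj C" using Hom_Obj(2)[OF g(1)] .
    show "g \<cdot> \<iota> j \<in> Hom C (FObj T j) y" if "j \<in> Obj J" for j using Comp_in_Hom[OF g(1) J(4)[THEN bspec, OF that, THEN conjunct2]] .
    fix i j u assume u: "u \<in> Hom J i j"
    then have "\<iota> j \<cdot> FArr T u = \<iota> i" using co unfolding is_cocone_def by blast
    then show "g \<cdot> \<iota> j \<cdot> FArr T u = g \<cdot> \<iota> i"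
      using g(1) u J(4)[THEN bspec, OF J.Hom_Obj(2)[OF u]] by (auto simp: Hom_iff)
  qed
  from is_colimit_map[OF J(3) this]
  have "\<exists>!h. h \<in> Hom C x y \<and> (\<forall>j\<in>Obj J. h \<cdot> \<iota> j = g \<cdot> \<iota> j)" .
  moreover have "\<forall>j\<in>Obj J. g' \<cdot> \<iota> j = g \<cdot> \<iota> j" using eq J(4) by metis
  ultimately show ?thesis using g by blast
qed

section \<open>Representing flat subfunctors\<close>

text \<open>
  A set \<open>K\<close> of arrows into \<open>p\<close> with finitely presented domains stands for the subfunctor
  \<open>c \<mapsto> K \<inter> Hom(c, p)\<close> of \<open>Hom(-, p)\<close>; the first conditions say that it is additive. The last one is
  flatness: a relation \<open>k u = 0\<close> between elements of the functor comes from a relation \<open>w u = 0\<close>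
  between finitely presented objects.
\<close>

definition flat_subfunctor :: "'o \<Rightarrow> 'm set \<Rightarrow> bool" where
  "flat_subfunctor p K \<longleftrightarrow> p \<in> Obj C \<and>
     (\<forall>k \<in> K. k \<in> Arr C \<and> Dom C k \<in> fp \<kappa> C \<and> Cod C k = p) \<and>
     (\<forall>c \<in> fp \<kappa> C. Zero C c p \<in> K) \<and>
     (\<forall>k \<in> K. \<forall>k' \<in> K. Dom C k = Dom C k' \<longrightarrow> k \<oplus> k' \<in> K) \<and>
     (\<forall>k \<in> K. \<forall>c \<in> fp \<kappa> C. \<forall>w \<in> Hom C c (Dom C k). k \<cdot> w \<in> K) \<and>
     (\<forall>k \<in> K. \<forall>c \<in> fp \<kappa> C. \<forall>u \<in> Hom C c (Dom C k). k \<cdot> u = Zero C c p \<longrightarrow>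
        (\<exists>w k'. k' \<in> K \<and> w \<in> Hom C (Dom C k) (Dom C k') \<and> k' \<cdot> w = k \<and> w \<cdot> u = Zero C c (Dom C k')))"

text \<open>
  The category of elements of the functor given by \<open>K\<close>. An arrow is stored with its two endpoints, as
  the same \<open>w\<close> may connect several pairs of elements.
\<close>

definition elements :: "'m set \<Rightarrow> ('m, 'm \<times> 'm \<times> 'm) cat" where
  "elements K = \<lparr>Obj = K, Arr = {(k, w, k'). k \<in> K \<and> k' \<in> K \<and> w \<in> Hom C (Dom C k) (Dom C k') \<and> k' \<cdot> w = k},
     Dom = (\<lambda>(k, w, k'). k), Cod = (\<lambda>(k, w, k'). k'), Ident = (\<lambda>k. (k, Ident C (Dom C k), k)),
     Comp = (\<lambda>(k', w', k'') (k, w, _). (k, w' \<cdot> w, k''))\<rparr>"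

lemma fp_representatives:
  obtains S where "S \<subseteq> fp \<kappa> C" "|S| <o \<kappa>" "\<forall>x \<in> fp \<kappa> C. \<exists>y \<in> S. isomorphic C x y"
  using fp_skeletally_small by blast

lemma fp_nonempty: "x \<in> Obj C \<Longrightarrow> \<exists>c. c \<in> fp \<kappa> C"
  using filtered_colimit_of_fp[of x] unfolding small_filtered_def by blast

lemma small_arrows_from:
  assumes "|S| <o \<kappa>" "S \<subseteq> Obj C" "p \<in> Obj C"
  shows "|{k \<in> Arr C. Dom C k \<in> S \<and> Cod C k = p}| <o \<kappa>"
proof -
  have "|\<Union>c\<in>S. Hom C c p| <o \<kappa>"
    by (rule small_UN[OF inaccessible assms(1)]) (use assms locally_small in auto)
  then show ?thesis by (rule small_subset[OF inaccessible]) (auto simp: Hom_iff)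
qed

text \<open>
  To stay small, the category of elements is restricted to representatives \<open>S\<close> of the isomorphism
  classes of finitely presented objects; by the second claim nothing is lost. It is filtered since
  two elements are restrictions of the sum of their composites with the projections of a biproduct,
  and since flatness, applied to a difference, coequalizes parallel arrows.
\<close>

lemma filtered_elements:
  assumes K: "flat_subfunctor p K"
    and S: "S \<subseteq> fp \<kappa> C" "|S| <o \<kappa>" "\<forall>x \<in> fp \<kappa> C. \<exists>y \<in> S. isomorphic C x y"
  defines "K' \<equiv> {k \<in> K. Dom C k \<in> S}"
  shows "filtered_index \<kappa> (elements K')"
    and "\<And>k. k \<in> K \<Longrightarrow> \<exists>k' w v. k' \<in> K' \<and> w \<in> Hom C (Dom C k) (Dom C k') \<and> v \<in> Hom C (Dom C k') (Dom C k)
       \<and> v \<cdot> w = Ident C (Dom C k) \<and> w \<cdot> v = Ident C (Dom C k') \<and> k' \<cdot> w = k"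
proof -
  have p: "p \<in> Obj C" and arr: "\<And>k. k \<in> K \<Longrightarrow> k \<in> Arr C" and dom: "\<And>k. k \<in> K \<Longrightarrow> Dom C k \<in> fp \<kappa> C"
    and cod: "\<And>k. k \<in> K \<Longrightarrow> Cod C k = p" and zero: "\<And>c. c \<in> fp \<kappa> C \<Longrightarrow> Zero C c p \<in> K"
    and plus: "\<And>k k'. \<lbrakk>k \<in> K; k' \<in> K; Dom C k = Dom C k'\<rbrakk> \<Longrightarrow> k \<oplus> k' \<in> K"
    and comp: "\<And>k c w. \<lbrakk>k \<in> K; c \<in> fp \<kappa> C; w \<in> Hom C c (Dom C k)\<rbrakk> \<Longrightarrow> k \<cdot> w \<in> K"
    and flat: "\<And>k c u. \<lbrakk>k \<in> K; c \<in> fp \<kappa> C; u \<in> Hom C c (Dom C k); k \<cdot> u = Zero C c p\<rbrakk> \<Longrightarrow>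
        (\<exists>w k'. k' \<in> K \<and> w \<in> Hom C (Dom C k) (Dom C k') \<and> k' \<cdot> w = k \<and> w \<cdot> u = Zero C c (Dom C k'))"
    using K unfolding flat_subfunctor_def by simp_all
  have K': "k \<in> K" and KS: "Dom C k \<in> S" if "k \<in> K'" for k using that by (simp_all add: K'_def)
  note [simp] = arr cod
  show rep: "\<exists>k' w v. k' \<in> K' \<and> w \<in> Hom C (Dom C k) (Dom C k') \<and> v \<in> Hom C (Dom C k') (Dom C k)
       \<and> v \<cdot> w = Ident C (Dom C k) \<and> w \<cdot> v = Ident C (Dom C k') \<and> k' \<cdot> w = k" if k: "k \<in> K" for k
  proof -
    obtain y w v where y: "y \<in> S" "w \<in> Hom C (Dom C k) y" "v \<in> Hom C y (Dom C k)"
      "v \<cdot> w = Ident C (Dom C k)" "w \<cdot> v = Ident C y"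
      using S(3)[THEN bspec, OF dom[OF k]] unfolding isomorphic_def by blast
    have "y \<in> fp \<kappa> C" using y(1) S(1) by blast
    then have "k \<cdot> v \<in> K'" using comp[OF k _ y(3)] y k by (auto simp: K'_def Hom_iff)
    moreover have "k \<cdot> v \<cdot> w = k" "Dom C (k \<cdot> v) = y" using y k by (auto simp: Hom_iff)
    ultimately show ?thesis using y by metis
  qed
  let ?E = "elements K'"
  have E [simp]: "Obj ?E = K'" "\<And>k w k'. Dom ?E (k, w, k') = k" "\<And>k w k'. Cod ?E (k, w, k') = k'"
    "\<And>k w k'. (k, w, k') \<in> Arr ?E \<longleftrightarrow> k \<in> K' \<and> k' \<in> K' \<and> w \<in> Hom C (Dom C k) (Dom C k') \<and> k' \<cdot> w = k"
    "\<And>k. Ident ?E k = (k, Ident C (Dom C k), k)"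
    "\<And>k w k' l w' l'. (l, w', l') \<cdot>\<^bsub>?E\<^esub> (k, w, k') = (k, w' \<cdot> w, l')"
    by (simp_all add: elements_def)
  have cat: "category ?E"
  proof
    fix a assume "a \<in> Arr ?E"
    then show "Dom ?E a \<in> Obj ?E" "Cod ?E a \<in> Obj ?E" by (cases a; simp)+
  next
    fix k assume "k \<in> Obj ?E"
    then show "Ident ?E k \<in> Hom ?E k k" by (simp add: Hom_iff K')
  next
    fix b a k l m assume "b \<in> Hom ?E l m" "a \<in> Hom ?E k l"
    then show "b \<cdot>\<^bsub>?E\<^esub> a \<in> Hom ?E k m"
      by (cases a; cases b) (auto simp: Hom_iff K' Comp_assoc_right[symmetric] simp del: Comp_assoc_right)
  next
    fix a k l assume "a \<in> Hom ?E k l"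
    then show "Ident ?E l \<cdot>\<^bsub>?E\<^esub> a = a" "a \<cdot>\<^bsub>?E\<^esub> Ident ?E k = a"
      by (cases a; simp add: Hom_iff)+
  next
    fix c b a k l m n assume "c \<in> Hom ?E m n" "b \<in> Hom ?E l m" "a \<in> Hom ?E k l"
    then show "c \<cdot>\<^bsub>?E\<^esub> b \<cdot>\<^bsub>?E\<^esub> a = c \<cdot>\<^bsub>?E\<^esub> (b \<cdot>\<^bsub>?E\<^esub> a)"
      by (cases a; cases b; cases c) (auto simp: Hom_iff)
  qed
  show "filtered_index \<kappa> ?E"
    unfolding filtered_index_def
  proof (intro conjI ballI allI cat)
    have S': "S \<subseteq> Obj C" using S(1) by auto
    have s1: "|K'| <o \<kappa>"
      by (rule small_subset[OF inaccessible small_arrows_from[OF S(2) S' p]]) (auto simp: K'_def)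
    then show "|Obj ?E| <o \<kappa>" by simp
    have "|\<Union>d\<in>S. {k \<in> Arr C. Dom C k \<in> S \<and> Cod C k = d}| <o \<kappa>"
      by (rule small_UN[OF inaccessible S(2)]) (use S' small_arrows_from[OF S(2) S'] in auto)
    then have "|K' \<times> (\<Union>d\<in>S. {k \<in> Arr C. Dom C k \<in> S \<and> Cod C k = d}) \<times> K'| <o \<kappa>"
      using small_Times[OF inaccessible s1 small_Times[OF inaccessible _ s1]] by blast
    moreover have "Arr ?E \<subseteq> K' \<times> (\<Union>d\<in>S. {k \<in> Arr C. Dom C k \<in> S \<and> Cod C k = d}) \<times> K'"
    proof
      fix a assume "a \<in> Arr ?E"
      then show "a \<in> K' \<times> (\<Union>d\<in>S. {k \<in> Arr C. Dom C k \<in> S \<and> Cod C k = d}) \<times> K'"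
        using KS by (cases a) (simp add: Hom_iff)
    qed
    ultimately show "|Arr ?E| <o \<kappa>" by (rule small_subset[OF inaccessible])
    obtain c where c: "c \<in> fp \<kappa> C" using fp_nonempty[OF p] by blast
    obtain k where "k \<in> K'" using rep[OF zero[OF c]] by blast
    then show "Obj ?E \<noteq> {}" by (simp only: E(1)) blast
  next
    fix k l assume kl: "k \<in> Obj ?E" "l \<in> Obj ?E"
    then have k [simp]: "k \<in> K'" "k \<in> K" "l \<in> K'" "l \<in> K" using K' by auto
    obtain c i j r s where bi: "biproduct (Dom C k) (Dom C l) c i j r s"
      using biproduct_exists[of "Dom C k" "Dom C l"] k(2,4) arr Dom_in_Obj by blast
    have c: "c \<in> fp \<kappa> C" using fp_biproduct[OF dom dom bi] by simp
    have a [simp]: "i \<in> Arr C" "j \<in> Arr C" "r \<in> Arr C" "s \<in> Arr C" "Dom C i = Dom C k" "Cod C i = c"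
      "Dom C j = Dom C l" "Cod C j = c" "Dom C r = c" "Cod C r = Dom C k" "Dom C s = c" "Cod C s = Dom C l"
      and eq: "r \<cdot> i = Ident C (Dom C k)" "s \<cdot> j = Ident C (Dom C l)"
        "s \<cdot> i = Zero C (Dom C k) (Dom C l)" "r \<cdot> j = Zero C (Dom C l) (Dom C k)"
      using bi by (auto simp: biproduct_def Hom_iff)
    have "k \<cdot> r \<oplus> l \<cdot> s \<in> K" by (intro plus comp c) (auto simp: Hom_iff c)
    from rep[OF this] obtain m w where m: "m \<in> K'" "w \<in> Hom C c (Dom C m)" "m \<cdot> w = k \<cdot> r \<oplus> l \<cdot> s"
      by auto
    have [simp]: "m \<in> K" "w \<in> Arr C" "Dom C w = c" "Cod C w = Dom C m" using m K' by (auto simp: Hom_iff)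
    have "m \<cdot> (w \<cdot> i) = k" "m \<cdot> (w \<cdot> j) = l"
      using Comp_eq_assoc[OF m(3), of i] Comp_eq_assoc[OF m(3), of j] p by (auto simp: eq)
    then have "(k, w \<cdot> i, m) \<in> Hom ?E k m" "(l, w \<cdot> j, m) \<in> Hom ?E l m"
      using m(1) by (auto simp: Hom_iff)
    then show "\<exists>m. Hom ?E k m \<noteq> {} \<and> Hom ?E l m \<noteq> {}" by blast
  next
    fix k l a b assume ab: "a \<in> Hom ?E k l" "b \<in> Hom ?E k l"
    then obtain u v where uv: "a = (k, u, l)" "b = (k, v, l)" "l \<cdot> u = k" "l \<cdot> v = k"
      "u \<in> Hom C (Dom C k) (Dom C l)" "v \<in> Hom C (Dom C k) (Dom C l)" and [simp]: "l \<in> K'" "k \<in> K'"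
      by (cases a; cases b) (auto simp: Hom_iff)
    have [simp]: "l \<in> K" "k \<in> K" using K' by auto
    have d: "u \<ominus> v \<in> Hom C (Dom C k) (Dom C l)" "l \<cdot> (u \<ominus> v) = Zero C (Dom C k) p"
      using uv by (auto simp: Hom_iff)
    obtain w k' where w: "k' \<in> K" "w \<in> Hom C (Dom C l) (Dom C k')" "k' \<cdot> w = l"
      "w \<cdot> (u \<ominus> v) = Zero C (Dom C k) (Dom C k')"
      using flat[OF _ _ d] dom by auto
    obtain m z where m: "m \<in> K'" "z \<in> Hom C (Dom C k') (Dom C m)" "m \<cdot> z = k'"
      using rep[OF w(1)] by blast
    have [simp]: "m \<in> K" using m K' by blast
    have wu: "w \<cdot> u = w \<cdot> v"
      using w uv Sub_eq_Zero_iff[of "w \<cdot> u" "w \<cdot> v"] by (auto simp: Hom_iff)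
    have "(l, z \<cdot> w, m) \<in> Hom ?E l m"
      using m w Comp_eq_assoc[OF m(3), of w] by (auto simp: Hom_iff)
    moreover have "(l, z \<cdot> w, m) \<cdot>\<^bsub>?E\<^esub> a = (l, z \<cdot> w, m) \<cdot>\<^bsub>?E\<^esub> b"
      using uv w m wu by (auto simp: Hom_iff)
    ultimately show "\<exists>k. \<exists>w\<in>Hom ?E l k. w \<cdot>\<^bsub>?E\<^esub> a = w \<cdot>\<^bsub>?E\<^esub> b" by blast
  qed
qed

text \<open>
  The arrow \<open>f : x \<rightarrow> p\<close> identifies \<open>Hom(-, x)\<close> with \<open>K\<close> on finitely presented objects. The last
  condition says that a natural transformation \<open>\<tau> : K \<rightarrow> Hom(-, y)\<close> is induced by an arrow
  \<open>x \<rightarrow> y\<close>.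
\<close>

definition represents :: "'o \<Rightarrow> 'm set \<Rightarrow> 'o \<Rightarrow> 'm \<Rightarrow> bool" where
  "represents p K x f \<longleftrightarrow> f \<in> Hom C x p \<and>
     (\<forall>c \<in> fp \<kappa> C. \<forall>l \<in> Hom C c x. f \<cdot> l \<in> K \<and> (f \<cdot> l = Zero C c p \<longrightarrow> l = Zero C c x)) \<and>
     (\<forall>k \<in> K. \<exists>l \<in> Hom C (Dom C k) x. f \<cdot> l = k) \<and>
     (\<forall>y \<tau>. y \<in> Obj C \<longrightarrow> (\<forall>k \<in> K. \<tau> k \<in> Hom C (Dom C k) y) \<longrightarrow>
       (\<forall>k \<in> K. \<forall>c \<in> fp \<kappa> C. \<forall>w \<in> Hom C c (Dom C k). \<tau> (k \<cdot> w) = \<tau> k \<cdot> w) \<longrightarrow>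
       (\<exists>h \<in> Hom C x y. \<forall>c \<in> fp \<kappa> C. \<forall>l \<in> Hom C c x. h \<cdot> l = \<tau> (f \<cdot> l)))"

text \<open>
  The object \<open>x\<close> is the colimit of the domains over the category of elements, and \<open>f\<close> is induced by
  the elements themselves. An arrow \<open>c \<rightarrow> x\<close> from a finitely presented object factors through some
  \<open>\<iota> k\<close>, hence its composite with \<open>f\<close> factors through \<open>k\<close> and lies in \<open>K\<close>. If the composite is
  zero, then flatness replaces \<open>k\<close> by a later element at which the arrow itself has become zero.
\<close>

lemma flat_subfunctor_representable:
  assumes K: "flat_subfunctor p K"
  shows "\<exists>x f. represents p K x f"
proof -
  have p: "p \<in> Obj C" and arr: "\<And>k. k \<in> K \<Longrightarrow> k \<in> Arr C" and dom: "\<And>k. k \<in> K \<Longrightarrow> Dom C k \<in> fp \<kappa> C"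
    and cod: "\<And>k. k \<in> K \<Longrightarrow> Cod C k = p" 
    and comp: "\<And>k c w. \<lbrakk>k \<in> K; c \<in> fp \<kappa> C; w \<in> Hom C c (Dom C k)\<rbrakk> \<Longrightarrow> k \<cdot> w \<in> K"
    and flat: "\<And>k c u. \<lbrakk>k \<in> K; c \<in> fp \<kappa> C; u \<in> Hom C c (Dom C k); k \<cdot> u = Zero C c p\<rbrakk> \<Longrightarrow>
        (\<exists>w k'. k' \<in> K \<and> w \<in> Hom C (Dom C k) (Dom C k') \<and> k' \<cdot> w = k \<and> w \<cdot> u = Zero C c (Dom C k'))"
    using K unfolding flat_subfunctor_def by simp_all
  note [simp] = arr cod
  obtain S where S: "S \<subseteq> fp \<kappa> C" "|S| <o \<kappa>" "\<forall>x \<in> fp \<kappa> C. \<exists>y \<in> S. isomorphic C x y"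
    using fp_representatives by blast
  define K' where "K' = {k \<in> K. Dom C k \<in> S}"
  note E = filtered_elements[OF K S, folded K'_def]
  have K' [simp]: "k \<in> K" if "k \<in> K'" for k using that by (simp add: K'_def)
  let ?E = "elements K'"
  let ?T = "\<lparr>FObj = Dom C, FArr = \<lambda>(k, w, k'). w\<rparr>"
  have T: "is_functor ?E C ?T"
    by (auto simp: is_functor_def elements_def Hom_iff)
  obtain x \<iota> where x: "is_colimit ?E C ?T x \<iota>" using filtered_colimit_exists[OF E(1) T] by blast
  have co: "is_cocone ?E C ?T x \<iota>" using x by (simp add: is_colimit_def)
  have xo: "x \<in> Obj C" using co by (simp add: is_cocone_def)
  have io [simp]: "\<iota> k \<in> Arr C" "Dom C (\<iota> k) = Dom C k" "Cod C (\<iota> k) = x" if "k \<in> K'" for k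
    using co that by (auto simp: is_cocone_def elements_def Hom_iff)
  have it: "\<iota> k' \<cdot> w = \<iota> k" if "k \<in> K'" "k' \<in> K'" "w \<in> Hom C (Dom C k) (Dom C k')" "k' \<cdot> w = k" for k k' w
  proof -
    have "(k, w, k') \<in> Hom ?E k k'" using that by (auto simp: elements_def Hom_iff)
    then show ?thesis using co unfolding is_cocone_def by fastforce
  qed
  have cocone: "is_cocone ?E C ?T y \<tau>"
    if "y \<in> Obj C" "\<And>k. k \<in> K' \<Longrightarrow> \<tau> k \<in> Hom C (Dom C k) y"
      "\<And>k k' w. \<lbrakk>k \<in> K'; k' \<in> K'; w \<in> Hom C (Dom C k) (Dom C k'); k' \<cdot> w = k\<rbrakk> \<Longrightarrow> \<tau> k' \<cdot> w = \<tau> k" for y \<tau>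
    using that by (auto simp: is_cocone_def elements_def Hom_iff)
  have stage: "\<exists>k \<in> K'. \<exists>a \<in> Hom C c (Dom C k). \<iota> k \<cdot> a = l" if "c \<in> fp \<kappa> C" "l \<in> Hom C c x" for c l
    using fp_factors_through_stage[OF E(1) T x that] by (simp add: elements_def)
  have "is_cocone ?E C ?T p (\<lambda>k. k)" by (rule cocone) (auto simp: p Hom_iff)
  from is_colimit_map[OF x this] obtain f where f: "f \<in> Hom C x p" and fi: "\<And>k. k \<in> K' \<Longrightarrow> f \<cdot> \<iota> k = k"
    by (auto simp: elements_def)
  have [simp]: "f \<in> Arr C" "Dom C f = x" "Cod C f = p" using f by (auto simp: Hom_iff)
  have fia: "f \<cdot> (\<iota> k \<cdot> a) = k \<cdot> a" if "k \<in> K'" "a \<in> Hom C c (Dom C k)" for k a c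
    using Comp_eq_assoc[OF fi[OF that(1)]] that by (auto simp: Hom_iff)
  have "represents p K x f"
    unfolding represents_def
  proof (intro conjI ballI allI impI f)
    fix c l assume c: "c \<in> fp \<kappa> C" and l: "l \<in> Hom C c x"
    obtain k a where k: "k \<in> K'" "a \<in> Hom C c (Dom C k)" "\<iota> k \<cdot> a = l" using stage[OF c l] by blast
    show "f \<cdot> l \<in> K" using fia[OF k(1,2)] comp[OF _ c k(2)] k by simp
    assume "f \<cdot> l = Zero C c p"
    then have "k \<cdot> a = Zero C c p" using fia[OF k(1,2)] k by simp
    then obtain w k' where w: "k' \<in> K" "w \<in> Hom C (Dom C k) (Dom C k')" "k' \<cdot> w = k" "w \<cdot> a = Zero C c (Dom C k')"
      using flat[OF _ c k(2)] k by auto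
    obtain m z where m: "m \<in> K'" "z \<in> Hom C (Dom C k') (Dom C m)" "m \<cdot> z = k'"
      using E(2)[OF w(1)] by blast
    have "z \<cdot> w \<in> Hom C (Dom C k) (Dom C m)" "m \<cdot> (z \<cdot> w) = k"
      using m w Comp_eq_assoc[OF m(3), of w] by (auto simp: Hom_iff)
    then have "\<iota> m \<cdot> (z \<cdot> w) = \<iota> k" using it k m by blast
    then have "l = \<iota> m \<cdot> (z \<cdot> (w \<cdot> a))" using Comp_eq_assoc[of "\<iota> m" "z \<cdot> w" "\<iota> k" a] k m w by (auto simp: Hom_iff)
    then show "l = Zero C c x" using w m c by (auto simp: Hom_iff)
  next
    fix k assume k: "k \<in> K"
    obtain k' w where w: "k' \<in> K'" "w \<in> Hom C (Dom C k) (Dom C k')" "k' \<cdot> w = k"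
      using E(2)[OF k] by blast
    have "\<iota> k' \<cdot> w \<in> Hom C (Dom C k) x" "f \<cdot> (\<iota> k' \<cdot> w) = k" using w fia[OF w(1,2)] by (auto simp: Hom_iff)
    then show "\<exists>l\<in>Hom C (Dom C k) x. f \<cdot> l = k" by blast
  next
    fix y \<tau> assume y: "y \<in> Obj C" and t: "\<forall>k \<in> K. \<tau> k \<in> Hom C (Dom C k) y"
      and nat: "\<forall>k \<in> K. \<forall>c \<in> fp \<kappa> C. \<forall>w \<in> Hom C c (Dom C k). \<tau> (k \<cdot> w) = \<tau> k \<cdot> w"
    have "is_cocone ?E C ?T y \<tau>"
    proof (rule cocone[OF y])
      show "\<tau> k \<in> Hom C (Dom C k) y" if "k \<in> K'" for k using t that by simp
      show "\<tau> k' \<cdot> w = \<tau> k" if "k \<in> K'" "k' \<in> K'" "w \<in> Hom C (Dom C k) (Dom C k')" "k' \<cdot> w = k" for k k' w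
        using nat dom[of k] that by (metis K')
    qed
    from is_colimit_map[OF x this] obtain h where h: "h \<in> Hom C x y" "\<And>k. k \<in> K' \<Longrightarrow> h \<cdot> \<iota> k = \<tau> k"
      by (auto simp: elements_def)
    have "h \<cdot> l = \<tau> (f \<cdot> l)" if c: "c \<in> fp \<kappa> C" and l: "l \<in> Hom C c x" for c l
    proof -
      obtain k a where k: "k \<in> K'" "a \<in> Hom C c (Dom C k)" "\<iota> k \<cdot> a = l" using stage[OF c l] by blast
      have "h \<cdot> l = \<tau> k \<cdot> a" using k h(1) Comp_eq_assoc[OF h(2)[OF k(1)], of a] by (auto simp: Hom_iff)
      also have "\<dots> = \<tau> (f \<cdot> l)" using fia[OF k(1,2)] nat c k by (metis K')
      finally show ?thesis .
    qed
    then show "\<exists>h\<in>Hom C x y. \<forall>c\<in>fp \<kappa> C. \<forall>l\<in>Hom C c x. h \<cdot> l = \<tau> (f \<cdot> l)" using h(1) by blast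
  qed
  then show ?thesis by blast
qed

end

section \<open>Coproducts of finitely presented objects\<close>

text \<open>
  The coproduct of finitely presented objects \<open>X i\<close> is constructed inside their product \<open>p\<close>: on
  finitely presented \<open>c\<close> it should be \<open>\<Oplus> Hom(c, X i)\<close>, that is, the arrows \<open>c \<rightarrow> p\<close> with finitely
  many nonzero coordinates. Infinite coproducts have to be built since only products are given.
\<close>

locale product_of_fp = small_accessible \<kappa> C
  for \<kappa> :: "'u rel" and C :: "('o, 'm, 'z) precat_scheme" (structure) +
  fixes I :: "'i set" and X :: "'i \<Rightarrow> 'o" and p :: 'o and \<pi> :: "'i \<Rightarrow> 'm"
  assumes prod: "is_product C I X p \<pi>" and X_fp: "\<And>i. i \<in> I \<Longrightarrow> X i \<in> fp \<kappa> C"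
begin

lemma p_Obj [simp]: "p \<in> Obj C" using prod by (simp add: is_product_def)

lemma X_Obj [simp]: "i \<in> I \<Longrightarrow> X i \<in> Obj C" using X_fp by simp

lemma \<pi>_simps [simp]: "i \<in> I \<Longrightarrow> \<pi> i \<in> Arr C" "i \<in> I \<Longrightarrow> Dom C (\<pi> i) = p" "i \<in> I \<Longrightarrow> Cod C (\<pi> i) = X i"
  using prod by (auto simp: is_product_def Hom_iff)

lemma product_ext:
  assumes g: "g \<in> Hom C c p" and h: "h \<in> Hom C c p" and eq: "\<And>i. i \<in> I \<Longrightarrow> \<pi> i \<cdot> g = \<pi> i \<cdot> h"
  shows "g = h"
proof -
  have "\<exists>!k. k \<in> Hom C c p \<and> (\<forall>i\<in>I. \<pi> i \<cdot> k = \<pi> i \<cdot> h)"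
    by (rule is_product_map[OF prod Hom_Obj(1)[OF h]]) (use h in \<open>simp add: Hom_iff\<close>)
  from ex1_unique[OF this, of g h] show ?thesis using g h eq by blast
qed

text \<open>
  The inclusion of the \<open>i\<close>-th factor, with coordinates given by the Kronecker delta.
\<close>

definition \<delta> :: "'i \<Rightarrow> 'm" where
  "\<delta> i = (SOME d. d \<in> Hom C (X i) p \<and> (\<forall>j\<in>I. \<pi> j \<cdot> d = (if j = i then Ident C (X i) else Zero C (X i) (X j))))"

lemma \<delta>:
  assumes "i \<in> I"
  shows "\<delta> i \<in> Arr C" "Dom C (\<delta> i) = X i" "Cod C (\<delta> i) = p" 
    "\<And>j. j \<in> I \<Longrightarrow> \<pi> j \<cdot> \<delta> i = (if j = i then Ident C (X i) else Zero C (X i) (X j))"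
proof -
  have "\<exists>!d. d \<in> Hom C (X i) p \<and> (\<forall>j\<in>I. \<pi> j \<cdot> d = (if j = i then Ident C (X i) else Zero C (X i) (X j)))"
    by (rule is_product_map[OF prod]) (use assms in \<open>auto simp: Hom_iff\<close>)
  then have "\<delta> i \<in> Hom C (X i) p \<and> (\<forall>j\<in>I. \<pi> j \<cdot> \<delta> i = (if j = i then Ident C (X i) else Zero C (X i) (X j)))"
    unfolding \<delta>_def by (rule someI_ex[OF ex1_implies_ex])
  then show "\<delta> i \<in> Arr C" "Dom C (\<delta> i) = X i" "Cod C (\<delta> i) = p" 
    "\<And>j. j \<in> I \<Longrightarrow> \<pi> j \<cdot> \<delta> i = (if j = i then Ident C (X i) else Zero C (X i) (X j))"
    by (auto simp: Hom_iff)
qed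

lemmas \<delta>_simps [simp] = \<delta>(1-3)

lemma \<pi>_\<delta>_Comp:
  assumes "i \<in> I" "j \<in> I" "a \<in> Arr C" "Cod C a = X i"
  shows "\<pi> j \<cdot> (\<delta> i \<cdot> a) = (if j = i then a else Zero C (Dom C a) (X j))"
  using Comp_eq_assoc[OF \<delta>(4)[OF assms(1,2)], of a] assms by auto

definition supp :: "'m \<Rightarrow> 'i set" where
  "supp k = {i \<in> I. \<pi> i \<cdot> k \<noteq> Zero C (Dom C k) (X i)}"

definition finite_support :: "'m set" where
  "finite_support = {k \<in> Arr C. Dom C k \<in> fp \<kappa> C \<and> Cod C k = p \<and> finite (supp k)}"

lemma supp_Comp:
  "\<lbrakk>k \<in> Arr C; Cod C k = p; w \<in> Arr C; Cod C w = Dom C k\<rbrakk> \<Longrightarrow> supp (k \<cdot> w) \<subseteq> supp k"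
  by (auto simp: supp_def) (metis Comp_eq_assoc Zero_Comp \<pi>_simps X_Obj)

lemma supp_Add:
  "\<lbrakk>k \<in> Arr C; Cod C k = p; l \<in> Arr C; Cod C l = p; Dom C k = Dom C l\<rbrakk>
    \<Longrightarrow> supp (k \<oplus> l) \<subseteq> supp k \<union> supp l"
  by (auto simp: supp_def)

lemma supp_\<delta>: "\<lbrakk>i \<in> I; a \<in> Arr C; Cod C a = X i\<rbrakk> \<Longrightarrow> supp (\<delta> i \<cdot> a) \<subseteq> {i}"
  by (auto simp: supp_def \<pi>_\<delta>_Comp split: if_splits)

lemma supp_remove:
  assumes "k \<in> Arr C" "Cod C k = p" "i \<in> I" "supp k \<subseteq> insert i s"
  shows "supp (k \<ominus> \<delta> i \<cdot> (\<pi> i \<cdot> k)) \<subseteq> s"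
proof
  fix j assume j: "j \<in> supp (k \<ominus> \<delta> i \<cdot> (\<pi> i \<cdot> k))"
  then have jI: "j \<in> I" by (simp add: supp_def)
  show "j \<in> s"
  proof (rule ccontr)
    assume "j \<notin> s"
    then have "j = i \<or> \<pi> j \<cdot> k = Zero C (Dom C k) (X j)" using assms(4) jI by (auto simp: supp_def)
    then have "\<pi> j \<cdot> (k \<ominus> \<delta> i \<cdot> (\<pi> i \<cdot> k)) = Zero C (Dom C k) (X j)"
      using assms(1-3) jI by (auto simp: \<pi>_\<delta>_Comp)
    then show False using j assms(1-3) by (simp add: supp_def)
  qed
qed

lemma supp_empty:
  assumes "k \<in> Arr C" "Cod C k = p" "supp k = {}" shows "k = Zero C (Dom C k) p"
  by (rule product_ext[of _ "Dom C k"]) (use assms in \<open>auto simp: Hom_iff supp_def\<close>)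

text \<open>
  An arrow whose support lies in \<open>s\<close> factors through the biproduct of the objects \<open>X i\<close> for \<open>i\<close> in
  \<open>s\<close>, and an arrow into this biproduct is zero once all its coordinates are. The induction adds one
  factor at a time.
\<close>

lemma finite_support_factors:
  assumes "finite s"
  shows "\<lbrakk>k \<in> Arr C; Dom C k \<in> fp \<kappa> C; Cod C k = p; supp k \<subseteq> s; s \<subseteq> I\<rbrakk> \<Longrightarrow>
    \<exists>w k'. k' \<in> finite_support \<and> w \<in> Hom C (Dom C k) (Dom C k') \<and> k' \<cdot> w = k \<and>
      (\<forall>c. \<forall>u \<in> Hom C c (Dom C k). k \<cdot> u = Zero C c p \<longrightarrow> w \<cdot> u = Zero C c (Dom C k'))"
  using assms
proof (induction s arbitrary: k)
  case empty
  \<comment> \<open>A zero arrow factors through the zero endomorphism of its domain, which takes the place of the empty biproduct.\<close>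
  let ?Z = "Zero C (Dom C k) (Dom C k)"
  have k: "k = Zero C (Dom C k) p" using empty supp_empty by blast
  have "supp k = {}" using empty by simp
  then have "k \<in> finite_support" using empty by (simp add: finite_support_def)
  moreover have "k \<cdot> ?Z = k" using k empty by (metis Comp_Zero fp_Obj)
  moreover have "\<forall>c. \<forall>u \<in> Hom C c (Dom C k). ?Z \<cdot> u = Zero C c (Dom C k)"
    using empty by (auto simp: Hom_iff)
  moreover have "?Z \<in> Hom C (Dom C k) (Dom C k)" using empty by (simp add: Hom_iff)
  ultimately show ?case by blast
next
  case (insert i s)
  note [simp] = insert.prems(1,3)
  have i [simp]: "i \<in> I" using insert.prems by simp
  have d: "Dom C k \<in> fp \<kappa> C" by fact
  define k1 where "k1 = k \<ominus> \<delta> i \<cdot> (\<pi> i \<cdot> k)"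
  have k1 [simp]: "k1 \<in> Arr C" "Dom C k1 = Dom C k" "Cod C k1 = p" by (simp_all add: k1_def)
  have "supp k1 \<subseteq> s" unfolding k1_def by (rule supp_remove) (use insert.prems in auto)
  then obtain w1 k2 where w1: "k2 \<in> finite_support" "w1 \<in> Hom C (Dom C k1) (Dom C k2)" "k2 \<cdot> w1 = k1"
      "\<And>c u. \<lbrakk>u \<in> Hom C c (Dom C k1); k1 \<cdot> u = Zero C c p\<rbrakk> \<Longrightarrow> w1 \<cdot> u = Zero C c (Dom C k2)"
    using insert.IH[OF k1(1) _ k1(3)] d insert.prems(5) by auto
  have k2 [simp]: "k2 \<in> Arr C" "Dom C k2 \<in> fp \<kappa> C" "Cod C k2 = p" "finite (supp k2)"
    using w1(1) by (auto simp: finite_support_def)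
  have w1' [simp]: "w1 \<in> Arr C" "Dom C w1 = Dom C k" "Cod C w1 = Dom C k2" using w1(2) by (auto simp: Hom_iff)
  obtain E e1 e2 r s where bi: "biproduct (Dom C k2) (X i) E e1 e2 r s"
    using biproduct_exists[OF _ X_Obj[OF i]] by fastforce
  have E: "E \<in> fp \<kappa> C" using fp_biproduct[OF _ X_fp[OF i] bi] by simp
  have a [simp]: "e1 \<in> Arr C" "e2 \<in> Arr C" "r \<in> Arr C" "s \<in> Arr C" "Dom C e1 = Dom C k2" "Cod C e1 = E"
      "Dom C e2 = X i" "Cod C e2 = E" "Dom C r = E" "Cod C r = Dom C k2" "Dom C s = E" "Cod C s = X i"
      and eq: "r \<cdot> e1 = Ident C (Dom C k2)" "s \<cdot> e2 = Ident C (X i)"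
        "s \<cdot> e1 = Zero C (Dom C k2) (X i)" "r \<cdot> e2 = Zero C (X i) (Dom C k2)"
    using bi by (auto simp: biproduct_def Hom_iff)
  let ?w = "e1 \<cdot> w1 \<oplus> e2 \<cdot> (\<pi> i \<cdot> k)" and ?k = "k2 \<cdot> r \<oplus> \<delta> i \<cdot> s"
  have rw: "r \<cdot> ?w = w1" "s \<cdot> ?w = \<pi> i \<cdot> k"
    by (simp_all add: Comp_eq_assoc[OF eq(1)] Comp_eq_assoc[OF eq(2)] Comp_eq_assoc[OF eq(3)] Comp_eq_assoc[OF eq(4)])
  have "?k \<cdot> ?w = k2 \<cdot> (r \<cdot> ?w) \<oplus> \<delta> i \<cdot> (s \<cdot> ?w)"
    using Add_Comp[of ?w "k2 \<cdot> r" "\<delta> i \<cdot> s"] by (simp del: Comp_Add)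
  also have "\<dots> = k" unfolding rw w1(3) by (simp add: k1_def)
  finally have kw: "?k \<cdot> ?w = k" .
  have "supp ?k \<subseteq> supp k2 \<union> {i}"
    using supp_Add[of "k2 \<cdot> r" "\<delta> i \<cdot> s"] supp_Comp[of k2 r] supp_\<delta>[of i s] by auto
  then have "?k \<in> finite_support"
    using finite_subset[of "supp ?k" "supp k2 \<union> {i}"] E by (simp add: finite_support_def)
  moreover have "?w \<cdot> u = Zero C c E" if u: "u \<in> Hom C c (Dom C k)" "k \<cdot> u = Zero C c p" for c u
  proof -
    have [simp]: "u \<in> Arr C" "Dom C u = c" "Cod C u = Dom C k" "c \<in> Obj C"
      using u(1) Hom_Obj(1)[OF u(1)] by (auto simp: Hom_iff)
    have "k1 \<cdot> u = Zero C c p" by (simp add: k1_def u(2))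
    then have "w1 \<cdot> u = Zero C c (Dom C k2)" using w1(4)[of u c] by (simp add: Hom_iff)
    then show ?thesis using E by (simp add: u(2))
  qed
  moreover have "?w \<in> Hom C (Dom C k) (Dom C ?k)" by (simp add: Hom_iff)
  ultimately show ?case using kw by (intro exI[of _ ?w] exI[of _ ?k]) simp
qed

lemma flat_finite_support: "flat_subfunctor p finite_support"
  unfolding flat_subfunctor_def
proof (intro conjI ballI allI impI)
  fix k assume k: "k \<in> finite_support"
  then show "k \<in> Arr C" "Dom C k \<in> fp \<kappa> C" "Cod C k = p" by (auto simp: finite_support_def)
next
  fix c assume "c \<in> fp \<kappa> C"
  moreover from this have "supp (Zero C c p) = {}" by (auto simp: supp_def)
  ultimately show "Zero C c p \<in> finite_support" by (simp add: finite_support_def)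
next
  fix k k' assume "k \<in> finite_support" "k' \<in> finite_support" "Dom C k = Dom C k'"
  then show "k \<oplus> k' \<in> finite_support" using supp_Add[of k k'] finite_subset
    by (auto simp: finite_support_def)
next
  fix k c w assume "k \<in> finite_support" "c \<in> fp \<kappa> C" "w \<in> Hom C c (Dom C k)"
  then show "k \<cdot> w \<in> finite_support" using supp_Comp[of k w] finite_subset
    by (auto simp: finite_support_def Hom_iff)
next
  fix k c u
  assume k: "k \<in> finite_support" and u: "u \<in> Hom C c (Dom C k)" "k \<cdot> u = Zero C c p"
  have "supp k \<subseteq> I" by (auto simp: supp_def)
  then show "\<exists>w k'. k' \<in> finite_support \<and> w \<in> Hom C (Dom C k) (Dom C k') \<and> k' \<cdot> w = k \<and> w \<cdot> u = Zero C c (Dom C k')"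
    using finite_support_factors[of "supp k" k] k u by (simp add: finite_support_def) blast
qed simp

text \<open>
  The arrow \<open>\<Sum>\<^sub>i f i \<pi> i k\<close>. It is natural in \<open>k\<close>, so it defines a transformation from the
  functor of finitely supported arrows to \<open>Hom(-, y)\<close>, which will be induced by the arrow out of the
  coproduct with components \<open>f i\<close>.
\<close>

definition copair :: "'o \<Rightarrow> ('i \<Rightarrow> 'm) \<Rightarrow> 'm \<Rightarrow> 'm" where
  "copair y f k = finprod (hom_group C (Dom C k) y) (\<lambda>i. f i \<cdot> (\<pi> i \<cdot> k)) (supp k)"

lemma copair_on:
  assumes k: "k \<in> finite_support" and f: "\<And>i. i \<in> I \<Longrightarrow> f i \<in> Hom C (X i) y" and y: "y \<in> Obj C"
    and s: "finite s" "supp k \<subseteq> s" "s \<subseteq> I"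
  shows "copair y f k = finprod (hom_group C (Dom C k) y) (\<lambda>i. f i \<cdot> (\<pi> i \<cdot> k)) s"
proof -
  have [simp]: "k \<in> Arr C" "Dom C k \<in> fp \<kappa> C" "Cod C k = p" using k by (auto simp: finite_support_def)
  interpret comm_group "hom_group C (Dom C k) y" using comm_group_hom_group y by simp
  have [simp]: "f i \<in> Arr C" "Dom C (f i) = X i" "Cod C (f i) = y" if "i \<in> I" for i
    using f[OF that] by (auto simp: Hom_iff)
  show ?thesis unfolding copair_def
  proof (rule finprod_mono_neutral_cong_left[OF s(1,2)])
    fix i assume "i \<in> s - supp k"
    then have "i \<in> I" "\<pi> i \<cdot> k = Zero C (Dom C k) (X i)" using s(3) by (auto simp: supp_def)
    then show "f i \<cdot> (\<pi> i \<cdot> k) = \<one>\<^bsub>hom_group C (Dom C k) y\<^esub>" by simp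
  next
    show "(\<lambda>i. f i \<cdot> (\<pi> i \<cdot> k)) \<in> s \<rightarrow> carrier (hom_group C (Dom C k) y)"
      using s(3) by (auto simp: Hom_iff)
  qed simp
qed

lemma copair_Hom:
  assumes k: "k \<in> finite_support" and f: "\<And>i. i \<in> I \<Longrightarrow> f i \<in> Hom C (X i) y" and y: "y \<in> Obj C"
  shows "copair y f k \<in> Hom C (Dom C k) y"
proof -
  have [simp]: "k \<in> Arr C" "Dom C k \<in> fp \<kappa> C" "Cod C k = p" using k by (auto simp: finite_support_def)
  interpret comm_group "hom_group C (Dom C k) y" using comm_group_hom_group y by simp
  have "copair y f k \<in> carrier (hom_group C (Dom C k) y)" unfolding copair_def
    using f by (intro finprod_closed) (auto simp: Hom_iff supp_def)
  then show ?thesis by simp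
qed

lemma finprod_Comp:
  assumes g: "\<And>i. i \<in> s \<Longrightarrow> g i \<in> Hom C x y" and w: "w \<in> Hom C c x" and y: "y \<in> Obj C" and s: "finite s"
  shows "finprod (hom_group C x y) g s \<cdot> w = finprod (hom_group C c y) (\<lambda>i. g i \<cdot> w) s"
proof -
  interpret X: comm_group "hom_group C x y" using comm_group_hom_group Hom_Obj[OF w] y by simp
  interpret W: comm_group "hom_group C c y" using comm_group_hom_group Hom_Obj[OF w] y by simp
  show ?thesis using s g
  proof (induction s)
    case empty
    show ?case using w y by (auto simp: Hom_iff)
  next
    case (insert i s)
    have F: "finprod (hom_group C x y) g s \<in> Hom C x y" 
      using X.finprod_closed[of g s] insert.prems by auto
    have "finprod (hom_group C c y) (\<lambda>i. g i \<cdot> w) (insert i s)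
      = g i \<cdot> w \<oplus> finprod (hom_group C c y) (\<lambda>i. g i \<cdot> w) s"
      using insert w by (subst W.finprod_insert) (auto intro: Comp_in_Hom)
    moreover have "finprod (hom_group C x y) g (insert i s) = g i \<oplus> finprod (hom_group C x y) g s"
      using insert by (subst X.finprod_insert) auto
    ultimately show ?case using insert.IH insert.prems F w by (auto simp: Hom_iff)
  qed
qed

lemma copair_Comp:
  assumes k: "k \<in> finite_support" and c: "c \<in> fp \<kappa> C" and w: "w \<in> Hom C c (Dom C k)"
    and f: "\<And>i. i \<in> I \<Longrightarrow> f i \<in> Hom C (X i) y" and y: "y \<in> Obj C"
  shows "copair y f (k \<cdot> w) = copair y f k \<cdot> w"
proof -
  have [simp]: "k \<in> Arr C" "Dom C k \<in> fp \<kappa> C" "Cod C k = p" "finite (supp k)"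
    using k by (auto simp: finite_support_def)
  have [simp]: "w \<in> Arr C" "Dom C w = c" "Cod C w = Dom C k" using w by (auto simp: Hom_iff)
  have [simp]: "f i \<in> Arr C" "Dom C (f i) = X i" "Cod C (f i) = y" if "i \<in> I" for i
    using f[OF that] by (auto simp: Hom_iff)
  have s: "supp k \<subseteq> I" by (auto simp: supp_def)
  have kw: "k \<cdot> w \<in> finite_support" using flat_finite_support k c w by (auto simp: flat_subfunctor_def)
  interpret W: comm_group "hom_group C c y" using comm_group_hom_group y c by simp
  have "copair y f (k \<cdot> w) = finprod (hom_group C c y) (\<lambda>i. f i \<cdot> (\<pi> i \<cdot> (k \<cdot> w))) (supp k)"
    using copair_on[OF kw f y _ supp_Comp s] by simp
  also have "\<dots> = finprod (hom_group C c y) (\<lambda>i. f i \<cdot> (\<pi> i \<cdot> k) \<cdot> w) (supp k)"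
    by (rule W.finprod_cong') (use s in \<open>auto simp: Hom_iff\<close>)
  also have "\<dots> = copair y f k \<cdot> w" unfolding copair_def
    by (rule finprod_Comp[symmetric]) (use s w y in \<open>auto simp: Hom_iff\<close>)
  finally show ?thesis .
qed

lemma copair_\<delta>:
  assumes i: "i \<in> I" and f: "\<And>i. i \<in> I \<Longrightarrow> f i \<in> Hom C (X i) y" and y: "y \<in> Obj C"
  shows "copair y f (\<delta> i) = f i"
proof -
  have "supp (\<delta> i) \<subseteq> {i}" using i by (auto simp: supp_def \<delta>(4) split: if_splits)
  moreover from this have "\<delta> i \<in> finite_support" 
    using i X_fp finite_subset[of "supp (\<delta> i)" "{i}"] by (simp add: finite_support_def)
  ultimately have "copair y f (\<delta> i) = finprod (hom_group C (X i) y) (\<lambda>j. f j \<cdot> (\<pi> j \<cdot> \<delta> i)) {i}"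
    using copair_on[of "\<delta> i" f y "{i}"] f y i by simp
  moreover interpret comm_group "hom_group C (X i) y" using comm_group_hom_group y i by simp
  have "finprod (hom_group C (X i) y) (\<lambda>j. f j \<cdot> (\<pi> j \<cdot> \<delta> i)) {i} = f i"
    using i f[OF i] \<delta>(4)[OF i i] by (subst finprod_insert) (auto simp: Hom_iff)
  ultimately show ?thesis by simp
qed

text \<open>
  The coproduct represents the finitely supported arrows. Existence of the arrow with components
  \<open>f\<close> is its universal property for \<open>copair y f\<close>. Uniqueness holds because arrows are determined on
  finitely presented objects, and there each element is a finite sum of elements factoring through
  the inclusions.
\<close>

lemma coproduct_exists:
  "\<exists>Q \<sigma>. Q \<in> Obj C \<and> (\<forall>i \<in> I. \<sigma> i \<in> Hom C (X i) Q) \<and>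
     (\<forall>y f. y \<in> Obj C \<longrightarrow> (\<forall>i \<in> I. f i \<in> Hom C (X i) y) \<longrightarrow> (\<exists>h \<in> Hom C Q y. \<forall>i \<in> I. h \<cdot> \<sigma> i = f i)) \<and>
     (\<forall>y. \<forall>g \<in> Hom C Q y. \<forall>h \<in> Hom C Q y. (\<forall>i \<in> I. g \<cdot> \<sigma> i = h \<cdot> \<sigma> i) \<longrightarrow> g = h)"
proof -
  obtain Q e where rep: "represents p finite_support Q e"
    using flat_subfunctor_representable[OF flat_finite_support] by blast
  note rep = rep[unfolded represents_def]
  have e: "e \<in> Hom C Q p"
    and fin: "\<And>c l. \<lbrakk>c \<in> fp \<kappa> C; l \<in> Hom C c Q\<rbrakk> \<Longrightarrow> e \<cdot> l \<in> finite_support"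
    and sur: "\<And>k. k \<in> finite_support \<Longrightarrow> \<exists>l \<in> Hom C (Dom C k) Q. e \<cdot> l = k"
    and inj: "\<And>c l. \<lbrakk>c \<in> fp \<kappa> C; l \<in> Hom C c Q; e \<cdot> l = Zero C c p\<rbrakk> \<Longrightarrow> l = Zero C c Q"
    using rep by simp_all
  note univ = rep[THEN conjunct2, THEN conjunct2, THEN conjunct2, rule_format]
  have Q: "Q \<in> Obj C" and [simp]: "e \<in> Arr C" "Dom C e = Q" "Cod C e = p" using e Hom_Obj[OF e] by (auto simp: Hom_iff)
  have df: "\<delta> i \<in> finite_support" if "i \<in> I" for i
    using that supp_\<delta>[OF that, of "Ident C (X i)"] X_fp finite_subset[of "supp (\<delta> i)" "{i}"]
    by (simp add: finite_support_def)
  have "\<forall>i \<in> I. \<exists>l. l \<in> Hom C (X i) Q \<and> e \<cdot> l = \<delta> i" using sur[OF df] by fastforce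
  then obtain \<sigma> where s: "\<forall>i \<in> I. \<sigma> i \<in> Hom C (X i) Q \<and> e \<cdot> \<sigma> i = \<delta> i" by metis
  have s' [simp]: "\<sigma> i \<in> Arr C" "Dom C (\<sigma> i) = X i" "Cod C (\<sigma> i) = Q" and es: "e \<cdot> \<sigma> i = \<delta> i" if "i \<in> I" for i
    using s that by (auto simp: Hom_iff)
  have ex: "\<exists>h \<in> Hom C Q y. \<forall>i \<in> I. h \<cdot> \<sigma> i = f i" if y: "y \<in> Obj C" and f: "\<forall>i \<in> I. f i \<in> Hom C (X i) y" for y f
  proof -
    have f': "\<And>i. i \<in> I \<Longrightarrow> f i \<in> Hom C (X i) y" using f by blast
    have "\<exists>h \<in> Hom C Q y. \<forall>c \<in> fp \<kappa> C. \<forall>l \<in> Hom C c Q. h \<cdot> l = copair y f (e \<cdot> l)"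
    proof (rule univ[OF y])
      show "copair y f k \<in> Hom C (Dom C k) y" if "k \<in> finite_support" for k
        by (rule copair_Hom[OF that f' y])
      show "copair y f (k \<cdot> w) = copair y f k \<cdot> w"
        if "k \<in> finite_support" "c \<in> fp \<kappa> C" "w \<in> Hom C c (Dom C k)" for k c w
        by (rule copair_Comp[OF that f' y])
    qed
    then obtain h where h: "h \<in> Hom C Q y" "\<forall>c \<in> fp \<kappa> C. \<forall>l \<in> Hom C c Q. h \<cdot> l = copair y f (e \<cdot> l)"
      by blast
    have "h \<cdot> \<sigma> i = f i" if "i \<in> I" for i
      using h(2) s that X_fp[OF that] copair_\<delta>[OF that f' y] by simp
    then show ?thesis using h(1) by blast
  qed
  have uq: "g = h" if g: "g \<in> Hom C Q y" and h: "h \<in> Hom C Q y" and eq: "\<forall>i \<in> I. g \<cdot> \<sigma> i = h \<cdot> \<sigma> i" for y g h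
  proof (rule fp_separate[OF g h])
    have y: "y \<in> Obj C" using Hom_Obj(2)[OF g] .
    have [simp]: "g \<in> Arr C" "Dom C g = Q" "Cod C g = y" "h \<in> Arr C" "Dom C h = Q" "Cod C h = y"
      using g h by (auto simp: Hom_iff)
    have *: "g \<cdot> l = h \<cdot> l" if "finite s" "s \<subseteq> I" "c \<in> fp \<kappa> C" "l \<in> Hom C c Q" "supp (e \<cdot> l) \<subseteq> s" for s c l
      using that
    proof (induction s arbitrary: l)
      case empty
      have "e \<cdot> l = Zero C c p" using supp_empty[of "e \<cdot> l"] empty by (auto simp: Hom_iff)
      then have "l = Zero C c Q" using inj empty by blast
      then show ?case using Q y empty by simp
    next
      case (insert i s)
      have i [simp]: "i \<in> I" using insert.prems by simp
      have l [simp]: "l \<in> Arr C" "Dom C l = c" "Cod C l = Q" using insert.prems by (auto simp: Hom_iff)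
      let ?a = "\<pi> i \<cdot> (e \<cdot> l)"
      let ?l = "l \<ominus> \<sigma> i \<cdot> ?a"
      have l': "?l \<in> Hom C c Q" by (simp add: Hom_iff)
      \<comment> \<open>Subtracting the \<open>i\<close>-th coordinate removes \<open>i\<close> from the support.\<close>
      have "e \<cdot> ?l = (e \<cdot> l) \<ominus> \<delta> i \<cdot> (\<pi> i \<cdot> (e \<cdot> l))"
        by (simp add: Comp_eq_assoc[OF es])
      then have "supp (e \<cdot> ?l) \<subseteq> s" using supp_remove[of "e \<cdot> l" i s] insert.prems by simp
      then have 1: "g \<cdot> ?l = h \<cdot> ?l" using insert.IH[OF _ _ l'] insert.prems by simp
      have 2: "g \<cdot> (\<sigma> i \<cdot> ?a) = h \<cdot> (\<sigma> i \<cdot> ?a)"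
        using Comp_eq_assoc[of g "\<sigma> i" "h \<cdot> \<sigma> i" ?a] eq by simp
      have 3: "k \<cdot> l = k \<cdot> ?l \<oplus> k \<cdot> (\<sigma> i \<cdot> ?a)" if "k \<in> Arr C" "Dom C k = Q" for k
      proof -
        have "l = ?l \<oplus> \<sigma> i \<cdot> ?a" by simp
        then have "k \<cdot> l = k \<cdot> (?l \<oplus> \<sigma> i \<cdot> ?a)" by simp
        then show ?thesis using that by simp
      qed
      show ?case using 3[of g] 3[of h] 1 2 by (simp only: \<open>g \<in> Arr C\<close> \<open>Dom C g = Q\<close> \<open>h \<in> Arr C\<close> \<open>Dom C h = Q\<close>)
    qed
    fix c l assume cl: "c \<in> fp \<kappa> C" "l \<in> Hom C c Q"
    show "g \<cdot> l = h \<cdot> l"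
      by (rule *[of "supp (e \<cdot> l)" c l]) (use cl fin[OF cl] in \<open>auto simp: finite_support_def supp_def\<close>)
  qed
  show ?thesis using Q s ex uq by (intro exI[of _ Q] exI[of _ \<sigma>] conjI) blast+
qed

end

section \<open>Exactness on finitely presented objects and flat kernels\<close>

lemma (in preadditive_category) exact_at_iff:
  assumes f: "f \<in> Hom C x y" and g: "g \<in> Hom C y z"
  shows "exact_at C c x y z f g \<longleftrightarrow> (\<forall>h \<in> Hom C c x. g \<cdot> (f \<cdot> h) = Zero C c z) \<and>
    (\<forall>h \<in> Hom C c y. g \<cdot> h = Zero C c z \<longrightarrow> (\<exists>h' \<in> Hom C c x. f \<cdot> h' = h))"
proof -
  have "\<And>h. h \<in> Hom C c x \<Longrightarrow> f \<cdot> h \<in> Hom C c y" using Comp_in_Hom f by blast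
  then show ?thesis unfolding exact_at_def kernel_def
    by (simp add: set_eq_iff image_iff Bex_def Ball_def) metis
qed

context small_accessible
begin

text \<open>
  Flatness of the functor \<open>Hom(-, y)\<close>: \<open>y\<close> is a filtered colimit of finitely presented objects, \<open>k\<close>
  factors through one of them, and the relation \<open>k u = 0\<close> holds at a later one.
\<close>

lemma fp_stage_kills:
  assumes D: "D \<in> fp \<kappa> C" and c: "c \<in> fp \<kappa> C" and k: "k \<in> Hom C D y" and u: "u \<in> Hom C c D"
    and ku: "k \<cdot> u = Zero C c y"
  shows "\<exists>E \<in> fp \<kappa> C. \<exists>w \<in> Hom C D E. \<exists>k' \<in> Hom C E y. k' \<cdot> w = k \<and> w \<cdot> u = Zero C c E"
proof -
  obtain J :: "('u, 'u) cat" and T \<iota> where J: "small_filtered \<kappa> J" "is_functor J C T"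
    "is_colimit J C T y \<iota>" "\<forall>j \<in> Obj J. FObj T j \<in> fp \<kappa> C \<and> \<iota> j \<in> Hom C (FObj T j) y"
    using fp_presentation[OF Hom_Obj(2)[OF k]] by blast
  interpret J: category J using J by (simp add: small_filtered_def)
  note [simp] = functor_simps[OF J(2)]
  obtain j f where j: "j \<in> Obj J" "f \<in> Hom C D (FObj T j)" "\<iota> j \<cdot> f = k"
    using fp_factors[OF D J(1-3) k] by blast
  have i: "\<iota> j \<in> Hom C (FObj T j) y" using J(4) j by blast
  have fu: "f \<cdot> u \<in> Hom C c (FObj T j)" "\<iota> j \<cdot> (f \<cdot> u) = Zero C c y"
    using j u ku i Comp_eq_assoc[OF j(3), of u] by (auto simp: Hom_iff)
  obtain m v where v: "v \<in> Hom J j m" "FArr T v \<cdot> (f \<cdot> u) = Zero C c (FObj T m)"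
    using fp_killed_at_stage[OF c J(1-3) j(1) fu] by blast
  have m: "m \<in> Obj J" using J.Hom_Obj(2)[OF v(1)] .
  have im: "\<iota> m \<cdot> FArr T v = \<iota> j" using J(3) v(1) unfolding is_colimit_def is_cocone_def by blast
  have mH: "\<iota> m \<in> Hom C (FObj T m) y" using J(4) m by blast
  have "FArr T v \<cdot> f \<in> Hom C D (FObj T m)" "FArr T v \<cdot> f \<cdot> u = Zero C c (FObj T m)"
    using v j u by (auto simp: Hom_iff)
  moreover have "\<iota> m \<cdot> (FArr T v \<cdot> f) = k" using Comp_eq_assoc[OF im, of f] v j mH by (auto simp: Hom_iff)
  ultimately show ?thesis using J(4) m mH by blast
qed

text \<open>
  Flatness, in the sense of \<open>flat_subfunctor\<close>, of the functor of arrows killed by \<open>g\<close>.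
\<close>

definition flat_kernel :: "'m \<Rightarrow> bool" where
  "flat_kernel g \<longleftrightarrow> (\<forall>D \<in> fp \<kappa> C. \<forall>k \<in> Hom C D (Dom C g). g \<cdot> k = Zero C D (Cod C g) \<longrightarrow>
     (\<forall>c \<in> fp \<kappa> C. \<forall>u \<in> Hom C c D. k \<cdot> u = Zero C c (Dom C g) \<longrightarrow>
       (\<exists>E \<in> fp \<kappa> C. \<exists>w \<in> Hom C D E. \<exists>k' \<in> Hom C E (Dom C g).
          k' \<cdot> w = k \<and> g \<cdot> k' = Zero C E (Cod C g) \<and> w \<cdot> u = Zero C c E)))"

definition fp_exact :: "'m \<Rightarrow> 'm \<Rightarrow> bool" where
  "fp_exact e g \<longleftrightarrow> e \<in> Arr C \<and> g \<in> Arr C \<and> Cod C e = Dom C g \<and> g \<cdot> e = Zero C (Dom C e) (Cod C g) \<and>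
     (\<forall>c \<in> fp \<kappa> C. \<forall>h \<in> Hom C c (Dom C g). g \<cdot> h = Zero C c (Cod C g) \<longrightarrow>
        (\<exists>h' \<in> Hom C c (Dom C e). e \<cdot> h' = h))"

lemma flat_kernel_Zero:
  assumes "x \<in> Obj C" "y \<in> Obj C" shows "flat_kernel (Zero C x y)"
  unfolding flat_kernel_def
proof (intro ballI impI)
  fix D k c u
  assume "D \<in> fp \<kappa> C" "k \<in> Hom C D (Dom C (Zero C x y))" "c \<in> fp \<kappa> C" "u \<in> Hom C c D"
    "k \<cdot> u = Zero C c (Dom C (Zero C x y))"
  then obtain E w k' where "E \<in> fp \<kappa> C" "w \<in> Hom C D E" "k' \<in> Hom C E x" "k' \<cdot> w = k" "w \<cdot> u = Zero C c E"
    using fp_stage_kills[of D c k x u] assms by auto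
  then show "\<exists>E\<in>fp \<kappa> C. \<exists>w\<in>Hom C D E. \<exists>k'\<in>Hom C E (Dom C (Zero C x y)). k' \<cdot> w = k \<and>
      Zero C x y \<cdot> k' = Zero C E (Cod C (Zero C x y)) \<and> w \<cdot> u = Zero C c E"
    using assms by (intro bexI[of _ E] bexI[of _ w] bexI[of _ k']) (auto simp: Hom_iff)
qed

text \<open>
  Flatness moves one step to the left along an exact sequence. The predicate \<open>N\<close> stands for any
  relation that can be realized at a finitely presented stage of \<open>Dom e\<close>, such as \<open>w u = 0\<close> or its
  image \<open>\<Lambda> w u = 0\<close> under a functor; the claim is that the stage can be chosen inside the kernel of
  \<open>e\<close>. The stage \<open>k1\<close> need not be killed by \<open>e\<close>, but \<open>e k1\<close> is a cycle that vanishes on \<open>w\<close>. By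
  flatness it factors through an arrow \<open>w2\<close> that already vanishes on \<open>w\<close>. Lifting the other
  factor along \<open>e\<close> yields a correction of \<open>k1\<close> that does not affect \<open>k1 w\<close>.
\<close>

lemma kernel_factorization:
  assumes ex: "fp_exact e g" and fl: "flat_kernel g" and D: "D \<in> fp \<kappa> C"
    and k: "k \<in> Hom C D (Dom C e)" "e \<cdot> k = Zero C D (Cod C e)"
    and N: "\<exists>E \<in> fp \<kappa> C. \<exists>w \<in> Hom C D E. \<exists>k' \<in> Hom C E (Dom C e). k' \<cdot> w = k \<and> N E w"
  shows "\<exists>E \<in> fp \<kappa> C. \<exists>w \<in> Hom C D E. \<exists>k' \<in> Hom C E (Dom C e).
    k' \<cdot> w = k \<and> e \<cdot> k' = Zero C E (Cod C e) \<and> N E w"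
proof -
  have e [simp]: "e \<in> Arr C" "g \<in> Arr C" "Cod C e = Dom C g" and ge: "g \<cdot> e = Zero C (Dom C e) (Cod C g)"
    using ex by (auto simp: fp_exact_def)
  obtain E w k1 where E: "E \<in> fp \<kappa> C" "w \<in> Hom C D E" "k1 \<in> Hom C E (Dom C e)" "k1 \<cdot> w = k" "N E w"
    using N by blast
  have [simp]: "w \<in> Arr C" "Dom C w = D" "Cod C w = E" "k1 \<in> Arr C" "Dom C k1 = E" "Cod C k1 = Dom C e" "E \<in> Obj C"
    using E by (auto simp: Hom_iff)
  have "e \<cdot> k1 \<in> Hom C E (Dom C g)" "g \<cdot> (e \<cdot> k1) = Zero C E (Cod C g)" "e \<cdot> k1 \<cdot> w = Zero C D (Dom C g)"
    using E(4) k(2) Comp_eq_assoc[OF ge, of k1] by (auto simp: Hom_iff)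
  then obtain E2 w2 m where m: "E2 \<in> fp \<kappa> C" "w2 \<in> Hom C E E2" "m \<in> Hom C E2 (Dom C g)" "m \<cdot> w2 = e \<cdot> k1"
      "g \<cdot> m = Zero C E2 (Cod C g)" "w2 \<cdot> w = Zero C D E2"
    using fl D E(1,2) unfolding flat_kernel_def by blast
  obtain m' where m': "m' \<in> Hom C E2 (Dom C e)" "e \<cdot> m' = m"
    using ex m(1,3,5) unfolding fp_exact_def by blast
  have [simp]: "w2 \<in> Arr C" "Dom C w2 = E" "Cod C w2 = E2" "m' \<in> Arr C" "Dom C m' = E2" "Cod C m' = Dom C e"
    using m m' by (auto simp: Hom_iff)
  let ?k = "k1 \<ominus> m' \<cdot> w2"
  have "?k \<cdot> w = k" using D k(1) by (auto simp: E(4) m(6) Hom_iff)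
  moreover have "e \<cdot> ?k = Zero C E (Cod C e)" using Comp_eq_assoc[OF m'(2), of w2] m(3,4) by (auto simp: Hom_iff)
  moreover have "?k \<in> Hom C E (Dom C e)" by (simp add: Hom_iff)
  ultimately show ?thesis using E by blast
qed

lemma flat_kernel_exact:
  assumes ex: "fp_exact e g" and fl: "flat_kernel g"
  shows "flat_kernel e"
  unfolding flat_kernel_def
proof (intro ballI impI)
  fix D k c u
  assume *: "D \<in> fp \<kappa> C" "k \<in> Hom C D (Dom C e)" "e \<cdot> k = Zero C D (Cod C e)" "c \<in> fp \<kappa> C" "u \<in> Hom C c D"
    "k \<cdot> u = Zero C c (Dom C e)"
  show "\<exists>E\<in>fp \<kappa> C. \<exists>w\<in>Hom C D E. \<exists>k'\<in>Hom C E (Dom C e).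
      k' \<cdot> w = k \<and> e \<cdot> k' = Zero C E (Cod C e) \<and> w \<cdot> u = Zero C c E"
    by (rule kernel_factorization[OF ex fl *(1-3) fp_stage_kills[OF *(1,4,2,5,6)]])
qed

text \<open>
  The kernel represents the flat functor of arrows killed by \<open>e\<close>.
\<close>

lemma kernel_exists:
  assumes e: "e \<in> Hom C y z" and fl: "flat_kernel e"
  shows "\<exists>x f. f \<in> Hom C x y \<and> (\<forall>c \<in> fp \<kappa> C. inj_on (\<lambda>h. f \<cdot> h) (Hom C c x) \<and> exact_at C c x y z f e)"
proof -
  have [simp]: "e \<in> Arr C" "Dom C e = y" "Cod C e = z" "y \<in> Obj C" "z \<in> Obj C"
    using e Hom_Obj[OF e] by (auto simp: Hom_iff)
  let ?K = "{k \<in> Arr C. Dom C k \<in> fp \<kappa> C \<and> Cod C k = y \<and> e \<cdot> k = Zero C (Dom C k) z}"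
  have "flat_subfunctor y ?K"
    unfolding flat_subfunctor_def
  proof (intro conjI ballI allI impI)
    fix k c w assume "k \<in> ?K" "c \<in> fp \<kappa> C" "w \<in> Hom C c (Dom C k)"
    then show "k \<cdot> w \<in> ?K" using Comp_eq_assoc[of e k _ w] by (auto simp: Hom_iff)
  next
    fix k c u assume k: "k \<in> ?K" and c: "c \<in> fp \<kappa> C" and u: "u \<in> Hom C c (Dom C k)" "k \<cdot> u = Zero C c y"
    have "k \<in> Hom C (Dom C k) y" using k by (simp add: Hom_iff)
    then obtain E w k' where w: "E \<in> fp \<kappa> C" "w \<in> Hom C (Dom C k) E" "k' \<in> Hom C E y" "k' \<cdot> w = k"
        "e \<cdot> k' = Zero C E z" "w \<cdot> u = Zero C c E"
      using fl[unfolded flat_kernel_def, rule_format, of "Dom C k" k c u] k c u by auto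
    then show "\<exists>w k'. k' \<in> ?K \<and> w \<in> Hom C (Dom C k) (Dom C k') \<and> k' \<cdot> w = k \<and> w \<cdot> u = Zero C c (Dom C k')"
      by (intro exI[of _ w] exI[of _ k']) (auto simp: Hom_iff)
  qed auto
  from flat_subfunctor_representable[OF this] obtain x f where rep: "represents y ?K x f" by blast
  note rep = rep[unfolded represents_def]
  have f: "f \<in> Hom C x y"
    and ker: "\<And>c l. \<lbrakk>c \<in> fp \<kappa> C; l \<in> Hom C c x\<rbrakk> \<Longrightarrow> f \<cdot> l \<in> ?K"
    and sur: "\<And>k. k \<in> ?K \<Longrightarrow> \<exists>l \<in> Hom C (Dom C k) x. f \<cdot> l = k"
    and inj: "\<And>c l. \<lbrakk>c \<in> fp \<kappa> C; l \<in> Hom C c x; f \<cdot> l = Zero C c y\<rbrakk> \<Longrightarrow> l = Zero C c x"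
    using rep by blast+
  have "inj_on (\<lambda>h. f \<cdot> h) (Hom C c x)" if c: "c \<in> fp \<kappa> C" for c
  proof (rule inj_onI)
    fix h h' assume h: "h \<in> Hom C c x" "h' \<in> Hom C c x" "f \<cdot> h = f \<cdot> h'"
    then have "h \<ominus> h' = Zero C c x" using f c by (intro inj) (auto simp: Hom_iff)
    then show "h = h'" using h Sub_eq_Zero_iff[of h h'] by (auto simp: Hom_iff)
  qed
  moreover have "exact_at C c x y z f e" if c: "c \<in> fp \<kappa> C" for c
    unfolding exact_at_iff[OF f e] using ker[OF c] sur c f by (fastforce simp: Hom_iff)
  ultimately show ?thesis using f by blast
qed

text \<open>
  Being a pure epimorphism includes the existence of a kernel; the kernel is flat because the zero
  arrow out of \<open>z\<close> has a flat kernel and \<open>e\<close> is exact against it.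
\<close>

lemma pure_epiI:
  assumes e: "e \<in> Hom C y z" and sur: "\<And>c h. \<lbrakk>c \<in> fp \<kappa> C; h \<in> Hom C c z\<rbrakk> \<Longrightarrow> \<exists>h' \<in> Hom C c y. e \<cdot> h' = h"
  shows "pure_epi \<kappa> C y z e"
proof -
  have z: "z \<in> Obj C" using Hom_Obj[OF e] by blast
  have "fp_exact e (Zero C z z)" using e z sur by (auto simp: fp_exact_def Hom_iff)
  then have "flat_kernel e" using flat_kernel_exact flat_kernel_Zero z by blast
  then obtain x f where f: "f \<in> Hom C x y" "\<forall>c \<in> fp \<kappa> C. inj_on (\<lambda>h. f \<cdot> h) (Hom C c x) \<and> exact_at C c x y z f e"
    using kernel_exists[OF e] by blast
  moreover have "(\<lambda>h. e \<cdot> h) ` Hom C c y = Hom C c z" if "c \<in> fp \<kappa> C" for c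
    using sur[OF that] Comp_in_Hom[OF e] by (auto simp: image_iff)
  ultimately have "pure_exact \<kappa> C x y z f e" using e by (simp add: pure_exact_def)
  then show ?thesis by (auto simp: pure_epi_def)
qed

section \<open>Pure projective objects\<close>

text \<open>
  An arrow out of \<open>P\<close> lifts along \<open>u\<close> as soon as all its restrictions to finitely presented objects
  do. Since the condition concerns a single arrow \<open>h\<close> rather than all arrows into \<open>z\<close>, it yields
  liftings of cycles along a differential without passing to the kernel.
\<close>

definition pure_lifting :: "'o \<Rightarrow> bool" where
  "pure_lifting P \<longleftrightarrow> P \<in> Obj C \<and> (\<forall>y z. \<forall>u \<in> Hom C y z. \<forall>h \<in> Hom C P z.
     (\<forall>c \<in> fp \<kappa> C. \<forall>l \<in> Hom C c P. \<exists>l' \<in> Hom C c y. u \<cdot> l' = h \<cdot> l) \<longrightarrow> (\<exists>h' \<in> Hom C P y. u \<cdot> h' = h))"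

text \<open>
  The cover is the coproduct of the finitely presented objects \<open>Dom k\<close>, over all arrows \<open>k\<close> from
  representatives of the finitely presented objects with \<open>g k = 0\<close>. Covering the kernel of \<open>g\<close>
  instead of an object is what makes these covers compose to a resolution; for \<open>g\<close> zero one
  obtains a cover of \<open>x\<close>.
\<close>

lemma pure_cover:
  assumes g: "g \<in> Hom C x y"
  shows "\<exists>e. e \<in> Hom C (Dom C e) x \<and> pure_lifting (Dom C e) \<and> fp_exact e g"
proof -
  have [simp]: "g \<in> Arr C" "Dom C g = x" "Cod C g = y" "x \<in> Obj C" "y \<in> Obj C"
    using g Hom_Obj[OF g] by (auto simp: Hom_iff)
  obtain S where S: "S \<subseteq> fp \<kappa> C" "|S| <o \<kappa>" "\<forall>x \<in> fp \<kappa> C. \<exists>y \<in> S. isomorphic C x y"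
    using fp_skeletally_small by blast
  define I where "I = {k \<in> Arr C. Dom C k \<in> S \<and> Cod C k = x \<and> g \<cdot> k = Zero C (Dom C k) y}"
  have I: "k \<in> Arr C" "Dom C k \<in> S" "Cod C k = x" "g \<cdot> k = Zero C (Dom C k) y" if "k \<in> I" for k
    using that by (auto simp: I_def)
  note [simp] = I(1,3)
  have S': "S \<subseteq> Obj C" using S(1) by auto
  have "|I| <o \<kappa>"
    by (rule small_subset[OF inaccessible small_arrows_from[OF S(2) S' \<open>x \<in> Obj C\<close>]]) (use I(1-3) in blast)
  then have "\<exists>p \<pi>. is_product C I (Dom C) p \<pi>" by (rule product_exists) simp
  then obtain p \<pi> where P: "is_product C I (Dom C) p \<pi>" by blast
  interpret P: product_of_fp \<kappa> C I "Dom C" p \<pi>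
    by unfold_locales (use P I(2) S(1) in auto)
  obtain Q \<sigma> where Q: "Q \<in> Obj C" and s: "\<forall>i \<in> I. \<sigma> i \<in> Hom C (Dom C i) Q"
    and ex: "\<forall>y f. y \<in> Obj C \<longrightarrow> (\<forall>i \<in> I. f i \<in> Hom C (Dom C i) y) \<longrightarrow> (\<exists>h \<in> Hom C Q y. \<forall>i \<in> I. h \<cdot> \<sigma> i = f i)"
    and uq: "\<forall>y. \<forall>g \<in> Hom C Q y. \<forall>h \<in> Hom C Q y. (\<forall>i \<in> I. g \<cdot> \<sigma> i = h \<cdot> \<sigma> i) \<longrightarrow> g = h"
    using P.coproduct_exists by blast
  have s' [simp]: "\<sigma> i \<in> Arr C" "Dom C (\<sigma> i) = Dom C i" "Cod C (\<sigma> i) = Q" if "i \<in> I" for i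
    using s that by (auto simp: Hom_iff)
  have "pure_lifting Q" unfolding pure_lifting_def
  proof (intro conjI allI ballI impI Q)
    fix z w u h assume u: "u \<in> Hom C z w" and h: "h \<in> Hom C Q w"
      and l: "\<forall>c\<in>fp \<kappa> C. \<forall>l\<in>Hom C c Q. \<exists>l'\<in>Hom C c z. u \<cdot> l' = h \<cdot> l"
    have "\<forall>i \<in> I. \<exists>l'. l' \<in> Hom C (Dom C i) z \<and> u \<cdot> l' = h \<cdot> \<sigma> i" using l s P.X_fp by blast
    then obtain f where f: "\<forall>i \<in> I. f i \<in> Hom C (Dom C i) z \<and> u \<cdot> f i = h \<cdot> \<sigma> i" by metis
    obtain h' where h': "h' \<in> Hom C Q z" "\<forall>i \<in> I. h' \<cdot> \<sigma> i = f i"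
      using ex[rule_format, of z f] f Hom_Obj(1)[OF u] by blast
    have "\<forall>i \<in> I. u \<cdot> h' \<cdot> \<sigma> i = h \<cdot> \<sigma> i" using f h' u by (auto simp: Hom_iff)
    then have "u \<cdot> h' = h" using uq h Comp_in_Hom[OF u h'(1)] by blast
    then show "\<exists>h'\<in>Hom C Q z. u \<cdot> h' = h" using h' by blast
  qed
  moreover obtain e where e: "e \<in> Hom C Q x" "\<forall>i \<in> I. e \<cdot> \<sigma> i = i"
    using ex[rule_format, of x "\<lambda>i. i"] by (auto simp: Hom_iff)
  have [simp]: "e \<in> Arr C" "Dom C e = Q" "Cod C e = x" using e by (auto simp: Hom_iff)
  have "\<forall>i \<in> I. g \<cdot> e \<cdot> \<sigma> i = Zero C Q y \<cdot> \<sigma> i" using e(2) I(4) by simp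
  then have "g \<cdot> e = Zero C Q y" using uq[rule_format, of "g \<cdot> e" y "Zero C Q y"] Q by (simp add: Hom_iff)
  moreover have "\<exists>h' \<in> Hom C c Q. e \<cdot> h' = h" if c: "c \<in> fp \<kappa> C" and h: "h \<in> Hom C c x" "g \<cdot> h = Zero C c y" for c h
  proof -
    obtain c' w v where w: "c' \<in> S" "w \<in> Hom C c c'" "v \<in> Hom C c' c" "v \<cdot> w = Ident C c"
      using S(3) c unfolding isomorphic_def by blast
    have hv: "h \<cdot> v \<in> I" using w h Comp_eq_assoc[OF h(2), of v] unfolding I_def by (auto simp: Hom_iff)
    have dv: "Dom C (h \<cdot> v) = c'" using h w by (auto simp: Hom_iff)
    have "\<sigma> (h \<cdot> v) \<cdot> w \<in> Hom C c Q" using s'[OF hv] w dv by (auto simp: Hom_iff)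
    moreover have "e \<cdot> (\<sigma> (h \<cdot> v) \<cdot> w) = h \<cdot> v \<cdot> w"
      using Comp_eq_assoc[of e "\<sigma> (h \<cdot> v)" "h \<cdot> v" w] e(2) hv w dv s'[OF hv] by (auto simp: Hom_iff)
    moreover have "h \<cdot> v \<cdot> w = h" using h w by (auto simp: Hom_iff)
    ultimately show ?thesis by metis
  qed
  ultimately show ?thesis by (intro exI[of _ e]) (auto simp: fp_exact_def Hom_iff)
qed

text \<open>
  A pure projective object is a retract of its cover by a coproduct of finitely presented objects, as
  the cover is a pure epimorphism. The lifting property passes to retracts.
\<close>

lemma pure_projective_iff_lifting: "pure_projective \<kappa> C P \<longleftrightarrow> pure_lifting P"
proof
  assume P: "pure_lifting P"
  then have o: "P \<in> Obj C" by (simp add: pure_lifting_def)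
  have "\<exists>s \<in> Hom C P y. g \<cdot> s = Ident C P" if "pure_epi \<kappa> C y P g" for y g
  proof -
    have g: "g \<in> Hom C y P" and sur: "\<forall>c \<in> fp \<kappa> C. (\<lambda>h. g \<cdot> h) ` Hom C c y = Hom C c P"
      using that by (auto simp: pure_epi_def pure_exact_def)
    have "\<forall>c\<in>fp \<kappa> C. \<forall>l\<in>Hom C c P. \<exists>l'\<in>Hom C c y. g \<cdot> l' = Ident C P \<cdot> l"
    proof (intro ballI)
      fix c l assume c: "c \<in> fp \<kappa> C" and l: "l \<in> Hom C c P"
      then have "l \<in> (\<lambda>h. g \<cdot> h) ` Hom C c y" using sur by blast
      then show "\<exists>l'\<in>Hom C c y. g \<cdot> l' = Ident C P \<cdot> l" using Ident_Comp[OF l] by auto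
    qed
    then show ?thesis using P g Ident_in_Hom[OF o] unfolding pure_lifting_def by blast
  qed
  then show "pure_projective \<kappa> C P" using o by (simp add: pure_projective_def)
next
  assume P: "pure_projective \<kappa> C P"
  then have o: "P \<in> Obj C" by (simp add: pure_projective_def)
  have z: "Zero C P P \<in> Hom C P P" using o by (simp add: Hom_iff)
  obtain e where e: "e \<in> Hom C (Dom C e) P" "pure_lifting (Dom C e)" "fp_exact e (Zero C P P)"
    using pure_cover[OF z] by blast
  have "pure_epi \<kappa> C (Dom C e) P e"
    by (rule pure_epiI[OF e(1)]) (use e(3) o in \<open>auto simp: fp_exact_def Hom_iff\<close>)
  then obtain s where s: "s \<in> Hom C P (Dom C e)" "e \<cdot> s = Ident C P"
    using P unfolding pure_projective_def by blast
  have [simp]: "e \<in> Arr C" "Cod C e = P" using e by (auto simp: Hom_iff)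
  show "pure_lifting P" unfolding pure_lifting_def
  proof (intro conjI allI ballI impI o)
    fix y z u h assume u: "u \<in> Hom C y z" and h: "h \<in> Hom C P z"
      and l: "\<forall>c\<in>fp \<kappa> C. \<forall>l\<in>Hom C c P. \<exists>l'\<in>Hom C c y. u \<cdot> l' = h \<cdot> l"
    have he: "h \<cdot> e \<in> Hom C (Dom C e) z" using h by (simp add: Hom_iff)
    have "\<exists>l'\<in>Hom C c y. u \<cdot> l' = h \<cdot> e \<cdot> m" if "c \<in> fp \<kappa> C" "m \<in> Hom C c (Dom C e)" for c m
      using l[rule_format, of c "e \<cdot> m"] that h by (auto simp: Hom_iff)
    then obtain h' where h': "h' \<in> Hom C (Dom C e) y" "u \<cdot> h' = h \<cdot> e"
      using e(2) u he unfolding pure_lifting_def by blast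
    have "u \<cdot> (h' \<cdot> s) = h \<cdot> e \<cdot> s" using Comp_eq_assoc[OF h'(2), of s] h' s u by (auto simp: Hom_iff)
    also have "\<dots> = h" using s h by (auto simp: Hom_iff)
    finally show "\<exists>h'\<in>Hom C P y. u \<cdot> h' = h" using Comp_in_Hom[OF h'(1) s(1)] by blast
  qed
qed

section \<open>Resolutions\<close>

text \<open>
  Pure projective resolutions with the resolved object included as \<open>X 0\<close> and the augmentation as
  \<open>a 1\<close>. The complex ends with the zero endomorphism \<open>a 0\<close> of \<open>X 0\<close>; it fits the pattern
  \<open>a n : X n \<rightarrow> X (n - 1)\<close> because subtraction of natural numbers gives \<open>0 - 1 = 0\<close>. So surjectivity of the augmentation is exactness at \<open>X 0\<close>, and inductions need no
  separate treatment of the augmentation.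
\<close>

definition resolution :: "(nat \<Rightarrow> 'o) \<Rightarrow> (nat \<Rightarrow> 'm) \<Rightarrow> bool" where
  "resolution X a \<longleftrightarrow> (\<forall>n. a n \<in> Hom C (X n) (X (n - 1))) \<and> a 0 = Zero C (X 0) (X 0) \<and>
     (\<forall>n. fp_exact (a (Suc n)) (a n)) \<and> (\<forall>n. pure_lifting (X (Suc n)))"

lemma resolutionD:
  assumes "resolution X a"
  shows "a n \<in> Hom C (X n) (X (n - 1))" "a 0 = Zero C (X 0) (X 0)" "fp_exact (a (Suc n)) (a n)"
    "pure_lifting (X (Suc n))" "X n \<in> Obj C" "a n \<in> Arr C" "Dom C (a n) = X n" "Cod C (a n) = X (n - 1)"
    "a n \<cdot> a (Suc n) = Zero C (X (Suc n)) (X (n - 1))"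
proof -
  show a: "a n \<in> Hom C (X n) (X (n - 1))" "a 0 = Zero C (X 0) (X 0)" and e: "fp_exact (a (Suc n)) (a n)"
    "pure_lifting (X (Suc n))" using assms by (auto simp: resolution_def)
  then show "X n \<in> Obj C" "a n \<in> Arr C" and d: "Dom C (a n) = X n" and c: "Cod C (a n) = X (n - 1)"
    using Hom_Obj(1)[OF a(1)] by (auto simp: Hom_iff)
  have "Dom C (a (Suc n)) = X (Suc n)" using assms by (auto simp: resolution_def Hom_iff)
  then show "a n \<cdot> a (Suc n) = Zero C (X (Suc n)) (X (n - 1))" using e d c by (simp add: fp_exact_def)
qed

lemma resolution_flat_kernel:
  assumes "resolution X a" shows "flat_kernel (a n)"
proof (induction n)
  case 0
  show ?case using resolutionD(2,5)[OF assms] flat_kernel_Zero by metis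
next
  case (Suc n)
  show ?case using flat_kernel_exact[OF resolutionD(3)[OF assms] Suc] .
qed

lemma pure_projective_resolution_imp:
  assumes R: "pure_projective_resolution \<kappa> C x P d e"
  shows "resolution (case_nat x P) (case_nat (Zero C x x) (case_nat e d))"
proof -
  have P: "\<And>n. pure_lifting (P n)" and d: "\<And>n. d n \<in> Hom C (P (Suc n)) (P n)" and e: "e \<in> Hom C (P 0) x"
    and sur: "\<And>c. c \<in> fp \<kappa> C \<Longrightarrow> (\<lambda>h. e \<cdot> h) ` Hom C c (P 0) = Hom C c x"
    and ex0: "\<And>c. c \<in> fp \<kappa> C \<Longrightarrow> exact_at C c (P (Suc 0)) (P 0) x (d 0) e"
    and ex: "\<And>c n. c \<in> fp \<kappa> C \<Longrightarrow> exact_at C c (P (Suc (Suc n))) (P (Suc n)) (P n) (d (Suc n)) (d n)"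
    using R by (auto simp: pure_projective_resolution_def pure_projective_iff_lifting)
  have x: "x \<in> Obj C" using Hom_Obj[OF e] by blast
  have exact: "fp_exact f g" if f: "f \<in> Hom C u v" and g: "g \<in> Hom C v w"
    and E: "\<And>c. c \<in> fp \<kappa> C \<Longrightarrow> exact_at C c u v w f g" for f g u v w
  proof -
    have o: "u \<in> Obj C" "w \<in> Obj C" using Hom_Obj[OF f] Hom_Obj[OF g] by auto
    note E = E[unfolded exact_at_iff[OF f g]]
    have "g \<cdot> f = Zero C u w"
    proof (rule fp_separate)
      show "g \<cdot> f \<in> Hom C u w" using Comp_in_Hom[OF g f] .
      show "Zero C u w \<in> Hom C u w" using o by (simp add: Hom_iff)
      fix c l assume "c \<in> fp \<kappa> C" "l \<in> Hom C c u"
      then show "g \<cdot> f \<cdot> l = Zero C u w \<cdot> l" using E[of c] f g o by (auto simp: Hom_iff)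
    qed
    then show ?thesis using E f g by (auto simp: fp_exact_def Hom_iff)
  qed
  have "fp_exact e (Zero C x x)"
    unfolding fp_exact_def
  proof (intro conjI ballI impI)
    fix c h assume c: "c \<in> fp \<kappa> C" and "h \<in> Hom C c (Dom C (Zero C x x))"
    then have "h \<in> (\<lambda>h. e \<cdot> h) ` Hom C c (P 0)" using sur[OF c] x by simp
    then show "\<exists>h'\<in>Hom C c (Dom C e). e \<cdot> h' = h" using e by (auto simp: Hom_iff)
  qed (use e x in \<open>auto simp: Hom_iff\<close>)
  moreover have "fp_exact (d 0) e" using exact[OF d e ex0] .
  moreover have "fp_exact (d (Suc n)) (d n)" for n using exact[OF d d ex] .
  ultimately have "fp_exact (case_nat (Zero C x x) (case_nat e d) (Suc n)) (case_nat (Zero C x x) (case_nat e d) n)" for n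
    by (simp split: nat.split)
  moreover have "case_nat (Zero C x x) (case_nat e d) n \<in> Hom C (case_nat x P n) (case_nat x P (n - 1))" for n
    using d e x by (simp add: Hom_iff split: nat.split)
  ultimately show ?thesis using P by (simp add: resolution_def)
qed

lemma resolution_imp_pure_projective:
  assumes R: "resolution X a"
  shows "pure_projective_resolution \<kappa> C (X 0) (\<lambda>n. X (Suc n)) (\<lambda>n. a (Suc (Suc n))) (a (Suc 0))"
proof -
  note R' = resolutionD[OF R]
  have ex: "exact_at C c (X (Suc (Suc n))) (X (Suc n)) (X n) (a (Suc (Suc n))) (a (Suc n))" if "c \<in> fp \<kappa> C" for c n
  proof -
    have a: "a (Suc (Suc n)) \<in> Hom C (X (Suc (Suc n))) (X (Suc n))" "a (Suc n) \<in> Hom C (X (Suc n)) (X n)"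
      using R'(1)[of "Suc (Suc n)"] R'(1)[of "Suc n"] by simp_all
    have "\<forall>h\<in>Hom C c (X (Suc (Suc n))). a (Suc n) \<cdot> (a (Suc (Suc n)) \<cdot> h) = Zero C c (X n)"
      using Comp_eq_assoc[OF R'(9)[of "Suc n"]] R'(5-8) by (auto simp: Hom_iff)
    then show ?thesis unfolding exact_at_iff[OF a] using that R'(3)[of "Suc n"] R'(7,8) by (auto simp: fp_exact_def)
  qed
  have "(\<lambda>h. a (Suc 0) \<cdot> h) ` Hom C c (X (Suc 0)) = Hom C c (X 0)" if c: "c \<in> fp \<kappa> C" for c
  proof (intro equalityI subsetI)
    fix h assume "h \<in> (\<lambda>h. a (Suc 0) \<cdot> h) ` Hom C c (X (Suc 0))"
    then show "h \<in> Hom C c (X 0)" using R'(6-8) by (auto simp: Hom_iff)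
  next
    fix h assume h: "h \<in> Hom C c (X 0)"
    then have "a 0 \<cdot> h = Zero C c (X 0)" using R'(2,5) by (auto simp: Hom_iff)
    then have "\<exists>h'\<in>Hom C c (X (Suc 0)). a (Suc 0) \<cdot> h' = h"
      using R'(3)[of 0] R'(7,8) h c by (auto simp: fp_exact_def)
    then show "h \<in> (\<lambda>h. a (Suc 0) \<cdot> h) ` Hom C c (X (Suc 0))" by blast
  qed
  moreover have "a (Suc 0) \<in> Hom C (X (Suc 0)) (X 0)" using R'(1)[of "Suc 0"] by simp
  moreover have "a (Suc (Suc n)) \<in> Hom C (X (Suc (Suc n))) (X (Suc n))" for n using R'(1)[of "Suc (Suc n)"] by simp
  ultimately show ?thesis
    using ex R'(4) by (simp add: pure_projective_resolution_def pure_projective_iff_lifting)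
qed

text \<open>
  Each differential covers the kernel of the preceding one. The construction chooses the arrows only;
  the objects are their domains.
\<close>

lemma resolution_exists:
  assumes x: "x \<in> Obj C"
  shows "\<exists>X a. resolution X a \<and> X 0 = x"
proof -
  let ?P = "\<lambda>n f. f \<in> Arr C \<and> (n = 0 \<longrightarrow> f = Zero C x x)"
  let ?Q = "\<lambda>(n :: nat) f f'. Cod C f' = Dom C f \<and> pure_lifting (Dom C f') \<and> fp_exact f' f"
  have "\<exists>f. ?P 0 f" using x by auto
  moreover have "\<exists>f'. ?P (Suc n) f' \<and> ?Q n f f'" if "?P n f" for n f
    using pure_cover[of f "Dom C f" "Cod C f"] that by (auto simp: Hom_iff)
  ultimately obtain a where a: "\<And>n. ?P n (a n)" "\<And>n. ?Q n (a n) (a (Suc n))"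
    using dependent_nat_choice[of ?P ?Q] by blast
  have "a n \<in> Hom C (Dom C (a n)) (Dom C (a (n - 1)))" for n
    by (cases n) (use a x in \<open>auto simp: Hom_iff\<close>)
  then have "resolution (\<lambda>n. Dom C (a n)) a"
    using a x by (auto simp: resolution_def)
  moreover have "Dom C (a 0) = x" using a(1)[of 0] x by simp
  ultimately show ?thesis by blast
qed

text \<open>
  Restricted to finitely presented objects, the cycle \<open>h\<close> lifts by exactness; hence it lifts.
\<close>

lemma resolution_lift:
  assumes R: "resolution Y b" and P: "pure_lifting P" and h: "h \<in> Hom C P (Y n)"
    and z: "b n \<cdot> h = Zero C P (Y (n - 1))"
  shows "\<exists>h' \<in> Hom C P (Y (Suc n)). b (Suc n) \<cdot> h' = h"
proof -
  note R' = resolutionD[OF R]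
  have u: "b (Suc n) \<in> Hom C (Y (Suc n)) (Y n)" using R'(1)[of "Suc n"] by simp
  have "\<exists>l'\<in>Hom C c (Y (Suc n)). b (Suc n) \<cdot> l' = h \<cdot> l" if c: "c \<in> fp \<kappa> C" and l: "l \<in> Hom C c P" for c l
  proof -
    have "b n \<cdot> (h \<cdot> l) = Zero C c (Y (n - 1))" "h \<cdot> l \<in> Hom C c (Y n)"
      using Comp_eq_assoc[OF z, of l] h l R'(5-8) by (auto simp: Hom_iff)
    then show ?thesis using R'(3)[of n] R'(7,8) c by (auto simp: fp_exact_def)
  qed
  then show ?thesis using P u h unfolding pure_lifting_def by blast
qed

definition chain_map :: "(nat \<Rightarrow> 'o) \<Rightarrow> (nat \<Rightarrow> 'm) \<Rightarrow> (nat \<Rightarrow> 'o) \<Rightarrow> (nat \<Rightarrow> 'm) \<Rightarrow> (nat \<Rightarrow> 'm) \<Rightarrow> bool" where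
  "chain_map X a Y b \<phi> \<longleftrightarrow> \<phi> 0 = Ident C (X 0) \<and> (\<forall>n. \<phi> n \<in> Hom C (X n) (Y n)) \<and>
     (\<forall>n. b (Suc n) \<cdot> \<phi> (Suc n) = \<phi> n \<cdot> a (Suc n))"

lemma comparison:
  assumes X: "resolution X a" and Y: "resolution Y b" and eq: "X 0 = Y 0"
  shows "\<exists>\<phi>. chain_map X a Y b \<phi>"
proof -
  note X' = resolutionD[OF X] and Y' = resolutionD[OF Y]
  have a [simp]: "a n \<in> Arr C" "Dom C (a n) = X n" "Cod C (a n) = X (n - 1)" "X n \<in> Obj C"
    "b n \<in> Arr C" "Dom C (b n) = Y n" "Cod C (b n) = Y (n - 1)" "Y n \<in> Obj C" for n
    using X' Y' by auto
  \<comment> \<open>The invariant says that the next lifting problem is posed by a cycle.\<close>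
  let ?P = "\<lambda>n f. f \<in> Hom C (X n) (Y n) \<and> (n = 0 \<longrightarrow> f = Ident C (X 0)) \<and>
     b n \<cdot> (f \<cdot> a (Suc n)) = Zero C (X (Suc n)) (Y (n - 1))"
  let ?Q = "\<lambda>n f f'. b (Suc n) \<cdot> f' = f \<cdot> a (Suc n)"
  have "?P 0 (Ident C (X 0))" using eq Y'(2) by (auto simp: Hom_iff)
  then have "\<exists>f. ?P 0 f" by blast
  moreover have "\<exists>f'. ?P (Suc n) f' \<and> ?Q n f f'" if f: "?P n f" for n f
  proof -
    have "f \<cdot> a (Suc n) \<in> Hom C (X (Suc n)) (Y n)" using f by (auto simp: Hom_iff)
    then obtain f' where f': "f' \<in> Hom C (X (Suc n)) (Y (Suc n))" "b (Suc n) \<cdot> f' = f \<cdot> a (Suc n)"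
      using resolution_lift[OF Y X'(4)] f by blast
    have "b (Suc n) \<cdot> (f' \<cdot> a (Suc (Suc n))) = f \<cdot> (a (Suc n) \<cdot> a (Suc (Suc n)))"
      using Comp_eq_assoc[OF f'(2), of "a (Suc (Suc n))"] f f'(1) by (auto simp: Hom_iff)
    also have "\<dots> = Zero C (X (Suc (Suc n))) (Y n)" using X'(9)[of "Suc n"] f by (auto simp: Hom_iff)
    finally show ?thesis using f' by auto
  qed
  ultimately obtain \<phi> where "\<And>n. ?P n (\<phi> n)" "\<And>n. ?Q n (\<phi> n) (\<phi> (Suc n))"
    using dependent_nat_choice[of ?P ?Q] by blast
  then have "chain_map X a Y b \<phi>" by (simp add: chain_map_def)
  then show ?thesis by blast
qed

text \<open>
  In each degree, what the homotopy found so far leaves of \<open>id - \<gamma>\<close> is a cycle, and it is lifted along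
  the next differential. The homotopy starts with zero on \<open>X 0\<close>, so in the lowest degree
  the complex without \<open>X 0\<close> sees no contribution from it.
\<close>

lemma homotopic_Ident:
  assumes X: "resolution X a" and g: "chain_map X a X a \<gamma>"
  shows "\<exists>s. s 0 = Zero C (X 0) (X (Suc 0)) \<and> (\<forall>n. s n \<in> Hom C (X n) (X (Suc n))) \<and>
    (\<forall>n. Ident C (X (Suc n)) = \<gamma> (Suc n) \<oplus> (a (Suc (Suc n)) \<cdot> s (Suc n) \<oplus> s n \<cdot> a (Suc n)))"
proof -
  note X' = resolutionD[OF X]
  have a [simp]: "a n \<in> Arr C" "Dom C (a n) = X n" "Cod C (a n) = X (n - 1)" "X n \<in> Obj C"
    "\<gamma> n \<in> Arr C" "Dom C (\<gamma> n) = X n" "Cod C (\<gamma> n) = X n" for n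
    using X' g by (auto simp: chain_map_def Hom_iff)
  have g0: "\<gamma> 0 = Ident C (X 0)" and gc: "\<And>n. a (Suc n) \<cdot> \<gamma> (Suc n) = \<gamma> n \<cdot> a (Suc n)"
    using g by (auto simp: chain_map_def)
  let ?D = "\<lambda>n. Ident C (X n) \<ominus> \<gamma> n"
  let ?P = "\<lambda>n s. s \<in> Hom C (X n) (X (Suc n)) \<and> (n = 0 \<longrightarrow> s = Zero C (X 0) (X (Suc 0))) \<and>
     (?D n \<ominus> a (Suc n) \<cdot> s) \<cdot> a (Suc n) = Zero C (X (Suc n)) (X n)"
  let ?Q = "\<lambda>n s s'. a (Suc (Suc n)) \<cdot> s' = ?D (Suc n) \<ominus> s \<cdot> a (Suc n)"
  have "?P 0 (Zero C (X 0) (X (Suc 0)))" using g0 by (auto simp: Hom_iff)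
  then have "\<exists>s. ?P 0 s" by blast
  moreover have "\<exists>s'. ?P (Suc n) s' \<and> ?Q n s s'" if s: "?P n s" for n s
  proof -
    have [simp]: "s \<in> Arr C" "Dom C s = X n" "Cod C s = X (Suc n)"
      using s[THEN conjunct1] by (auto simp: Hom_iff)
    let ?q = "?D (Suc n) \<ominus> s \<cdot> a (Suc n)"
    have q: "?q \<in> Hom C (X (Suc n)) (X (Suc n))" by (simp add: Hom_iff)
    have "a (Suc n) \<cdot> ?q = (?D n \<ominus> a (Suc n) \<cdot> s) \<cdot> a (Suc n)" by (simp add: gc)
    also have "\<dots> = Zero C (X (Suc n)) (X (Suc n - 1))" using s[THEN conjunct2, THEN conjunct2] by simp
    finally have "a (Suc n) \<cdot> ?q = Zero C (X (Suc n)) (X (Suc n - 1))" .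
    then obtain s' where s': "s' \<in> Hom C (X (Suc n)) (X (Suc (Suc n)))" "a (Suc (Suc n)) \<cdot> s' = ?q"
      using resolution_lift[OF X X'(4) q] by blast
    \<comment> \<open>By the choice of \<open>s'\<close> the remaining difference is \<open>s a\<close>, which the differential kills.\<close>
    have "(?D (Suc n) \<ominus> a (Suc (Suc n)) \<cdot> s') \<cdot> a (Suc (Suc n)) = s \<cdot> a (Suc n) \<cdot> a (Suc (Suc n))"
      unfolding s'(2) by (subst Sub_Sub_self) simp_all
    also have "\<dots> = Zero C (X (Suc (Suc n))) (X (Suc n))" using X'(9)[of "Suc n"] by simp
    finally have "?P (Suc n) s'" using s'(1) by blast
    then show ?thesis using s'(2) by blast
  qed
  ultimately obtain s where s: "\<And>n. ?P n (s n)" "\<And>n. ?Q n (s n) (s (Suc n))"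
    using dependent_nat_choice[of ?P ?Q] by blast
  have [simp]: "s n \<in> Arr C" "Dom C (s n) = X n" "Cod C (s n) = X (Suc n)" for n
    using s(1)[of n, THEN conjunct1] by (auto simp: Hom_iff)
  have "Ident C (X (Suc n)) = \<gamma> (Suc n) \<oplus> (a (Suc (Suc n)) \<cdot> s (Suc n) \<oplus> s n \<cdot> a (Suc n))" for n
  proof -
    have "a (Suc (Suc n)) \<cdot> s (Suc n) \<oplus> s n \<cdot> a (Suc n) = ?D (Suc n)" unfolding s(2) by simp
    moreover have "\<gamma> (Suc n) \<oplus> ?D (Suc n) = ?D (Suc n) \<oplus> \<gamma> (Suc n)" by (rule Add_commute) simp_all
    ultimately show ?thesis by simp
  qed
  then show ?thesis using s(1) by blast
qed

end

section \<open>Cohomology\<close>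

abbreviation cocycles :: "(nat \<Rightarrow> 'a monoid) \<Rightarrow> (nat \<Rightarrow> 'a \<Rightarrow> 'a) \<Rightarrow> nat \<Rightarrow> 'a set" where
  "cocycles G \<delta> n \<equiv> kernel (G n) (G (Suc n)) (\<delta> n)"

definition coboundaries :: "(nat \<Rightarrow> 'a monoid) \<Rightarrow> (nat \<Rightarrow> 'a \<Rightarrow> 'a) \<Rightarrow> nat \<Rightarrow> 'a set" where
  "coboundaries G \<delta> n = (case n of 0 \<Rightarrow> {\<one>\<^bsub>G 0\<^esub>} | Suc m \<Rightarrow> \<delta> m ` carrier (G m))"

text \<open>
  The map \<open>z \<mapsto> M + \<phi> z\<close> is onto the quotient and has kernel \<open>N\<close>.
\<close>

lemma quotient_iso:
  assumes Z: "comm_group Z" and Z': "comm_group Z'" and N: "subgroup N Z" and M: "subgroup M Z'"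
    and \<phi>: "\<phi> \<in> hom Z Z'" and NM: "\<And>z. z \<in> carrier Z \<Longrightarrow> \<phi> z \<in> M \<longleftrightarrow> z \<in> N"
    and sur: "\<And>z'. z' \<in> carrier Z' \<Longrightarrow> \<exists>z \<in> carrier Z. \<exists>m \<in> M. z' = m \<otimes>\<^bsub>Z'\<^esub> \<phi> z"
  shows "Z' Mod M \<cong> Z Mod N"
proof -
  interpret Z: comm_group Z by fact
  interpret Z': comm_group Z' by fact
  interpret M: normal M Z' using Z'.subgroup_imp_normal[OF M] .
  let ?h = "\<lambda>z. M #>\<^bsub>Z'\<^esub> \<phi> z"
  have "(\<lambda>a. M #>\<^bsub>Z'\<^esub> a) \<circ> \<phi> \<in> hom Z (Z' Mod M)"
    using hom_compose[OF \<phi> M.r_coset_hom_Mod] .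
  then have h: "?h \<in> hom Z (Z' Mod M)" by (simp add: comp_def)
  interpret h: group_hom Z "Z' Mod M" ?h
    by (rule group_hom.intro[OF Z.is_group M.factorgroup_is_group group_hom_axioms.intro[OF h]])
  have \<phi>c: "\<phi> z \<in> carrier Z'" if "z \<in> carrier Z" for z using \<phi> that by (auto simp: hom_def)
  have "?h ` carrier Z = carrier (Z' Mod M)"
  proof (intro equalityI subsetI)
    fix c assume "c \<in> ?h ` carrier Z"
    then show "c \<in> carrier (Z' Mod M)" using h.hom_closed by auto
  next
    fix c assume "c \<in> carrier (Z' Mod M)"
    then obtain z' where z': "z' \<in> carrier Z'" "c = M #>\<^bsub>Z'\<^esub> z'" by (auto simp: FactGroup_def RCOSETS_def)
    obtain z m where zm: "z \<in> carrier Z" "m \<in> M" "z' = m \<otimes>\<^bsub>Z'\<^esub> \<phi> z" using sur[OF z'(1)] by blast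
    have "m \<otimes>\<^bsub>Z'\<^esub> \<phi> z \<in> M #>\<^bsub>Z'\<^esub> \<phi> z" using zm(2) by (auto simp: r_coset_def)
    then have "M #>\<^bsub>Z'\<^esub> \<phi> z = M #>\<^bsub>Z'\<^esub> z'"
      using Z'.repr_independence[OF _ \<phi>c[OF zm(1)] M] zm(3) by blast
    then show "c \<in> ?h ` carrier Z" using z' zm by blast
  qed
  moreover have "kernel Z (Z' Mod M) ?h = N"
  proof -
    have "?h z = M \<longleftrightarrow> z \<in> N" if "z \<in> carrier Z" for z
      using NM[OF that] Z'.coset_join1[of M "\<phi> z"] Z'.coset_join2[of "\<phi> z" M] M \<phi>c[OF that] M.subset by blast
    then show ?thesis using subgroup.subset[OF N] by (auto simp: kernel_def FactGroup_def)
  qed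
  ultimately have "Z Mod N \<cong> Z' Mod M" using h.FactGroup_iso by simp
  then show ?thesis by (rule group.iso_sym[OF normal.factorgroup_is_group[OF Z.subgroup_imp_normal[OF N]]])
qed

definition cochain_complex :: "(nat \<Rightarrow> 'a monoid) \<Rightarrow> (nat \<Rightarrow> 'a \<Rightarrow> 'a) \<Rightarrow> bool" where
  "cochain_complex G \<delta> \<longleftrightarrow> (\<forall>n. comm_group (G n)) \<and> (\<forall>n. \<delta> n \<in> hom (G n) (G (Suc n))) \<and>
     (\<forall>n. \<forall>f \<in> carrier (G n). \<delta> (Suc n) (\<delta> n f) = \<one>\<^bsub>G (Suc (Suc n))\<^esub>)"

lemma cochain_complex_groups:
  assumes "cochain_complex G \<delta>"
  shows "comm_group ((G n)\<lparr>carrier := cocycles G \<delta> n\<rparr>)"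
    and "subgroup (coboundaries G \<delta> n) ((G n)\<lparr>carrier := cocycles G \<delta> n\<rparr>)"
proof -
  have G: "comm_group (G k)" and d: "\<delta> k \<in> hom (G k) (G (Suc k))"
    and dd: "f \<in> carrier (G k) \<Longrightarrow> \<delta> (Suc k) (\<delta> k f) = \<one>\<^bsub>G (Suc (Suc k))\<^esub>" for k f
    using assms by (simp_all add: cochain_complex_def)
  interpret G: comm_group "G k" for k by (rule G)
  interpret d: group_hom "G k" "G (Suc k)" "\<delta> k" for k by unfold_locales (rule d)
  have K: "subgroup (cocycles G \<delta> n) (G n)" by (rule d.subgroup_kernel)
  show "comm_group ((G n)\<lparr>carrier := cocycles G \<delta> n\<rparr>)"
    by (rule group.group_comm_groupI[OF subgroup.subgroup_is_group[OF K G.is_group]])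
      (auto simp: kernel_def intro: G.m_comm)
  have "subgroup (coboundaries G \<delta> n) (G n)"
  proof (cases n)
    case 0
    show ?thesis unfolding coboundaries_def 0 using G.triv_subgroup[of 0] by simp
  next
    case (Suc m)
    show ?thesis unfolding coboundaries_def Suc using d.img_is_subgroup[of m] by simp
  qed
  moreover have "coboundaries G \<delta> n \<subseteq> cocycles G \<delta> n"
    using dd by (cases n) (auto simp: coboundaries_def kernel_def)
  ultimately show "subgroup (coboundaries G \<delta> n) ((G n)\<lparr>carrier := cocycles G \<delta> n\<rparr>)"
    using G.subgroup_incl K by blast
qed

text \<open>
  The hypotheses on \<open>\<phi>\<close> say that it is injective and surjective on cohomology in degree \<open>n\<close>. They
  are about elements only, so an inverse up to homotopy can be used without its additivity.
\<close>

lemma cohomology_iso: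
  assumes G: "cochain_complex G \<delta>" and G': "cochain_complex G' \<delta>'"
    and \<phi>: "\<And>n. \<phi> n \<in> hom (G n) (G' n)"
    and comm: "\<And>n f. f \<in> carrier (G n) \<Longrightarrow> \<phi> (Suc n) (\<delta> n f) = \<delta>' n (\<phi> n f)"
    and inj: "\<And>f. \<lbrakk>f \<in> cocycles G \<delta> n; \<phi> n f \<in> coboundaries G' \<delta>' n\<rbrakk> \<Longrightarrow> f \<in> coboundaries G \<delta> n"
    and sur: "\<And>f'. f' \<in> cocycles G' \<delta>' n \<Longrightarrow>
      \<exists>f \<in> cocycles G \<delta> n. \<exists>b \<in> coboundaries G' \<delta>' n. f' = b \<otimes>\<^bsub>G' n\<^esub> \<phi> n f"
  shows "cohomology G' \<delta>' n \<cong> cohomology G \<delta> n"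
proof -
  interpret G: comm_group "G k" for k using G by (simp add: cochain_complex_def)
  interpret G': comm_group "G' k" for k using G' by (simp add: cochain_complex_def)
  interpret f: group_hom "G k" "G' k" "\<phi> k" for k by unfold_locales (rule \<phi>)
  have \<phi>Z: "\<phi> n f \<in> cocycles G' \<delta>' n" if "f \<in> cocycles G \<delta> n" for f
    using that comm[of f n] by (auto simp: kernel_def)
  have \<phi>B: "\<phi> n f \<in> coboundaries G' \<delta>' n" if "f \<in> coboundaries G \<delta> n" for f
    using that comm by (cases n) (auto simp: coboundaries_def)
  have "(G' n)\<lparr>carrier := cocycles G' \<delta>' n\<rparr> Mod coboundaries G' \<delta>' n \<cong>
        (G n)\<lparr>carrier := cocycles G \<delta> n\<rparr> Mod coboundaries G \<delta> n"
  proof (rule quotient_iso[OF cochain_complex_groups(1)[OF G] cochain_complex_groups(1)[OF G']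
        cochain_complex_groups(2)[OF G] cochain_complex_groups(2)[OF G']])
    show "\<phi> n \<in> hom ((G n)\<lparr>carrier := cocycles G \<delta> n\<rparr>) ((G' n)\<lparr>carrier := cocycles G' \<delta>' n\<rparr>)"
      using \<phi>Z f.hom_mult by (auto simp: hom_def kernel_def)
    show "\<phi> n z \<in> coboundaries G' \<delta>' n \<longleftrightarrow> z \<in> coboundaries G \<delta> n"
      if "z \<in> carrier ((G n)\<lparr>carrier := cocycles G \<delta> n\<rparr>)" for z
    proof
      have "z \<in> cocycles G \<delta> n" using that by simp
      then show "z \<in> coboundaries G \<delta> n" if "\<phi> n z \<in> coboundaries G' \<delta>' n"
        using inj that by blast
      show "\<phi> n z \<in> coboundaries G' \<delta>' n" if "z \<in> coboundaries G \<delta> n" using \<phi>B that by blast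
    qed
    show "\<exists>z\<in>carrier ((G n)\<lparr>carrier := cocycles G \<delta> n\<rparr>). \<exists>m\<in>coboundaries G' \<delta>' n.
        z' = m \<otimes>\<^bsub>(G' n)\<lparr>carrier := cocycles G' \<delta>' n\<rparr>\<^esub> \<phi> n z"
      if "z' \<in> carrier ((G' n)\<lparr>carrier := cocycles G' \<delta>' n\<rparr>)" for z'
      using sur that by simp
  qed
  then show ?thesis by (simp add: cohomology_def coboundaries_def)
qed

section \<open>Independence of the resolution\<close>

context small_accessible
begin

abbreviation hom_cohomology :: "(nat \<Rightarrow> 'o) \<Rightarrow> (nat \<Rightarrow> 'm) \<Rightarrow> 'o \<Rightarrow> nat \<Rightarrow> 'm set monoid" where
  "hom_cohomology X a y n \<equiv> cohomology (\<lambda>k. hom_group C (X (Suc k)) y) (\<lambda>k f. f \<cdot> a (Suc (Suc k))) n"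

lemma hom_complex:
  assumes X: "resolution X a" and y: "y \<in> Obj C"
  shows "cochain_complex (\<lambda>k. hom_group C (X (Suc k)) y) (\<lambda>k f. f \<cdot> a (Suc (Suc k)))"
  unfolding cochain_complex_def
proof (intro conjI allI ballI)
  note X' = resolutionD[OF X]
  fix k
  show "comm_group (hom_group C (X (Suc k)) y)" using comm_group_hom_group X'(5) y by blast
  show "(\<lambda>f. f \<cdot> a (Suc (Suc k))) \<in> hom (hom_group C (X (Suc k)) y) (hom_group C (X (Suc (Suc k))) y)"
    using X'(6-8) by (auto simp: hom_def Hom_iff)
  show "f \<cdot> a (Suc (Suc k)) \<cdot> a (Suc (Suc (Suc k))) = \<one>\<^bsub>hom_group C (X (Suc (Suc (Suc k)))) y\<^esub>"
    if "f \<in> carrier (hom_group C (X (Suc k)) y)" for f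
    using that X'(5-8) X'(9)[of "Suc (Suc k)"] by (auto simp: Hom_iff)
qed

text \<open>
  Comparison maps \<open>\<alpha> : Y \<rightarrow> X\<close> and \<open>\<beta> : X \<rightarrow> Y\<close> over the identity of \<open>X 0\<close> are inverse to each
  other up to homotopies \<open>s\<close> and \<open>t\<close>. On a cocycle \<open>f\<close> the term of the homotopy that begins
  with a differential vanishes, and the other one is a coboundary; in degree zero it vanishes as
  well, because \<open>s 0\<close> and \<open>t 0\<close> are zero.
\<close>

lemma resolution_independence:
  assumes X: "resolution X a" and Y: "resolution Y b" and eq: "X 0 = Y 0" and y: "y \<in> Obj C"
  shows "hom_cohomology Y b y n \<cong> hom_cohomology X a y n"
proof -
  note X' = resolutionD[OF X] and Y' = resolutionD[OF Y]
  obtain \<beta> where \<beta>: "chain_map X a Y b \<beta>" using comparison[OF X Y eq] by blast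
  obtain \<alpha> where \<alpha>: "chain_map Y b X a \<alpha>" using comparison[OF Y X eq[symmetric]] by blast
  have s [simp]: "a n \<in> Arr C" "Dom C (a n) = X n" "Cod C (a n) = X (n - 1)" "X n \<in> Obj C"
    "b n \<in> Arr C" "Dom C (b n) = Y n" "Cod C (b n) = Y (n - 1)" "Y n \<in> Obj C"
    "\<alpha> n \<in> Arr C" "Dom C (\<alpha> n) = Y n" "Cod C (\<alpha> n) = X n" "\<beta> n \<in> Arr C" "Dom C (\<beta> n) = X n" "Cod C (\<beta> n) = Y n" for n
    using X' Y' \<alpha> \<beta> by (auto simp: chain_map_def Hom_iff)
  have \<alpha>c: "a (Suc n) \<cdot> \<alpha> (Suc n) = \<alpha> n \<cdot> b (Suc n)" and \<beta>c: "b (Suc n) \<cdot> \<beta> (Suc n) = \<beta> n \<cdot> a (Suc n)" for n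
    using \<alpha> \<beta> by (auto simp: chain_map_def)
  have "chain_map X a X a (\<lambda>n. \<alpha> n \<cdot> \<beta> n)"
    using \<alpha> \<beta> eq Comp_eq_assoc[OF \<alpha>c] Comp_eq_assoc[OF \<beta>c] by (auto simp: chain_map_def Hom_iff)
  from homotopic_Ident[OF X this] obtain s where s0: "s 0 = Zero C (X 0) (X (Suc 0))"
    and sH: "\<And>n. s n \<in> Hom C (X n) (X (Suc n))"
    and sX: "\<And>n. Ident C (X (Suc n)) = \<alpha> (Suc n) \<cdot> \<beta> (Suc n) \<oplus> (a (Suc (Suc n)) \<cdot> s (Suc n) \<oplus> s n \<cdot> a (Suc n))"
    by blast
  have "chain_map Y b Y b (\<lambda>n. \<beta> n \<cdot> \<alpha> n)"
    using \<alpha> \<beta> eq Comp_eq_assoc[OF \<alpha>c] Comp_eq_assoc[OF \<beta>c] by (auto simp: chain_map_def Hom_iff)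
  from homotopic_Ident[OF Y this] obtain t where t0: "t 0 = Zero C (Y 0) (Y (Suc 0))"
    and tH: "\<And>n. t n \<in> Hom C (Y n) (Y (Suc n))"
    and tY: "\<And>n. Ident C (Y (Suc n)) = \<beta> (Suc n) \<cdot> \<alpha> (Suc n) \<oplus> (b (Suc (Suc n)) \<cdot> t (Suc n) \<oplus> t n \<cdot> b (Suc n))"
    by blast
  have st [simp]: "s n \<in> Arr C" "Dom C (s n) = X n" "Cod C (s n) = X (Suc n)"
    "t n \<in> Arr C" "Dom C (t n) = Y n" "Cod C (t n) = Y (Suc n)" for n
    using sH[of n] tH[of n] by (auto simp: Hom_iff)
  have split: "f = f \<cdot> u \<oplus> f \<cdot> w" if "f \<in> Arr C" "Dom C f = x" "Ident C x = u \<oplus> (v \<oplus> w)" "f \<cdot> v = Zero C x y" "Cod C f = y"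
    "u \<in> Hom C x x" "v \<in> Hom C x x" "w \<in> Hom C x x" for f u v w x
  proof -
    have "f = f \<cdot> (u \<oplus> (v \<oplus> w))" using that(1-3) by (metis Comp_units(2))
    also have "\<dots> = f \<cdot> u \<oplus> (f \<cdot> v \<oplus> f \<cdot> w)" using that by (auto simp: Hom_iff)
    finally show ?thesis using that by (auto simp: Hom_iff)
  qed
  let ?G = "\<lambda>k. hom_group C (X (Suc k)) y" and ?d = "\<lambda>k f. f \<cdot> a (Suc (Suc k))"
  let ?G' = "\<lambda>k. hom_group C (Y (Suc k)) y" and ?d' = "\<lambda>k f. f \<cdot> b (Suc (Suc k))"
  show ?thesis
  proof (rule cohomology_iso[where \<phi> = "\<lambda>k f. f \<cdot> \<alpha> (Suc k)", OF hom_complex[OF X y] hom_complex[OF Y y]])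
    show "(\<lambda>f. f \<cdot> \<alpha> (Suc k)) \<in> hom (?G k) (?G' k)" for k
      by (auto simp: hom_def Hom_iff)
    show "f \<cdot> a (Suc (Suc k)) \<cdot> \<alpha> (Suc (Suc k)) = f \<cdot> \<alpha> (Suc k) \<cdot> b (Suc (Suc k))" if "f \<in> carrier (?G k)" for f k
      using that by (auto simp: Hom_iff \<alpha>c)
  next
    fix f assume f: "f \<in> cocycles ?G ?d n" and fb: "f \<cdot> \<alpha> (Suc n) \<in> coboundaries ?G' ?d' n"
    have [simp]: "f \<in> Arr C" "Dom C f = X (Suc n)" "Cod C f = y" and fa: "f \<cdot> a (Suc (Suc n)) = Zero C (X (Suc (Suc n))) y"
      using f by (auto simp: kernel_def Hom_iff)
    have f_split: "f = f \<cdot> (\<alpha> (Suc n) \<cdot> \<beta> (Suc n)) \<oplus> f \<cdot> (s n \<cdot> a (Suc n))"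
      by (rule split[OF _ _ sX]) (use y Comp_eq_assoc[OF fa] in \<open>auto simp: Hom_iff\<close>)
    show "f \<in> coboundaries ?G ?d n"
    proof (cases n)
      case 0
      have "f \<cdot> \<alpha> (Suc 0) = Zero C (Y (Suc 0)) y" using fb by (simp add: 0 coboundaries_def)
      then have "f = Zero C (X (Suc 0)) y" using f_split y Comp_eq_assoc[of f "\<alpha> (Suc 0)" _ "\<beta> (Suc 0)"]
        by (simp add: 0 s0)
      then show ?thesis by (simp add: 0 coboundaries_def)
    next
      case (Suc m)
      obtain g where g: "g \<in> Hom C (Y n) y" "f \<cdot> \<alpha> (Suc n) = g \<cdot> b (Suc n)"
        using fb by (auto simp: Suc coboundaries_def)
      have [simp]: "g \<in> Arr C" "Dom C g = Y n" "Cod C g = y" using g by (auto simp: Hom_iff)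
      have "f \<cdot> (\<alpha> (Suc n) \<cdot> \<beta> (Suc n)) = g \<cdot> (\<beta> n \<cdot> a (Suc n))"
        using Comp_eq_assoc[OF g(2), of "\<beta> (Suc n)"] by (simp add: \<beta>c)
      then have "f = (g \<cdot> \<beta> n \<oplus> f \<cdot> s n) \<cdot> a (Suc n)" using f_split by simp
      moreover have "g \<cdot> \<beta> n \<oplus> f \<cdot> s n \<in> Hom C (X n) y" by (simp add: Hom_iff)
      ultimately have "f \<in> (\<lambda>h. h \<cdot> a (Suc n)) ` Hom C (X n) y" by (rule image_eqI)
      then show ?thesis by (simp add: Suc coboundaries_def)
    qed
  next
    fix f assume f: "f \<in> cocycles ?G' ?d' n"
    have [simp]: "f \<in> Arr C" "Dom C f = Y (Suc n)" "Cod C f = y" and fb: "f \<cdot> b (Suc (Suc n)) = Zero C (Y (Suc (Suc n))) y"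
      using f by (auto simp: kernel_def Hom_iff)
    have f_split: "f = f \<cdot> (\<beta> (Suc n) \<cdot> \<alpha> (Suc n)) \<oplus> f \<cdot> (t n \<cdot> b (Suc n))"
      by (rule split[OF _ _ tY]) (use y Comp_eq_assoc[OF fb] in \<open>auto simp: Hom_iff\<close>)
    have "f \<cdot> \<beta> (Suc n) \<in> cocycles ?G ?d n"
      using y Comp_eq_assoc[OF fb, of "\<beta> (Suc (Suc n))"] by (auto simp: kernel_def Hom_iff \<beta>c[symmetric])
    moreover have "f \<cdot> (t n \<cdot> b (Suc n)) \<in> coboundaries ?G' ?d' n"
    proof (cases n)
      case 0
      then show ?thesis using y by (simp add: coboundaries_def t0)
    next
      case (Suc m)
      have "f \<cdot> (t n \<cdot> b (Suc n)) = f \<cdot> t n \<cdot> b (Suc n)" "f \<cdot> t n \<in> Hom C (Y n) y"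
        by (simp_all add: Hom_iff)
      then have "f \<cdot> (t n \<cdot> b (Suc n)) \<in> (\<lambda>h. h \<cdot> b (Suc n)) ` Hom C (Y n) y" by (rule image_eqI)
      then show ?thesis by (simp add: Suc coboundaries_def)
    qed
    moreover have "f = f \<cdot> (t n \<cdot> b (Suc n)) \<otimes>\<^bsub>?G' n\<^esub> (f \<cdot> \<beta> (Suc n) \<cdot> \<alpha> (Suc n))"
      using f_split Add_commute[of "f \<cdot> (t n \<cdot> b (Suc n))" "f \<cdot> (\<beta> (Suc n) \<cdot> \<alpha> (Suc n))"] by simp
    ultimately show "\<exists>g \<in> cocycles ?G ?d n. \<exists>c \<in> coboundaries ?G' ?d' n. f = c \<otimes>\<^bsub>?G' n\<^esub> (g \<cdot> \<alpha> (Suc n))" by blast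
  qed
qed

lemma PExt_resolution:
  assumes x: "x \<in> Obj C"
  shows "\<exists>X a. resolution X a \<and> X 0 = x \<and> (\<forall>n y. PExt \<kappa> C n x y = hom_cohomology X a y n)"
proof -
  let ?R = "\<lambda>(P, d, e). pure_projective_resolution \<kappa> C x P d e"
  have "\<exists>t. ?R t" using resolution_exists[OF x] resolution_imp_pure_projective by fastforce
  then have R: "?R (SOME t. ?R t)" by (rule someI_ex)
  obtain P d e where t: "(SOME t. ?R t) = (P, d, e)" by (metis surj_pair)
  have "pure_projective_resolution \<kappa> C x P d e" using R unfolding t by simp
  note res = pure_projective_resolution_imp[OF this]
  have "PExt \<kappa> C n x y = hom_cohomology (case_nat x P) (case_nat (Zero C x x) (case_nat e d)) y n" for n y
    by (simp add: PExt_def t)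
  with res show ?thesis 
    by (intro exI[of _ "case_nat x P"] exI[of _ "case_nat (Zero C x x) (case_nat e d)"]) simp
qed

end

section \<open>The adjunction\<close>

locale definable_adjunction =
  A: small_accessible \<kappa> A + B: small_accessible \<kappa> B
  for \<kappa> :: "'u rel" and A :: "('o1, 'm1, 'z1) precat_scheme" and B :: "('o2, 'm2, 'z2) precat_scheme" +
  fixes F :: "('o1, 'm1, 'o2, 'm2) func" and \<Lambda> :: "('o2, 'm2, 'o1, 'm1) func"
  assumes F_additive: "additive_functor A B F"
    and F_filtered_colimits: "preserves_filtered_colimits \<kappa> A B F"
    and \<Lambda>_additive: "additive_functor B A \<Lambda>"
    and left_adjoint: "left_adjoint A B \<Lambda> F"
begin

lemma F_functor: "is_functor A B F" using F_additive by (simp add: additive_functor_def)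
lemma \<Lambda>_functor: "is_functor B A \<Lambda>" using \<Lambda>_additive by (simp add: additive_functor_def)

lemmas F_simps [simp] = functor_simps[OF F_functor]
  additive_functor_simps[OF F_additive A.preadditive_category_axioms B.preadditive_category_axioms]
lemmas \<Lambda>_simps [simp] = functor_simps[OF \<Lambda>_functor]
  additive_functor_simps[OF \<Lambda>_additive B.preadditive_category_axioms A.preadditive_category_axioms]

definition \<phi> :: "'o2 \<Rightarrow> 'o1 \<Rightarrow> 'm1 \<Rightarrow> 'm2" where
  "\<phi> = (SOME \<phi>. (\<forall>d \<in> Obj B. \<forall>c \<in> Obj A. bij_betw (\<phi> d c) (Hom A (FObj \<Lambda> d) c) (Hom B d (FObj F c))) \<and>
     (\<forall>d d' c c'. \<forall>g \<in> Hom B d' d. \<forall>h \<in> Hom A c c'. \<forall>f \<in> Hom A (FObj \<Lambda> d) c.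
        \<phi> d' c' (h \<cdot>\<^bsub>A\<^esub> f \<cdot>\<^bsub>A\<^esub> FArr \<Lambda> g) = FArr F h \<cdot>\<^bsub>B\<^esub> \<phi> d c f \<cdot>\<^bsub>B\<^esub> g))"

lemma \<phi>_bij: "\<lbrakk>d \<in> Obj B; c \<in> Obj A\<rbrakk> \<Longrightarrow> bij_betw (\<phi> d c) (Hom A (FObj \<Lambda> d) c) (Hom B d (FObj F c))"
  and \<phi>_natural: "\<lbrakk>g \<in> Hom B d' d; h \<in> Hom A c c'; f \<in> Hom A (FObj \<Lambda> d) c\<rbrakk>
    \<Longrightarrow> \<phi> d' c' (h \<cdot>\<^bsub>A\<^esub> f \<cdot>\<^bsub>A\<^esub> FArr \<Lambda> g) = FArr F h \<cdot>\<^bsub>B\<^esub> \<phi> d c f \<cdot>\<^bsub>B\<^esub> g"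
  using someI_ex[OF left_adjoint[unfolded left_adjoint_def], folded \<phi>_def] by blast+

lemma \<phi>_Hom:
  assumes "f \<in> Hom A (FObj \<Lambda> d) c" "d \<in> Obj B"
  shows "\<phi> d c f \<in> Hom B d (FObj F c)"
  using bij_betwE[OF \<phi>_bij[OF assms(2) A.Hom_Obj(2)[OF assms(1)]]] assms(1) by simp

lemma \<phi>_inject:
  assumes "\<phi> d c f = \<phi> d c g" "f \<in> Hom A (FObj \<Lambda> d) c" "g \<in> Hom A (FObj \<Lambda> d) c" "d \<in> Obj B"
  shows "f = g"
  using inj_onD[OF bij_betw_imp_inj_on[OF \<phi>_bij[OF assms(4) A.Hom_Obj(2)[OF assms(2)]]] assms(1-3)] .

lemma \<phi>_surject:
  assumes "g \<in> Hom B d (FObj F c)" "c \<in> Obj A"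
  shows "\<exists>f \<in> Hom A (FObj \<Lambda> d) c. \<phi> d c f = g"
proof -
  have "g \<in> \<phi> d c ` Hom A (FObj \<Lambda> d) c"
    unfolding bij_betw_imp_surj_on[OF \<phi>_bij[OF B.Hom_Obj(1)[OF assms(1)] assms(2)]] by (rule assms(1))
  then show ?thesis by auto
qed

lemma \<phi>_post:
  assumes "h \<in> Hom A c c'" "f \<in> Hom A (FObj \<Lambda> d) c" "d \<in> Obj B"
  shows "\<phi> d c' (h \<cdot>\<^bsub>A\<^esub> f) = FArr F h \<cdot>\<^bsub>B\<^esub> \<phi> d c f"
  using \<phi>_natural[OF B.Ident_in_Hom[OF assms(3)] assms(1,2)] assms \<phi>_Hom[OF assms(2,3)] by (auto simp: Hom_iff)

lemma \<phi>_pre: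
  assumes "g \<in> Hom B d' d" "f \<in> Hom A (FObj \<Lambda> d) c"
  shows "\<phi> d' c (f \<cdot>\<^bsub>A\<^esub> FArr \<Lambda> g) = \<phi> d c f \<cdot>\<^bsub>B\<^esub> g"
proof -
  have o: "d \<in> Obj B" "c \<in> Obj A" using B.Hom_Obj[OF assms(1)] A.Hom_Obj[OF assms(2)] by auto
  show ?thesis
    using \<phi>_natural[OF assms(1) A.Ident_in_Hom[OF o(2)] assms(2)] assms \<phi>_Hom[OF assms(2) o(1)] o by (auto simp: Hom_iff)
qed

text \<open>
  With the unit \<open>\<eta> = \<phi>(id)\<close> one has \<open>\<phi> h = F h \<eta>\<close>, so \<open>\<phi>\<close> is additive because \<open>F\<close> is.
\<close>

lemma \<phi>_Add:
  assumes f: "f \<in> Hom A (FObj \<Lambda> d) c" and g: "g \<in> Hom A (FObj \<Lambda> d) c" and d: "d \<in> Obj B"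
  shows "\<phi> d c (f \<oplus>\<^bsub>A\<^esub> g) = \<phi> d c f \<oplus>\<^bsub>B\<^esub> \<phi> d c g"
proof -
  let ?\<eta> = "\<phi> d (FObj \<Lambda> d) (Ident A (FObj \<Lambda> d))"
  have i: "Ident A (FObj \<Lambda> d) \<in> Hom A (FObj \<Lambda> d) (FObj \<Lambda> d)" using d by (simp add: Hom_iff)
  have \<eta>: "\<phi> d c h = FArr F h \<cdot>\<^bsub>B\<^esub> ?\<eta>" if "h \<in> Hom A (FObj \<Lambda> d) c" for h
    using \<phi>_post[OF that i d] that by (simp add: Hom_iff)
  have "f \<oplus>\<^bsub>A\<^esub> g \<in> Hom A (FObj \<Lambda> d) c" using f g by (auto simp: Hom_iff)
  then show ?thesis using \<phi>_Hom[OF i d] f g by (simp add: \<eta> Hom_iff)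
qed

lemma \<phi>_Zero:
  assumes d: "d \<in> Obj B" and c: "c \<in> Obj A"
  shows "\<phi> d c (Zero A (FObj \<Lambda> d) c) = Zero B d (FObj F c)"
proof -
  have z: "Zero A (FObj \<Lambda> d) (FObj \<Lambda> d) \<in> Hom A (FObj \<Lambda> d) (FObj \<Lambda> d)" "Zero A (FObj \<Lambda> d) c \<in> Hom A (FObj \<Lambda> d) c"
    using d c by (auto simp: Hom_iff)
  show ?thesis using \<phi>_post[OF z(2,1) d] \<phi>_Hom[OF z(1) d] d c by (simp add: Hom_iff)
qed

text \<open>
  The functor \<open>Hom(\<Lambda> x, -)\<close> is isomorphic to \<open>Hom(x, F -)\<close>, and both \<open>F\<close> and \<open>Hom(x, -)\<close>
  preserve filtered colimits.
\<close>

lemma \<Lambda>_fp: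
  assumes x: "x \<in> fp \<kappa> B" shows "FObj \<Lambda> x \<in> fp \<kappa> A"
proof (rule A.fpI)
  have xo: "x \<in> Obj B" using x by simp
  show "FObj \<Lambda> x \<in> Obj A" using xo by simp
  fix J :: "('u, 'u) cat" and T c \<iota>
  assume J: "small_filtered \<kappa> J" "is_functor J A T" "is_colimit J A T c \<iota>"
  interpret J: category J using J by (simp add: small_filtered_def)
  note T [simp] = functor_simps[OF J(2)]
  let ?T = "\<lparr>FObj = FObj F \<circ> FObj T, FArr = FArr F \<circ> FArr T\<rparr>"
  have co: "is_colimit J B ?T (FObj F c) (\<lambda>j. FArr F (\<iota> j))"
    using F_filtered_colimits[unfolded preserves_filtered_colimits_def, rule_format, of J T c \<iota>] J by simp
  have fu: "is_functor J B ?T" by (auto simp: is_functor_def Hom_iff)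
  have \<iota>: "\<iota> j \<in> Hom A (FObj T j) c" if "j \<in> Obj J" for j using J(3) that by (simp add: is_colimit_def is_cocone_def)
  have c: "c \<in> Obj A" using J(3) by (simp add: is_colimit_def is_cocone_def)
  {
    fix h assume h: "h \<in> Hom A (FObj \<Lambda> x) c"
    obtain j f where j: "j \<in> Obj J" "f \<in> Hom B x (FObj F (FObj T j))" "FArr F (\<iota> j) \<cdot>\<^bsub>B\<^esub> f = \<phi> x c h"
      using fp_factors[OF x J(1) fu co \<phi>_Hom[OF h xo]] by auto
    obtain f' where f': "f' \<in> Hom A (FObj \<Lambda> x) (FObj T j)" "\<phi> x (FObj T j) f' = f"
      using \<phi>_surject[OF j(2)] j(1) by auto
    have "\<iota> j \<cdot>\<^bsub>A\<^esub> f' = h"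
      by (rule \<phi>_inject[OF _ A.Comp_in_Hom[OF \<iota>[OF j(1)] f'(1)] h xo])
        (simp add: \<phi>_post[OF \<iota>[OF j(1)] f'(1) xo] f' j)
    then show "\<exists>j\<in>Obj J. \<exists>f\<in>Hom A (FObj \<Lambda> x) (FObj T j). \<iota> j \<cdot>\<^bsub>A\<^esub> f = h" using f' j by blast
  next
    fix i f assume i: "i \<in> Obj J" and f: "f \<in> Hom A (FObj \<Lambda> x) (FObj T i)" and z: "\<iota> i \<cdot>\<^bsub>A\<^esub> f = Zero A (FObj \<Lambda> x) c"
    have "FArr F (\<iota> i) \<cdot>\<^bsub>B\<^esub> \<phi> x (FObj T i) f = Zero B x (FObj F c)"
      using \<phi>_post[OF \<iota>[OF i] f xo] z \<phi>_Zero[OF xo c] by simp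
    moreover have "\<phi> x (FObj T i) f \<in> Hom B x (FObj ?T i)" using \<phi>_Hom[OF f xo] by simp
    ultimately have "\<exists>k. \<exists>u \<in> Hom J i k. FArr ?T u \<cdot>\<^bsub>B\<^esub> \<phi> x (FObj T i) f = Zero B x (FObj ?T k)"
      by (intro B.fp_killed_at_stage[OF x J(1) fu co i])
    then obtain k u where u: "u \<in> Hom J i k" "FArr F (FArr T u) \<cdot>\<^bsub>B\<^esub> \<phi> x (FObj T i) f = Zero B x (FObj F (FObj T k))"
      by auto
    have k: "k \<in> Obj J" using J.Hom_Obj(2)[OF u(1)] .
    have Tu: "FArr T u \<in> Hom A (FObj T i) (FObj T k)" using u by (auto simp: Hom_iff)
    have Tk: "FObj T k \<in> Obj A" using k by simp
    have "\<phi> x (FObj T k) (FArr T u \<cdot>\<^bsub>A\<^esub> f) = \<phi> x (FObj T k) (Zero A (FObj \<Lambda> x) (FObj T k))"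
      using \<phi>_post[OF Tu f xo] u(2) \<phi>_Zero[OF xo Tk] by metis
    moreover have "Zero A (FObj \<Lambda> x) (FObj T k) \<in> Hom A (FObj \<Lambda> x) (FObj T k)" using xo Tk by (simp add: Hom_iff)
    ultimately have "FArr T u \<cdot>\<^bsub>A\<^esub> f = Zero A (FObj \<Lambda> x) (FObj T k)"
      by (rule \<phi>_inject[OF _ A.Comp_in_Hom[OF Tu f] _ xo])
    then show "\<exists>k. \<exists>u\<in>Hom J i k. FArr T u \<cdot>\<^bsub>A\<^esub> f = Zero A (FObj \<Lambda> x) (FObj T k)" using u by blast
  }
qed

lemma \<Lambda>_colimit:
  assumes J: "category J" "is_functor J B T" "is_colimit J B T c \<iota>"
  shows "is_functor J A \<lparr>FObj = FObj \<Lambda> \<circ> FObj T, FArr = FArr \<Lambda> \<circ> FArr T\<rparr>" (is "is_functor J A ?T")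
    and "is_colimit J A \<lparr>FObj = FObj \<Lambda> \<circ> FObj T, FArr = FArr \<Lambda> \<circ> FArr T\<rparr> (FObj \<Lambda> c) (\<lambda>j. FArr \<Lambda> (\<iota> j))"
proof -
  interpret J: category J by fact
  note T [simp] = functor_simps[OF J(2)]
  show "is_functor J A ?T" by (auto simp: is_functor_def Hom_iff)
  have c [simp]: "c \<in> Obj B" and \<iota>: "\<And>j. j \<in> Obj J \<Longrightarrow> \<iota> j \<in> Hom B (FObj T j) c"
    and \<iota>c: "\<And>i j u. u \<in> Hom J i j \<Longrightarrow> \<iota> j \<cdot>\<^bsub>B\<^esub> FArr T u = \<iota> i"
    using J(3) by (simp_all add: is_colimit_def is_cocone_def)
  have \<Lambda>\<iota>: "FArr \<Lambda> (\<iota> j) \<in> Hom A (FObj \<Lambda> (FObj T j)) (FObj \<Lambda> c)" if "j \<in> Obj J" for j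
    using \<iota>[OF that] by (auto simp: Hom_iff)
  show "is_colimit J A ?T (FObj \<Lambda> c) (\<lambda>j. FArr \<Lambda> (\<iota> j))"
    unfolding is_colimit_def
  proof (intro conjI allI impI)
    have "FArr \<Lambda> (\<iota> j) \<cdot>\<^bsub>A\<^esub> FArr \<Lambda> (FArr T u) = FArr \<Lambda> (\<iota> i)" if u: "u \<in> Hom J i j" for i j u
    proof -
      have "FArr \<Lambda> (\<iota> j \<cdot>\<^bsub>B\<^esub> FArr T u) = FArr \<Lambda> (\<iota> j) \<cdot>\<^bsub>A\<^esub> FArr \<Lambda> (FArr T u)"
        using \<iota>[OF J.Hom_Obj(2)[OF u]] u by (intro \<Lambda>_simps) (auto simp: Hom_iff)
      then show ?thesis using \<iota>c[OF u] by simp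
    qed
    then show "is_cocone J A ?T (FObj \<Lambda> c) (\<lambda>j. FArr \<Lambda> (\<iota> j))"
      using \<Lambda>\<iota> by (simp add: is_cocone_def)
    fix x \<tau> assume t: "is_cocone J A ?T x \<tau>"
    have x: "x \<in> Obj A" and \<tau>: "\<And>j. j \<in> Obj J \<Longrightarrow> \<tau> j \<in> Hom A (FObj \<Lambda> (FObj T j)) x"
      and \<tau>c: "\<And>i j u. u \<in> Hom J i j \<Longrightarrow> \<tau> j \<cdot>\<^bsub>A\<^esub> FArr \<Lambda> (FArr T u) = \<tau> i"
      using t by (simp_all add: is_cocone_def)
    let ?\<tau> = "\<lambda>j. \<phi> (FObj T j) x (\<tau> j)"
    have tr: "h \<cdot>\<^bsub>A\<^esub> FArr \<Lambda> (\<iota> j) = \<tau> j \<longleftrightarrow> \<phi> c x h \<cdot>\<^bsub>B\<^esub> \<iota> j = ?\<tau> j"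
      if h: "h \<in> Hom A (FObj \<Lambda> c) x" and j: "j \<in> Obj J" for h j
    proof -
      have "\<phi> c x h \<cdot>\<^bsub>B\<^esub> \<iota> j = \<phi> (FObj T j) x (h \<cdot>\<^bsub>A\<^esub> FArr \<Lambda> (\<iota> j))" using \<phi>_pre[OF \<iota>[OF j] h] by simp
      then show ?thesis using \<phi>_inject[OF _ A.Comp_in_Hom[OF h \<Lambda>\<iota>[OF j]] \<tau>[OF j]] j by auto
    qed
    have "is_cocone J B T (FObj F x) ?\<tau>"
      unfolding is_cocone_def
    proof (intro conjI ballI allI)
      show "FObj F x \<in> Obj B" using x by simp
      show "?\<tau> j \<in> Hom B (FObj T j) (FObj F x)" if "j \<in> Obj J" for j using \<phi>_Hom[OF \<tau>[OF that]] that by simp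
      fix i j u assume u: "u \<in> Hom J i j"
      have Tu: "FArr T u \<in> Hom B (FObj T i) (FObj T j)" using u by (auto simp: Hom_iff)
      show "?\<tau> j \<cdot>\<^bsub>B\<^esub> FArr T u = ?\<tau> i"
        using \<phi>_pre[OF Tu \<tau>[OF J.Hom_Obj(2)[OF u]]] \<tau>c[OF u] by simp
    qed
    note ex = is_colimit_map[OF J(3) this]
    then obtain g where g: "g \<in> Hom B c (FObj F x)" "\<forall>j \<in> Obj J. g \<cdot>\<^bsub>B\<^esub> \<iota> j = ?\<tau> j" by blast
    obtain h where h: "h \<in> Hom A (FObj \<Lambda> c) x" "\<phi> c x h = g" using \<phi>_surject[OF g(1) x] by blast
    show "\<exists>!h. h \<in> Hom A (FObj \<Lambda> c) x \<and> (\<forall>j\<in>Obj J. h \<cdot>\<^bsub>A\<^esub> FArr \<Lambda> (\<iota> j) = \<tau> j)"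
    proof (intro ex1I[of _ h] conjI ballI)
      show "h \<in> Hom A (FObj \<Lambda> c) x" by fact
      show "h \<cdot>\<^bsub>A\<^esub> FArr \<Lambda> (\<iota> j) = \<tau> j" if "j \<in> Obj J" for j using tr[OF h(1) that] g(2) h(2) that by simp
      fix h' assume h': "h' \<in> Hom A (FObj \<Lambda> c) x \<and> (\<forall>j\<in>Obj J. h' \<cdot>\<^bsub>A\<^esub> FArr \<Lambda> (\<iota> j) = \<tau> j)"
      then have "\<phi> c x h' \<in> Hom B c (FObj F x) \<and> (\<forall>j\<in>Obj J. \<phi> c x h' \<cdot>\<^bsub>B\<^esub> \<iota> j = ?\<tau> j)"
        using tr[of h'] \<phi>_Hom[of h' c x] by simp
      then have "\<phi> c x h' = g" using ex1_unique[OF ex] g by blast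
      then show "h' = h" using \<phi>_inject[of c x h' h] h h' by simp
    qed
  qed
qed

text \<open>
  The relation \<open>\<Lambda> k u = 0\<close> holds at a finitely presented stage of \<open>y\<close>: \<open>\<Lambda>\<close> preserves the
  colimit that presents \<open>y\<close>, and \<open>c\<close> is finitely presented.
\<close>

lemma \<Lambda>_stage_kills:
  assumes D: "D \<in> fp \<kappa> B" and c: "c \<in> fp \<kappa> A" and k: "k \<in> Hom B D y" and u: "u \<in> Hom A c (FObj \<Lambda> D)"
    and ku: "FArr \<Lambda> k \<cdot>\<^bsub>A\<^esub> u = Zero A c (FObj \<Lambda> y)"
  shows "\<exists>E \<in> fp \<kappa> B. \<exists>w \<in> Hom B D E. \<exists>k' \<in> Hom B E y. k' \<cdot>\<^bsub>B\<^esub> w = k \<and> FArr \<Lambda> w \<cdot>\<^bsub>A\<^esub> u = Zero A c (FObj \<Lambda> E)"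
proof -
  obtain J :: "('u, 'u) cat" and T \<iota> where J: "small_filtered \<kappa> J" "is_functor J B T"
    "is_colimit J B T y \<iota>" "\<forall>j \<in> Obj J. FObj T j \<in> fp \<kappa> B \<and> \<iota> j \<in> Hom B (FObj T j) y"
    using B.fp_presentation[OF B.Hom_Obj(2)[OF k]] by blast
  interpret J: category J using J by (simp add: small_filtered_def)
  note [simp] = functor_simps[OF J(2)]
  note \<Lambda>J = \<Lambda>_colimit[OF J.category_axioms J(2,3)]
  obtain j f where j: "j \<in> Obj J" "f \<in> Hom B D (FObj T j)" "\<iota> j \<cdot>\<^bsub>B\<^esub> f = k"
    using fp_factors[OF D J(1-3) k] by blast
  have i: "\<iota> j \<in> Hom B (FObj T j) y" using J(4) j by blast
  have [simp]: "f \<in> Arr B" "Dom B f = D" "Cod B f = FObj T j" "\<iota> j \<in> Arr B" "Dom B (\<iota> j) = FObj T j" "Cod B (\<iota> j) = y"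
    "u \<in> Arr A" "Dom A u = c" "Cod A u = FObj \<Lambda> D" using i j u by (auto simp: Hom_iff)
  have \<Lambda>k: "FArr \<Lambda> (\<iota> j) \<cdot>\<^bsub>A\<^esub> FArr \<Lambda> f = FArr \<Lambda> k" unfolding j(3)[symmetric] by simp
  have fu: "FArr \<Lambda> f \<cdot>\<^bsub>A\<^esub> u \<in> Hom A c (FObj \<lparr>FObj = FObj \<Lambda> \<circ> FObj T, FArr = FArr \<Lambda> \<circ> FArr T\<rparr> j)"
    "FArr \<Lambda> (\<iota> j) \<cdot>\<^bsub>A\<^esub> (FArr \<Lambda> f \<cdot>\<^bsub>A\<^esub> u) = Zero A c (FObj \<Lambda> y)"
    using ku A.Comp_eq_assoc[OF \<Lambda>k, of u] by (auto simp: Hom_iff)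
  obtain m v where v: "v \<in> Hom J j m" "FArr \<Lambda> (FArr T v) \<cdot>\<^bsub>A\<^esub> (FArr \<Lambda> f \<cdot>\<^bsub>A\<^esub> u) = Zero A c (FObj \<Lambda> (FObj T m))"
    using A.fp_killed_at_stage[OF c J(1) \<Lambda>J j(1) fu] by auto
  have m: "m \<in> Obj J" using J.Hom_Obj(2)[OF v(1)] .
  have im: "\<iota> m \<cdot>\<^bsub>B\<^esub> FArr T v = \<iota> j" using J(3) v(1) unfolding is_colimit_def is_cocone_def by blast
  have mH: "\<iota> m \<in> Hom B (FObj T m) y" using J(4) m by blast
  have [simp]: "v \<in> Arr J" "Dom J v = j" "Cod J v = m" using v by (auto simp: Hom_iff)
  have "FArr T v \<cdot>\<^bsub>B\<^esub> f \<in> Hom B D (FObj T m)" by (simp add: Hom_iff)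
  moreover have "FArr \<Lambda> (FArr T v \<cdot>\<^bsub>B\<^esub> f) \<cdot>\<^bsub>A\<^esub> u = Zero A c (FObj \<Lambda> (FObj T m))" using v(2) by simp
  moreover have "\<iota> m \<cdot>\<^bsub>B\<^esub> (FArr T v \<cdot>\<^bsub>B\<^esub> f) = k" using B.Comp_eq_assoc[OF im, of f] mH j(3) by (simp add: Hom_iff)
  ultimately show ?thesis using J(4) m mH by blast
qed

text \<open>
  In a resolution the stage can moreover be chosen among cycles, by \<open>kernel_factorization\<close> for the
  relation \<open>\<Lambda> w u = 0\<close>. At \<open>n = 0\<close> every arrow is a cycle.
\<close>

lemma \<Lambda>_kernel_factorization:
  assumes X: "B.resolution X a" and D: "D \<in> fp \<kappa> B" and c: "c \<in> fp \<kappa> A"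
    and k: "k \<in> Hom B D (X n)" "a n \<cdot>\<^bsub>B\<^esub> k = Zero B D (X (n - 1))"
    and u: "u \<in> Hom A c (FObj \<Lambda> D)" "FArr \<Lambda> k \<cdot>\<^bsub>A\<^esub> u = Zero A c (FObj \<Lambda> (X n))"
  shows "\<exists>E \<in> fp \<kappa> B. \<exists>w \<in> Hom B D E. \<exists>k' \<in> Hom B E (X n).
    k' \<cdot>\<^bsub>B\<^esub> w = k \<and> a n \<cdot>\<^bsub>B\<^esub> k' = Zero B E (X (n - 1)) \<and> FArr \<Lambda> w \<cdot>\<^bsub>A\<^esub> u = Zero A c (FObj \<Lambda> E)"
proof (cases n)
  case 0
  obtain E w k' where E: "E \<in> fp \<kappa> B" "w \<in> Hom B D E" "k' \<in> Hom B E (X n)" "k' \<cdot>\<^bsub>B\<^esub> w = k"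
      "FArr \<Lambda> w \<cdot>\<^bsub>A\<^esub> u = Zero A c (FObj \<Lambda> E)"
    using \<Lambda>_stage_kills[OF D c k(1) u] by blast
  moreover have "a n \<cdot>\<^bsub>B\<^esub> k' = Zero B E (X (n - 1))"
    using B.resolutionD(2)[OF X] B.resolutionD(5)[OF X, of 0] E(3) by (auto simp: 0 Hom_iff)
  ultimately show ?thesis by blast
next
  case (Suc m)
  note R = B.resolutionD[OF X]
  show ?thesis
    using B.kernel_factorization[OF R(3)[of m] B.resolution_flat_kernel[OF X] D, of k
        "\<lambda>E w. FArr \<Lambda> w \<cdot>\<^bsub>A\<^esub> u = Zero A c (FObj \<Lambda> E)"] k \<Lambda>_stage_kills[OF D c k(1) u] R(7,8)[of n]
    by (simp add: Suc)
qed

text \<open>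
  A cycle \<open>h : c \<rightarrow> \<Lambda> (X n)\<close> is written as \<open>\<Lambda> k h0\<close> for an arrow \<open>k\<close> from a finitely presented
  object \<open>D\<close>. Although \<open>a k\<close> may be nonzero, it is a cycle whose image under \<open>\<Lambda>\<close> vanishes on \<open>h0\<close>;
  hence it factors as a cycle \<open>q\<close> after some \<open>w\<close> with \<open>\<Lambda> w h0 = 0\<close>. As \<open>q\<close> is a boundary,
  \<open>k\<close> can be corrected by a multiple of \<open>w\<close> to a cycle in \<open>B\<close>, which is a boundary by exactness,
  and the correction does not change \<open>\<Lambda> k h0\<close>.
\<close>

lemma \<Lambda>_fp_exact:
  assumes X: "B.resolution X a"
  shows "A.fp_exact (FArr \<Lambda> (a (Suc n))) (FArr \<Lambda> (a n))"
  unfolding A.fp_exact_def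
proof (intro conjI ballI impI)
  note R = B.resolutionD[OF X]
  have [simp]: "a i \<in> Arr B" "Dom B (a i) = X i" "Cod B (a i) = X (i - 1)" "X i \<in> Obj B" for i
    using R by auto
  show "FArr \<Lambda> (a (Suc n)) \<in> Arr A" "FArr \<Lambda> (a n) \<in> Arr A" "Cod A (FArr \<Lambda> (a (Suc n))) = Dom A (FArr \<Lambda> (a n))"
    by simp_all
  have "FArr \<Lambda> (a n) \<cdot>\<^bsub>A\<^esub> FArr \<Lambda> (a (Suc n)) = FArr \<Lambda> (a n \<cdot>\<^bsub>B\<^esub> a (Suc n))" by simp
  also have "\<dots> = Zero A (Dom A (FArr \<Lambda> (a (Suc n)))) (Cod A (FArr \<Lambda> (a n)))" by (simp add: R(9) del: \<Lambda>_simps(6))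
  finally show "FArr \<Lambda> (a n) \<cdot>\<^bsub>A\<^esub> FArr \<Lambda> (a (Suc n)) = Zero A (Dom A (FArr \<Lambda> (a (Suc n)))) (Cod A (FArr \<Lambda> (a n)))" .
  fix c h assume c: "c \<in> fp \<kappa> A" and "h \<in> Hom A c (Dom A (FArr \<Lambda> (a n)))"
    and "FArr \<Lambda> (a n) \<cdot>\<^bsub>A\<^esub> h = Zero A c (Cod A (FArr \<Lambda> (a n)))"
  then have h: "h \<in> Hom A c (FObj \<Lambda> (X n))" and hz: "FArr \<Lambda> (a n) \<cdot>\<^bsub>A\<^esub> h = Zero A c (FObj \<Lambda> (X (n - 1)))" by simp_all
  obtain J :: "('u, 'u) cat" and T \<iota> where J: "small_filtered \<kappa> J" "is_functor J B T"
    "is_colimit J B T (X n) \<iota>" "\<forall>j \<in> Obj J. FObj T j \<in> fp \<kappa> B \<and> \<iota> j \<in> Hom B (FObj T j) (X n)"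
    using B.fp_presentation[of "X n"] by auto
  have "category J" using J(1) by (simp add: small_filtered_def)
  note \<Lambda>J = \<Lambda>_colimit[OF this J(2,3)]
  obtain j h0 where j: "j \<in> Obj J" "h0 \<in> Hom A c (FObj \<Lambda> (FObj T j))" "FArr \<Lambda> (\<iota> j) \<cdot>\<^bsub>A\<^esub> h0 = h"
    using fp_factors[OF c J(1) \<Lambda>J h] by auto
  define D k where "D = FObj T j" and "k = \<iota> j"
  have D: "D \<in> fp \<kappa> B" and k: "k \<in> Hom B D (X n)" and h0: "h0 \<in> Hom A c (FObj \<Lambda> D)" "FArr \<Lambda> k \<cdot>\<^bsub>A\<^esub> h0 = h"
    using J(4) j by (auto simp: D_def k_def)
  have [simp]: "k \<in> Arr B" "Dom B k = D" "Cod B k = X n" "h0 \<in> Arr A" "Dom A h0 = c" "Cod A h0 = FObj \<Lambda> D" "D \<in> Obj B"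
    using k h0 D by (auto simp: Hom_iff)
  show "\<exists>h' \<in> Hom A c (Dom A (FArr \<Lambda> (a (Suc n)))). FArr \<Lambda> (a (Suc n)) \<cdot>\<^bsub>A\<^esub> h' = h"
  proof -
    have "\<exists>k0 \<in> Hom B D (X n). a n \<cdot>\<^bsub>B\<^esub> k0 = Zero B D (X (n - 1)) \<and> FArr \<Lambda> k0 \<cdot>\<^bsub>A\<^esub> h0 = h"
    proof (cases n)
      case 0
      have "a n \<cdot>\<^bsub>B\<^esub> k = Zero B D (X (n - 1))" using 0 R(2) by simp
      then show ?thesis using k h0(2) by blast
    next
      case (Suc m)
      have 1: "a n \<cdot>\<^bsub>B\<^esub> k \<in> Hom B D (X m)" by (simp add: Hom_iff Suc)
      have 2: "a m \<cdot>\<^bsub>B\<^esub> (a n \<cdot>\<^bsub>B\<^esub> k) = Zero B D (X (m - 1))"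
        using B.Comp_eq_assoc[OF R(9)[of m], of k] by (simp add: Suc)
      have 3: "FArr \<Lambda> (a n \<cdot>\<^bsub>B\<^esub> k) \<cdot>\<^bsub>A\<^esub> h0 = Zero A c (FObj \<Lambda> (X m))"
        using hz h0(2) by (simp add: Suc)
      obtain E w q where E: "E \<in> fp \<kappa> B" "w \<in> Hom B D E" "q \<in> Hom B E (X m)" "q \<cdot>\<^bsub>B\<^esub> w = a n \<cdot>\<^bsub>B\<^esub> k"
          "a m \<cdot>\<^bsub>B\<^esub> q = Zero B E (X (m - 1))" "FArr \<Lambda> w \<cdot>\<^bsub>A\<^esub> h0 = Zero A c (FObj \<Lambda> E)"
        using \<Lambda>_kernel_factorization[OF X D c 1 2 h0(1) 3] by blast
      obtain q' where q': "q' \<in> Hom B E (X n)" "a n \<cdot>\<^bsub>B\<^esub> q' = q"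
        using R(3)[of m] E(1,3,5) by (auto simp: B.fp_exact_def Suc)
      have [simp]: "w \<in> Arr B" "Dom B w = D" "Cod B w = E" "q' \<in> Arr B" "Dom B q' = E" "Cod B q' = X n" "c \<in> Obj A"
        using E q' c by (auto simp: Hom_iff)
      let ?k = "k \<ominus>\<^bsub>B\<^esub> q' \<cdot>\<^bsub>B\<^esub> w"
      have "a n \<cdot>\<^bsub>B\<^esub> ?k = Zero B D (X (n - 1))"
        using B.Comp_eq_assoc[OF q'(2), of w] E(4) by simp
      moreover have "FArr \<Lambda> ?k \<cdot>\<^bsub>A\<^esub> h0 = h" using E(6) h0(2) h by (auto simp: Hom_iff)
      moreover have "?k \<in> Hom B D (X n)" by (simp add: Hom_iff)
      ultimately show ?thesis by blast
    qed
    then obtain k0 where k0: "k0 \<in> Hom B D (X n)" "a n \<cdot>\<^bsub>B\<^esub> k0 = Zero B D (X (n - 1))" "FArr \<Lambda> k0 \<cdot>\<^bsub>A\<^esub> h0 = h"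
      by blast
    obtain k1 where k1: "k1 \<in> Hom B D (X (Suc n))" "a (Suc n) \<cdot>\<^bsub>B\<^esub> k1 = k0"
      using R(3)[of n] D k0 by (auto simp: B.fp_exact_def)
    have \<Lambda>k: "FArr \<Lambda> (a (Suc n)) \<cdot>\<^bsub>A\<^esub> FArr \<Lambda> k1 = FArr \<Lambda> k0" unfolding k1(2)[symmetric] using k1(1) by (auto simp: Hom_iff)
    have "FArr \<Lambda> (a (Suc n)) \<cdot>\<^bsub>A\<^esub> (FArr \<Lambda> k1 \<cdot>\<^bsub>A\<^esub> h0) = h"
      using A.Comp_eq_assoc[OF \<Lambda>k, of h0] k1(1) k0(3) by (auto simp: Hom_iff)
    moreover have "FArr \<Lambda> k1 \<cdot>\<^bsub>A\<^esub> h0 \<in> Hom A c (FObj \<Lambda> (X (Suc n)))" using k1(1) by (auto simp: Hom_iff)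
    ultimately show ?thesis by auto
  qed
qed

text \<open>
  Transposition turns a lifting problem for \<open>\<Lambda> P\<close> along \<open>u\<close> into one for \<open>P\<close> along \<open>F u\<close>. The
  restrictions to finitely presented \<open>c\<close> of the latter correspond to restrictions to \<open>\<Lambda> c\<close>, which is
  again finitely presented.
\<close>

lemma \<Lambda>_pure_lifting:
  assumes P: "B.pure_lifting P" shows "A.pure_lifting (FObj \<Lambda> P)"
  unfolding A.pure_lifting_def
proof (intro conjI allI ballI impI)
  have Po: "P \<in> Obj B" using P by (simp add: B.pure_lifting_def)
  then show "FObj \<Lambda> P \<in> Obj A" by simp
  fix y z u h assume u: "u \<in> Hom A y z" and h: "h \<in> Hom A (FObj \<Lambda> P) z"
    and l: "\<forall>c\<in>fp \<kappa> A. \<forall>l\<in>Hom A c (FObj \<Lambda> P). \<exists>l'\<in>Hom A c y. u \<cdot>\<^bsub>A\<^esub> l' = h \<cdot>\<^bsub>A\<^esub> l"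
  have y: "y \<in> Obj A" using A.Hom_Obj(1)[OF u] .
  have Fu: "FArr F u \<in> Hom B (FObj F y) (FObj F z)" using u by (auto simp: Hom_iff)
  have "\<exists>m'\<in>Hom B c (FObj F y). FArr F u \<cdot>\<^bsub>B\<^esub> m' = \<phi> P z h \<cdot>\<^bsub>B\<^esub> m" if c: "c \<in> fp \<kappa> B" and m: "m \<in> Hom B c P" for c m
  proof -
    have co: "c \<in> Obj B" using c by simp
    have \<Lambda>m: "FArr \<Lambda> m \<in> Hom A (FObj \<Lambda> c) (FObj \<Lambda> P)" using m by (auto simp: Hom_iff)
    obtain l' where l': "l' \<in> Hom A (FObj \<Lambda> c) y" "u \<cdot>\<^bsub>A\<^esub> l' = h \<cdot>\<^bsub>A\<^esub> FArr \<Lambda> m"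
      using l \<Lambda>_fp[OF c] \<Lambda>m by blast
    have "FArr F u \<cdot>\<^bsub>B\<^esub> \<phi> c y l' = \<phi> P z h \<cdot>\<^bsub>B\<^esub> m"
      using \<phi>_post[OF u l'(1) co] \<phi>_pre[OF m h] l'(2) by simp
    then show ?thesis using \<phi>_Hom[OF l'(1) co] by blast
  qed
  then obtain g where g: "g \<in> Hom B P (FObj F y)" "FArr F u \<cdot>\<^bsub>B\<^esub> g = \<phi> P z h"
    using P Fu \<phi>_Hom[OF h Po] unfolding B.pure_lifting_def by blast
  obtain h' where h': "h' \<in> Hom A (FObj \<Lambda> P) y" "\<phi> P y h' = g" using \<phi>_surject[OF g(1) y] by blast
  have "u \<cdot>\<^bsub>A\<^esub> h' = h"
    by (rule \<phi>_inject[OF _ A.Comp_in_Hom[OF u h'(1)] h Po]) (simp add: \<phi>_post[OF u h'(1) Po] h' g)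
  then show "\<exists>h'\<in>Hom A (FObj \<Lambda> P) y. u \<cdot>\<^bsub>A\<^esub> h' = h" using h' by blast
qed

lemma \<Lambda>_resolution:
  assumes X: "B.resolution X a"
  shows "A.resolution (\<lambda>n. FObj \<Lambda> (X n)) (\<lambda>n. FArr \<Lambda> (a n))"
  unfolding A.resolution_def
proof (intro conjI allI)
  note R = B.resolutionD[OF X]
  show "FArr \<Lambda> (a n) \<in> Hom A (FObj \<Lambda> (X n)) (FObj \<Lambda> (X (n - 1)))" for n using R(6-8) by (simp add: Hom_iff)
  show "FArr \<Lambda> (a 0) = Zero A (FObj \<Lambda> (X 0)) (FObj \<Lambda> (X 0))" using R(2,5) by simp
  show "A.fp_exact (FArr \<Lambda> (a (Suc n))) (FArr \<Lambda> (a n))" for n by (rule \<Lambda>_fp_exact[OF X])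
  show "A.pure_lifting (FObj \<Lambda> (X (Suc n)))" for n by (rule \<Lambda>_pure_lifting[OF R(4)])
qed

lemma adjoint_cohomology:
  assumes X: "B.resolution X a" and y: "y \<in> Obj A"
  shows "B.hom_cohomology X a (FObj F y) n \<cong> A.hom_cohomology (\<lambda>n. FObj \<Lambda> (X n)) (\<lambda>n. FArr \<Lambda> (a n)) y n"
proof -
  note R = B.resolutionD[OF X]
  have [simp]: "X i \<in> Obj B" for i using R(5) .
  have a: "a (Suc i) \<in> Hom B (X (Suc i)) (X i)" for i using R(1)[of "Suc i"] by simp
  have \<Lambda>a: "FArr \<Lambda> (a (Suc i)) \<in> Hom A (FObj \<Lambda> (X (Suc i))) (FObj \<Lambda> (X i))" for i using a[of i] by (simp add: Hom_iff)
  have Fy: "FObj F y \<in> Obj B" using y by simp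
  let ?G = "\<lambda>k. hom_group A (FObj \<Lambda> (X (Suc k))) y" and ?d = "\<lambda>k f. f \<cdot>\<^bsub>A\<^esub> FArr \<Lambda> (a (Suc (Suc k)))"
  let ?G' = "\<lambda>k. hom_group B (X (Suc k)) (FObj F y)" and ?d' = "\<lambda>k f. f \<cdot>\<^bsub>B\<^esub> a (Suc (Suc k))"
  let ?\<phi> = "\<lambda>k. \<phi> (X (Suc k)) y"
  have comm: "?\<phi> (Suc k) (?d k f) = ?d' k (?\<phi> k f)" if "f \<in> Hom A (FObj \<Lambda> (X (Suc k))) y" for f k
    using \<phi>_pre[OF a that] .
  have \<phi>0: "\<phi> (X k) y (Zero A (FObj \<Lambda> (X k)) y) = Zero B (X k) (FObj F y)" for k using \<phi>_Zero y by simp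
  have G': "comm_group (?G' n)" using B.comm_group_hom_group Fy by simp
  show ?thesis
  proof (rule cohomology_iso[where \<phi> = ?\<phi>, OF A.hom_complex[OF \<Lambda>_resolution[OF X] y] B.hom_complex[OF X Fy]])
    show "?\<phi> k \<in> hom (?G k) (?G' k)" for k
      using \<phi>_Add \<phi>_Hom by (auto simp: hom_def)
    show "?\<phi> (Suc k) (?d k f) = ?d' k (?\<phi> k f)" if "f \<in> carrier (?G k)" for f k using comm that by simp
  next
    fix f assume f: "f \<in> cocycles ?G ?d n" and fb: "?\<phi> n f \<in> coboundaries ?G' ?d' n"
    have fH: "f \<in> Hom A (FObj \<Lambda> (X (Suc n))) y" using f by (simp add: kernel_def)
    show "f \<in> coboundaries ?G ?d n"
    proof (cases n)
      case 0
      then have "?\<phi> n f = ?\<phi> n (Zero A (FObj \<Lambda> (X (Suc n))) y)" using fb \<phi>0 by (simp add: coboundaries_def)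
      then have "f = Zero A (FObj \<Lambda> (X (Suc n))) y" by (rule \<phi>_inject) (use fH y in \<open>auto simp: Hom_iff\<close>)
      then show ?thesis by (simp add: 0 coboundaries_def)
    next
      case (Suc m)
      obtain g where g: "g \<in> Hom B (X (Suc m)) (FObj F y)" "?\<phi> n f = ?d' m g"
        using fb by (auto simp: Suc coboundaries_def)
      obtain g' where g': "g' \<in> Hom A (FObj \<Lambda> (X (Suc m))) y" "?\<phi> m g' = g" using \<phi>_surject[OF g(1) y] by blast
      have "?\<phi> n f = ?\<phi> n (?d m g')" using comm[OF g'(1)] g(2) g'(2) by (simp add: Suc)
      then have "f = ?d m g'"
        by (rule \<phi>_inject) (use fH A.Comp_in_Hom[OF g'(1) \<Lambda>a] in \<open>auto simp: Suc\<close>)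
      then have "f \<in> ?d m ` Hom A (FObj \<Lambda> (X (Suc m))) y" using g'(1) by (rule image_eqI)
      then show ?thesis by (simp add: Suc coboundaries_def)
    qed
  next
    fix g assume g: "g \<in> cocycles ?G' ?d' n"
    have gH: "g \<in> Hom B (X (Suc n)) (FObj F y)" and gz: "?d' n g = Zero B (X (Suc (Suc n))) (FObj F y)"
      using g by (auto simp: kernel_def)
    obtain f where f: "f \<in> Hom A (FObj \<Lambda> (X (Suc n))) y" "?\<phi> n f = g" using \<phi>_surject[OF gH y] by blast
    have "?\<phi> (Suc n) (?d n f) = ?\<phi> (Suc n) (Zero A (FObj \<Lambda> (X (Suc (Suc n)))) y)"
      using comm[OF f(1)] f(2) gz \<phi>0 by simp
    then have "?d n f = Zero A (FObj \<Lambda> (X (Suc (Suc n)))) y"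
      by (rule \<phi>_inject) (use A.Comp_in_Hom[OF f(1) \<Lambda>a] y in \<open>auto simp: Hom_iff\<close>)
    then have "f \<in> cocycles ?G ?d n" using f by (simp add: kernel_def)
    moreover have "\<one>\<^bsub>?G' n\<^esub> \<in> coboundaries ?G' ?d' n"
      using subgroup.one_closed[OF cochain_complex_groups(2)[OF B.hom_complex[OF X Fy]]] by simp
    moreover have "g = \<one>\<^bsub>?G' n\<^esub> \<otimes>\<^bsub>?G' n\<^esub> ?\<phi> n f" using gH f(2) by (auto simp: Hom_iff)
    ultimately show "\<exists>f \<in> cocycles ?G ?d n. \<exists>b \<in> coboundaries ?G' ?d' n. g = b \<otimes>\<^bsub>?G' n\<^esub> ?\<phi> n f" by blast
  qed
qed

lemma PExt_adjunction:
  assumes y: "y \<in> Obj A" and x: "x \<in> Obj B"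
  shows "PExt \<kappa> B n x (FObj F y) \<cong> PExt \<kappa> A n (FObj \<Lambda> x) y"
proof -
  obtain X a where X: "B.resolution X a" "X 0 = x" "\<forall>n z. PExt \<kappa> B n x z = B.hom_cohomology X a z n"
    using B.PExt_resolution[OF x] by blast
  have "FObj \<Lambda> x \<in> Obj A" using x by simp
  then obtain Y b where Y: "A.resolution Y b" "Y 0 = FObj \<Lambda> x" "\<forall>n z. PExt \<kappa> A n (FObj \<Lambda> x) z = A.hom_cohomology Y b z n"
    using A.PExt_resolution by blast
  have "PExt \<kappa> B n x (FObj F y) = B.hom_cohomology X a (FObj F y) n" using X(3) by blast
  also have "\<dots> \<cong> A.hom_cohomology (\<lambda>n. FObj \<Lambda> (X n)) (\<lambda>n. FArr \<Lambda> (a n)) y n"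
    by (rule adjoint_cohomology[OF X(1) y])
  also have "\<dots> \<cong> A.hom_cohomology Y b y n"
    by (rule A.resolution_independence[OF Y(1) \<Lambda>_resolution[OF X(1)] _ y]) (simp add: X(2) Y(2))
  also have "\<dots> = PExt \<kappa> A n (FObj \<Lambda> x) y" using Y(3) by simp
  finally show ?thesis .
qed

end

theorem theorem2:
  fixes \<kappa> :: "'u rel"
    and A :: "('o1, 'm1) precat" and B :: "('o2, 'm2) precat"
    and F :: "('o1, 'm1, 'o2, 'm2) func" and \<Lambda> :: "('o2, 'm2, 'o1, 'm1) func"
    and n :: nat
  assumes "inaccessible \<kappa>"
    and "finitely_accessible_with_products \<kappa> A"
    and "finitely_accessible_with_products \<kappa> B"
    and "definable_functor \<kappa> A B F"
    and "additive_functor B A \<Lambda>"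
    and "left_adjoint A B \<Lambda> F"
    and "a \<in> Obj A" and "b \<in> Obj B"
  shows "PExt \<kappa> B n b (FObj F a) \<cong> PExt \<kappa> A n (FObj \<Lambda> b) a"
proof -
  interpret definable_adjunction \<kappa> A B F \<Lambda>
    using assms(1-6)
    by (simp add: definable_adjunction_def definable_adjunction_axioms_def small_accessible_def
        small_accessible_axioms_def definable_functor_def)
  show ?thesis using PExt_adjunction assms(7,8) .
qed

end
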